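(* Let $0<\beta\le 1$, $1<\alpha<2$, $\eta>0$, and for $t>0$, $x\in\mathbb{R}\setminus\{0\}$ let $$N(x,t)=\frac{t^{\beta-1}}{\alpha|x|}\,H^{2,1}_{3,3}\left[\frac{|x|}{(\eta t^{\beta})^{1/\alpha}}\,\middle|\,\begin{matrix}(1,1/\alpha),(\beta,\beta/\alpha),(1,1/2)\\(1,1),(1,1/\alpha),(1,1/2)\end{matrix}\right].$$ Then $$N(x,t)\sim\frac{\Gamma\left(1+\frac1\alpha\right)\Gamma\left(1-\frac1\alpha\right)}{\pi\,\eta^{1/\alpha}\,t^{1+\beta/\alpha-\beta}\,\Gamma\left(\beta-\frac{\beta}{\alpha}\right)}\qquad\text{for}\quad \frac{|x|}{(\eta t^{\beta})^{1/\alpha}}\ll 1,$$ i.e. the ratio of the two sides tends to $1$ as $|x|/(\eta t^{\beta})^{1/\alpha}\to0$.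
   Context: The H-function is the Mellin-Barnes integral $$H^{m,n}_{p,q}\left[z\,\middle|\,\begin{matrix}(a_1,A_1),\dots,(a_p,A_p)\\(b_1,B_1),\dots,(b_q,B_q)\end{matrix}\right]=\frac{1}{2\pi i}\int_{\Omega}\theta(\xi)z^{-\xi}\,d\xi,\qquad \theta(\xi)=\frac{\prod_{j=1}^m\Gamma(b_j+B_j\xi)\prod_{j=1}^n\Gamma(1-a_j-A_j\xi)}{\prod_{j=m+1}^q\Gamma(1-b_j-B_j\xi)\prod_{j=n+1}^p\Gamma(a_j+A_j\xi)},$$ with $A_j,B_j>0$, empty products equal to $1$, no pole of any $\Gamma(b_j+B_j\xi)$ ($1\le j\le m$) coinciding with a pole of any $\Gamma(1-a_i-A_i\xi)$ ($1\le i\le n$), and $\Omega$ a contour separating these two sets of poles, being either a loop $L_{-\infty}$ beginning and ending at $-\infty$ in a horizontal strip, a loop $L_{+\infty}$ beginning and ending at $+\infty$ in a horizontal strip, or a contour $L_{i\gamma\infty}$ from $\gamma-i\infty$ to $\gamma+i\infty$. *)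

theory Defs
  imports "HOL-Complex_Analysis.Complex_Analysis"
begin

text \<open>
  The parameters of the H-function are lists \<open>as = [(a\<^sub>1,A\<^sub>1), \<dots>, (a\<^sub>p,A\<^sub>p)]\<close> and
  \<open>bs = [(b\<^sub>1,B\<^sub>1), \<dots>, (b\<^sub>q,B\<^sub>q)]\<close>, so list indices are shifted by one against the usual notation.
  At a pole the library sets \<open>Gamma\<close> to \<open>0\<close>; together with \<open>x / 0 = 0\<close> this gives a Gamma factor
  in the denominator of \<open>fox_theta\<close> its correct reciprocal value \<open>0\<close>.
\<close>

definition fox_theta ::
  "nat \<Rightarrow> nat \<Rightarrow> (complex \<times> real) list \<Rightarrow> (complex \<times> real) list \<Rightarrow> complex \<Rightarrow> complex" where
  "fox_theta m n as bs \<xi> =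
     ((\<Prod>j<m. Gamma (fst (bs ! j) + of_real (snd (bs ! j)) * \<xi>)) *
      (\<Prod>j<n. Gamma (1 - fst (as ! j) - of_real (snd (as ! j)) * \<xi>))) /
     ((\<Prod>j\<in>{m..<length bs}. Gamma (1 - fst (bs ! j) - of_real (snd (bs ! j)) * \<xi>)) *
      (\<Prod>j\<in>{n..<length as}. Gamma (fst (as ! j) + of_real (snd (as ! j)) * \<xi>)))"

definition left_poles :: "nat \<Rightarrow> (complex \<times> real) list \<Rightarrow> complex set" where
  "left_poles m bs = {\<xi>. \<exists>j<m. fst (bs ! j) + of_real (snd (bs ! j)) * \<xi> \<in> \<int>\<^sub>\<le>\<^sub>0}"

definition right_poles :: "nat \<Rightarrow> (complex \<times> real) list \<Rightarrow> complex set" where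
  "right_poles n as = {\<xi>. \<exists>j<n. 1 - fst (as ! j) - of_real (snd (as ! j)) * \<xi> \<in> \<int>\<^sub>\<le>\<^sub>0}"

definition fox_params ::
  "nat \<Rightarrow> nat \<Rightarrow> (complex \<times> real) list \<Rightarrow> (complex \<times> real) list \<Rightarrow> bool" where
  "fox_params m n as bs \<longleftrightarrow>
     m \<le> length bs \<and> n \<le> length as \<and>
     (\<forall>(a, A) \<in> set as. A > 0) \<and> (\<forall>(b, B) \<in> set bs. B > 0) \<and>
     left_poles m bs \<inter> right_poles n as = {}"

text \<open>
  A contour is a simple, locally piecewise smooth curve parametrised by the whole real line. Each of
  the following three kinds records the two sides of the curve, with \<open>U\<close> on the left of the direction
  of travel and \<open>V\<close> on its right. For a loop, the ends run along the horizontal rays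
  \<open>Im \<xi> = \<phi>\<^sub>1\<close> and \<open>Im \<xi> = \<phi>\<^sub>2\<close> with \<open>\<phi>\<^sub>1 < \<phi>\<^sub>2\<close>, which fixes the orientation, and its interior is the
  side that contains the points between the two rays.
\<close>

definition contour_sides :: "(real \<Rightarrow> complex) \<Rightarrow> complex set \<Rightarrow> complex set \<Rightarrow> bool" where
  "contour_sides g U V \<longleftrightarrow>
     inj g \<and> (\<forall>a b. g piecewise_C1_differentiable_on {a..b}) \<and>
     U \<in> components (- range g) \<and> V \<in> components (- range g) \<and> U \<noteq> V"

definition loop_minus_inf :: "(real \<Rightarrow> complex) \<Rightarrow> complex set \<Rightarrow> complex set \<Rightarrow> bool" where
  "loop_minus_inf g U V \<longleftrightarrow> contour_sides g U V \<and>
     (\<exists>\<phi>\<^sub>1 \<phi>\<^sub>2. \<phi>\<^sub>1 < \<phi>\<^sub>2 \<and>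
        filterlim (\<lambda>s. Re (g s)) at_bot at_bot \<and> (\<forall>\<^sub>F s in at_bot. Im (g s) = \<phi>\<^sub>1) \<and>
        filterlim (\<lambda>s. Re (g s)) at_bot at_top \<and> (\<forall>\<^sub>F s in at_top. Im (g s) = \<phi>\<^sub>2) \<and>
        (\<forall>y\<in>{\<phi>\<^sub>1<..<\<phi>\<^sub>2}. \<forall>\<^sub>F x in at_bot. Complex x y \<in> U) \<and>
        (\<forall>y. \<forall>\<^sub>F x in at_top. Complex x y \<in> V))"

definition loop_plus_inf :: "(real \<Rightarrow> complex) \<Rightarrow> complex set \<Rightarrow> complex set \<Rightarrow> bool" where
  "loop_plus_inf g U V \<longleftrightarrow> contour_sides g U V \<and>
     (\<exists>\<phi>\<^sub>1 \<phi>\<^sub>2. \<phi>\<^sub>1 < \<phi>\<^sub>2 \<and>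
        filterlim (\<lambda>s. Re (g s)) at_top at_bot \<and> (\<forall>\<^sub>F s in at_bot. Im (g s) = \<phi>\<^sub>1) \<and>
        filterlim (\<lambda>s. Re (g s)) at_top at_top \<and> (\<forall>\<^sub>F s in at_top. Im (g s) = \<phi>\<^sub>2) \<and>
        (\<forall>y. \<forall>\<^sub>F x in at_bot. Complex x y \<in> U) \<and>
        (\<forall>y\<in>{\<phi>\<^sub>1<..<\<phi>\<^sub>2}. \<forall>\<^sub>F x in at_top. Complex x y \<in> V))"

definition line_imag_inf :: "(real \<Rightarrow> complex) \<Rightarrow> complex set \<Rightarrow> complex set \<Rightarrow> bool" where
  "line_imag_inf g U V \<longleftrightarrow> contour_sides g U V \<and>
     (\<exists>\<gamma>. ((\<lambda>s. Re (g s)) \<longlongrightarrow> \<gamma>) at_bot \<and> filterlim (\<lambda>s. Im (g s)) at_bot at_bot \<and>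
          ((\<lambda>s. Re (g s)) \<longlongrightarrow> \<gamma>) at_top \<and> filterlim (\<lambda>s. Im (g s)) at_top at_top \<and>
          (\<forall>y. \<forall>\<^sub>F x in at_bot. Complex x y \<in> U) \<and>
          (\<forall>y. \<forall>\<^sub>F x in at_top. Complex x y \<in> V))"

definition fox_contour ::
  "nat \<Rightarrow> nat \<Rightarrow> (complex \<times> real) list \<Rightarrow> (complex \<times> real) list \<Rightarrow> (real \<Rightarrow> complex) \<Rightarrow> bool" where
  "fox_contour m n as bs g \<longleftrightarrow>
     (\<exists>U V. (loop_minus_inf g U V \<or> loop_plus_inf g U V \<or> line_imag_inf g U V) \<and>
            left_poles m bs \<subseteq> U \<and> right_poles n as \<subseteq> V)"

definition fox_integrand ::
  "nat \<Rightarrow> nat \<Rightarrow> (complex \<times> real) list \<Rightarrow> (complex \<times> real) list \<Rightarrow> complex \<Rightarrow>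
   (real \<Rightarrow> complex) \<Rightarrow> real \<Rightarrow> complex" where
  "fox_integrand m n as bs z g s =
     fox_theta m n as bs (g s) * z powr (- g s) * vector_derivative g (at s)"

text \<open>
  The value is the common one of the integrals over all admissible contours on which the integral
  converges absolutely; it is unspecified if there is no such contour or if two of them disagree.
\<close>

definition fox_H ::
  "nat \<Rightarrow> nat \<Rightarrow> (complex \<times> real) list \<Rightarrow> (complex \<times> real) list \<Rightarrow> complex \<Rightarrow> complex" where
  "fox_H m n as bs z =
     (THE h. fox_params m n as bs \<and>
        (\<exists>g. fox_contour m n as bs g \<and>
             fox_integrand m n as bs z g absolutely_integrable_on UNIV \<and>
             h = 1 / (2 * of_real pi * \<i>) * integral UNIV (fox_integrand m n as bs z g)))"

end

(*
  By the reflection formula, theta decays exponentially on vertical lines, and for 0 < z < 1 the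
  integrand F(xi) = theta(xi) z^(-xi) is small far to the left and bounded below far to the right,
  away from the real axis.  The right loops are therefore never absolutely integrable.  Every other
  admissible contour can be pushed to the line Re xi = -rho for large rho: a long piece of it is
  closed through -rho, and the residue theorem gives the residues at the left poles to the right of
  -rho, because the winding number about these poles is 1 and about all other poles 0.  So the
  integral does not depend on the contour, which makes the H-function well defined.

  For the line Re xi = -1/2 the same formula holds already for 1 < rho < alpha.  Then -1 is the only
  pole that is crossed; its residue is the leading term, and the remaining integral is O(z^rho).
*)

theory Submission imports Defs begin

section \<open>Bounds for the Gamma function and the sine\<close>

text \<open>\<open>fox_H\<close> is a definite description, so expanding the integral along one
  convenient line says nothing about it until every admissible contour is shown to give the same
  value. These contours are merely injective and piecewise C1, with sides given as components of the
  complement; they may wander and cross the real axis many times. Orientation is therefore read off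
  from the ends alone, and the finitely many poles caught in the tangled middle are tied by compact
  connected sets to a real ray on their side. The closing curve must stay clear of these sets, which
  is why \<open>\<rho>\<close> has to be large for a general contour; for the line Re = -1/2 the
  sets are single points. With kappa = \<beta>/\<alpha>, theta is Gamma(1 + xi)/Gamma(\<beta> +
  kappa xi) times sin(pi xi/2)/sin(pi xi/\<alpha>). On vertical lines the exponential rates in |Im
  xi| add up to pi kappa/2 - pi/\<alpha>, which is at most -pi/(2 \<alpha>). Horizontally kappa < 1
  decides which Gamma factor wins on either side. All Gamma estimates compare Euler's product factor
  by factor and take the exact modulus at real part 1/2 from reflection.\<close>

lemma norm_rGamma_series:
  "norm (rGamma_series s n) =
     (\<Prod>k=0..<Suc n. norm (s + of_nat k)) / (fact n * exp (Re s * ln (of_nat n)))"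
  for s :: complex
  by (simp add: rGamma_series_def norm_divide norm_mult pochhammer_prod prod_norm
        del: prod.op_ivl_Suc)

text \<open>In Euler's product each factor |x + k + iy| / (x + k) decreases in x, and the
  normalising powers of n cancel between the two sides. This carries the exact modulus at real part
  1/2 to all larger real parts.\<close>

lemma norm_rGamma_vertical_mono:
  assumes "0 < x" "x \<le> x'"
  shows "norm (rGamma (Complex x' y)) * rGamma x \<le> norm (rGamma (Complex x y)) * rGamma x'"
proof (rule LIMSEQ_le)
  show "(\<lambda>n. norm (rGamma_series (Complex x' y) n) * rGamma_series x n)
          \<longlonglongrightarrow> norm (rGamma (Complex x' y)) * rGamma x"
    by (intro tendsto_intros)
  show "(\<lambda>n. norm (rGamma_series (Complex x y) n) * rGamma_series x' n)
          \<longlonglongrightarrow> norm (rGamma (Complex x y)) * rGamma x'"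
    by (intro tendsto_intros)
  have factor: "norm (Complex x' y + of_nat k) * (x + real k)
                  \<le> norm (Complex x y + of_nat k) * (x' + real k)" for k
  proof (rule power2_le_imp_le)
    have "(x + k)\<^sup>2 \<le> (x' + k)\<^sup>2"
      using assms by (intro power_mono) auto
    then have "y\<^sup>2 * (x + k)\<^sup>2 \<le> y\<^sup>2 * (x' + k)\<^sup>2"
      by (intro mult_left_mono) auto
    then have "((x' + k)\<^sup>2 + y\<^sup>2) * (x + k)\<^sup>2 \<le> ((x + k)\<^sup>2 + y\<^sup>2) * (x' + k)\<^sup>2"
      by (simp only: distrib_right mult.commute[of "(x + k)\<^sup>2" "(x' + k)\<^sup>2"] add_left_mono)
    then show "(norm (Complex x' y + of_nat k) * (x + real k))\<^sup>2
                 \<le> (norm (Complex x y + of_nat k) * (x' + real k))\<^sup>2"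
      by (simp only: power_mult_distrib cmod_power2) simp
  qed (use assms in auto)
  have "norm (rGamma_series (Complex x' y) n) * rGamma_series x n
          \<le> norm (rGamma_series (Complex x y) n) * rGamma_series x' n" for n
  proof -
    have "(\<Prod>k=0..<Suc n. norm (Complex x' y + of_nat k) * (x + real k))
            \<le> (\<Prod>k=0..<Suc n. norm (Complex x y + of_nat k) * (x' + real k))"
      using assms factor by (intro prod_mono) auto
    moreover have "A * a \<le> B * b \<Longrightarrow> A / (f * p) * (a / (f * q)) \<le> B / (f * q) * (b / (f * p))"
      if "f > 0" "p > 0" "q > 0" for A a B b f p q :: real
      using that by (simp add: field_simps)
    ultimately show ?thesis
      unfolding norm_rGamma_series rGamma_series_def[of x] rGamma_series_def[of x'] pochhammer_prod
        prod.distrib by simp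
  qed
  then show "\<exists>N. \<forall>n\<ge>N. norm (rGamma_series (Complex x' y) n) * rGamma_series x n
               \<le> norm (rGamma_series (Complex x y) n) * rGamma_series x' n"
    by blast
qed

text \<open>Factor by factor in the product for 1/Gamma, from |s + k| >= Re s + k > 0.\<close>

lemma norm_Gamma_le:
  assumes "Re s > 0"
  shows "norm (Gamma s) \<le> Gamma (Re s)"
proof -
  have "rGamma (Re s) \<le> norm (rGamma s)"
  proof (rule LIMSEQ_le)
    show "rGamma_series (Re s) \<longlonglongrightarrow> rGamma (Re s)"
      and "(\<lambda>n. norm (rGamma_series s n)) \<longlonglongrightarrow> norm (rGamma s)"
      by (intro tendsto_intros)+
    have "(\<Prod>k=0..<Suc n. Re s + of_nat k) \<le> (\<Prod>k=0..<Suc n. norm (s + of_nat k))" for n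
    proof (rule prod_mono)
      show "0 \<le> Re s + real k \<and> Re s + real k \<le> norm (s + of_nat k)" for k
        using assms complex_Re_le_cmod[of "s + of_nat k"] by simp
    qed
    then have "rGamma_series (Re s) n \<le> norm (rGamma_series s n)" for n
      unfolding norm_rGamma_series
      by (simp add: rGamma_series_def pochhammer_prod divide_right_mono del: prod.op_ivl_Suc)
    then show "\<exists>N. \<forall>n\<ge>N. rGamma_series (Re s) n \<le> norm (rGamma_series s n)"
      by blast
  qed
  moreover have "rGamma (Re s) > 0"
    using assms by (simp add: rGamma_inverse_Gamma Gamma_real_pos)
  ultimately show ?thesis
    by (simp add: Gamma_def norm_inverse le_imp_inverse_le)
qed

lemma norm_rGamma_half: "norm (rGamma (Complex (1/2) y)) = sqrt (cosh (pi * y) / pi)"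
proof -
  let ?s = "Complex (1/2) y"
  have "complex_of_real ((norm (rGamma ?s))\<^sup>2) = rGamma ?s * cnj (rGamma ?s)"
    by (rule complex_norm_square)
  also have "cnj (rGamma ?s) = rGamma (1 - ?s)"
    by (simp add: Complex_eq cnj_rGamma)
  also have "rGamma ?s * rGamma (1 - ?s) = sin (of_real pi * ?s) / of_real pi"
    by (rule rGamma_reflection_complex)
  also have "of_real pi * ?s = of_real pi / 2 + \<i> * of_real (pi * y)"
    by (simp add: Complex_eq algebra_simps)
  also have "sin \<dots> = cos (\<i> * of_real (pi * y))"
    by (simp add: sin_add)
  also have "\<dots> = of_real (cosh (pi * y))"
    by (simp add: cosh_def cos_exp_eq exp_minus scaleR_conv_of_real flip: exp_of_real)
  finally have "(norm (rGamma ?s))\<^sup>2 = cosh (pi * y) / pi"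
    by (metis of_real_divide of_real_eq_iff)
  then show ?thesis
    by (metis norm_ge_zero real_sqrt_unique)
qed

text \<open>The value at real part 1/2 is transported to the right by monotonicity. The factor
  \<open>rGamma (Re s)\<close> is kept exactly, because in the horizontal estimates of theta it has
  to cancel against another Gamma factor.\<close>

lemma norm_rGamma_le:
  assumes "Re s \<ge> 1/2"
  shows "norm (rGamma s) \<le> exp (pi / 2 * \<bar>Im s\<bar>) * rGamma (Re s)"
proof -
  have "cosh (pi * Im s) \<le> exp \<bar>pi * Im s\<bar>"
    by (auto simp: cosh_def abs_if)
  also have "\<dots> = (exp (pi / 2 * \<bar>Im s\<bar>))\<^sup>2"
    by (simp add: power2_eq_square abs_mult flip: exp_add)
  finally have sqrt_le: "sqrt (cosh (pi * Im s)) \<le> exp (pi / 2 * \<bar>Im s\<bar>)"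
    by (simp add: real_le_lsqrt)
  have "norm (rGamma s) * rGamma (1/2) \<le> norm (rGamma (Complex (1/2) (Im s))) * rGamma (Re s)"
    using norm_rGamma_vertical_mono[of "1/2" "Re s" "Im s"] assms by simp
  then have "norm (rGamma s) \<le> sqrt (cosh (pi * Im s)) * rGamma (Re s)"
    by (simp add: norm_rGamma_half rGamma_inverse_Gamma[of "1/2"] Gamma_one_half_real
          real_sqrt_divide field_simps)
  also have "\<dots> \<le> exp (pi / 2 * \<bar>Im s\<bar>) * rGamma (Re s)"
    using assms sqrt_le by (intro mult_right_mono) (auto simp: rGamma_inverse_Gamma Gamma_real_pos less_imp_le)
  finally show ?thesis .
qed

lemma norm_sin_le: "norm (sin s) \<le> exp \<bar>Im s\<bar>" for s :: complex
proof -
  have "norm (sin s) \<le> (norm (exp (\<i> * s)) + norm (exp (-(\<i> * s)))) / 2"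
    using norm_triangle_ineq4[of "exp (\<i> * s)" "exp (-(\<i> * s))"]
    by (simp add: sin_exp_eq norm_divide norm_mult)
  also have "\<dots> \<le> exp \<bar>Im s\<bar>"
    by (auto simp: norm_exp_eq_Re abs_if)
  finally show ?thesis .
qed

text \<open>Of the two exponentials in the sine the smaller is at most exp(-2 \<phi>) times the
  larger. The full rate exp |Im s| survives, with a positive constant as soon as \<phi> > 0.\<close>

lemma norm_sin_ge:
  fixes s :: complex
  assumes "\<bar>Im s\<bar> \<ge> \<phi>" 
  shows "norm (sin s) \<ge> (1 - exp (- (2 * \<phi>))) / 2 * exp \<bar>Im s\<bar>"
proof -
  have "(1 - exp (- (2 * \<phi>))) / 2 * exp \<bar>Im s\<bar> \<le> (exp \<bar>Im s\<bar> - exp (- \<bar>Im s\<bar>)) / 2"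
    using assms by (simp add: field_simps flip: exp_add)
  also have "\<dots> \<le> \<bar>norm (exp (\<i> * s)) - norm (exp (-(\<i> * s)))\<bar> / 2"
    by (auto simp: norm_exp_eq_Re abs_if)
  also have "\<dots> \<le> norm (sin s)"
    using norm_triangle_ineq3[of "exp (\<i> * s)" "exp (-(\<i> * s))"]
    by (simp add: sin_exp_eq norm_divide norm_mult)
  finally show ?thesis .
qed

lemma norm_cos_ge:
  fixes s :: complex
  assumes "\<bar>Im s\<bar> \<ge> \<phi>" 
  shows "norm (cos s) \<ge> (1 - exp (- (2 * \<phi>))) / 2 * exp \<bar>Im s\<bar>"
  using norm_sin_ge[of \<phi> "s + of_real pi / 2"] assms by (simp add: sin_add)

text \<open>The recurrence \<open>rGamma s = s * rGamma (s + 1)\<close> moves the left edge of the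
  strip by one unit at a time. Each step costs a factor |s|, linear in |Im s|, which half of the
  available \<epsilon> absorbs. Hence the induction varies \<epsilon>, and also b, since s + 1 may
  lie beyond the right edge.\<close>

lemma norm_rGamma_strip:
  fixes a b \<epsilon> :: real
  assumes "\<epsilon> > 0"
  shows "\<exists>C>0. \<forall>s. a \<le> Re s \<and> Re s \<le> b \<longrightarrow> norm (rGamma s) \<le> C * exp ((pi / 2 + \<epsilon>) * \<bar>Im s\<bar>)"
proof -
  have "\<exists>C>0. \<forall>s. 1 / 2 - real n \<le> Re s \<and> Re s \<le> b \<longrightarrow>
          norm (rGamma s) \<le> C * exp ((pi / 2 + \<epsilon>) * \<bar>Im s\<bar>)" if "\<epsilon> > 0" for n b and \<epsilon> :: real
    using that
  proof (induction n arbitrary: b \<epsilon>)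
    case 0
    have "continuous_on {1/2..b} (rGamma :: real \<Rightarrow> real)"
      by (intro continuous_intros)
    then have "bounded (rGamma ` {1/2..b})"
      by (intro compact_imp_bounded compact_continuous_image) auto
    then obtain C where C: "C > 0" "\<And>x. x \<in> {1/2..b} \<Longrightarrow> \<bar>rGamma x\<bar> \<le> C"
      by (auto simp: bounded_pos)
    have "norm (rGamma s) \<le> C * exp ((pi / 2 + \<epsilon>) * \<bar>Im s\<bar>)" if "1/2 \<le> Re s" "Re s \<le> b" for s
    proof -
      have "norm (rGamma s) \<le> exp (pi / 2 * \<bar>Im s\<bar>) * rGamma (Re s)"
        using that by (intro norm_rGamma_le)
      also have "\<dots> \<le> exp ((pi / 2 + \<epsilon>) * \<bar>Im s\<bar>) * C"
      proof (intro mult_mono)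
        have "pi / 2 * \<bar>Im s\<bar> \<le> (pi / 2 + \<epsilon>) * \<bar>Im s\<bar>"
          using \<open>\<epsilon> > 0\<close> by (intro mult_right_mono) auto
        then show "exp (pi / 2 * \<bar>Im s\<bar>) \<le> exp ((pi / 2 + \<epsilon>) * \<bar>Im s\<bar>)"
          by simp
      qed (use C(2)[of "Re s"] that in \<open>auto simp: rGamma_inverse_Gamma Gamma_real_pos less_imp_le\<close>)
      finally show ?thesis
        by (simp add: mult.commute)
    qed
    then show ?case
      using C(1) by auto
  next
    case (Suc n)
    have "\<epsilon> / 2 > 0"
      using \<open>\<epsilon> > 0\<close> by simp
    from Suc.IH[OF this, of "b + 1"] obtain C where C: "C > 0"
      "\<And>s. 1 / 2 - real n \<le> Re s \<Longrightarrow> Re s \<le> b + 1 \<Longrightarrow> 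
          norm (rGamma s) \<le> C * exp ((pi / 2 + \<epsilon> / 2) * \<bar>Im s\<bar>)"
      by blast
    \<comment> \<open>The first three summands bound |Re s|. The summand
      \<open>2 / \<epsilon>\<close> makes \<open>M * \<epsilon> / 2\<close> at least 1, so that
      \<open>M * exp (\<epsilon> / 2 * \<bar>Im s\<bar>)\<close> dominates the part |Im s| of the
      bound on |s| as well.\<close>
    define M where "M = \<bar>b\<bar> + real n + 1 + 2 / \<epsilon>"
    have "M > 0"
      using \<open>\<epsilon> > 0\<close> by (simp add: M_def add_pos_nonneg)
    have "norm (rGamma s) \<le> M * C * exp ((pi / 2 + \<epsilon>) * \<bar>Im s\<bar>)"
      if s: "1/2 - real (Suc n) \<le> Re s" "Re s \<le> b" for s
    proof -
      have "norm s \<le> \<bar>Re s\<bar> + \<bar>Im s\<bar>"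
        by (rule cmod_le)
      also have "\<bar>Re s\<bar> \<le> \<bar>b\<bar> + real n + 1"
        using s by auto
      also have "\<bar>b\<bar> + real n + 1 + \<bar>Im s\<bar> \<le> M * (1 + \<epsilon> / 2 * \<bar>Im s\<bar>)"
      proof -
        have "M * (1 + \<epsilon> / 2 * \<bar>Im s\<bar>) = M + (M * \<epsilon> / 2) * \<bar>Im s\<bar>"
          by (simp add: algebra_simps)
        moreover have "M * \<epsilon> / 2 \<ge> 1"
          using \<open>\<epsilon> > 0\<close> by (simp add: M_def field_simps)
        then have "(M * \<epsilon> / 2) * \<bar>Im s\<bar> \<ge> 1 * \<bar>Im s\<bar>"
          by (intro mult_right_mono) auto
        moreover have "M \<ge> \<bar>b\<bar> + real n + 1"
          using \<open>\<epsilon> > 0\<close> by (simp add: M_def)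
        ultimately show ?thesis
          by linarith
      qed
      also have "\<dots> \<le> M * exp (\<epsilon> / 2 * \<bar>Im s\<bar>)"
        using \<open>M > 0\<close> by (intro mult_left_mono exp_ge_add_one_self) auto
      finally have "norm s \<le> M * exp (\<epsilon> / 2 * \<bar>Im s\<bar>)"
        by simp
      moreover have "norm (rGamma (s + 1)) \<le> C * exp ((pi / 2 + \<epsilon> / 2) * \<bar>Im s\<bar>)"
        using C(2)[of "s + 1"] s by simp
      ultimately have "norm s * norm (rGamma (s + 1))
          \<le> M * exp (\<epsilon> / 2 * \<bar>Im s\<bar>) * (C * exp ((pi / 2 + \<epsilon> / 2) * \<bar>Im s\<bar>))"
        using \<open>M > 0\<close> by (intro mult_mono) auto
      also have "\<dots> = M * C * exp ((pi / 2 + \<epsilon>) * \<bar>Im s\<bar>)"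
        by (simp add: algebra_simps flip: exp_add)
      finally show ?thesis
        by (simp add: rGamma_plus1 flip: norm_mult)
    qed
    then show ?case
      using \<open>M > 0\<close> C(1) by (intro exI[of _ "M * C"]) auto
  qed
  moreover obtain n where "1 / 2 - a \<le> real n"
    using real_arch_simple by blast
  then have "1 / 2 - real n \<le> Re s" if "a \<le> Re s" for s
    using that by linarith
  ultimately show ?thesis
    using assms by meson
qed

section \<open>Residues inside a closed piece of a contour\<close>

lemma valid_path_subpath_real:
  fixes g :: "real \<Rightarrow> 'a :: real_normed_vector"
  assumes "g piecewise_C1_differentiable_on {a..b}" "a < b"
  shows "valid_path (subpath a b g)"
proof -
  let ?f = "\<lambda>x. (b - a) * x + a"
  have "(g \<circ> ?f) piecewise_C1_differentiable_on {0..1}"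
  proof (rule piecewise_C1_differentiable_compose)
    show "?f piecewise_C1_differentiable_on {0..1}"
      by (simp add: C1_differentiable_imp_piecewise)
    show "g piecewise_C1_differentiable_on ?f ` {0..1}"
      using assms by (simp add: image_affinity_atLeastAtMost)
    show "finite ({0..1} \<inter> ?f -` {x})" for x
      using assms by (simp add: Int_commute [of "{0..1}"] inj_on_def finite_vimage_IntI)
  qed
  then show ?thesis
    by (simp add: o_def valid_path_def subpath_def)
qed

text \<open>An affine substitution onto {0..1}. The chain rule can fail only at the preimages of the
  finitely many kinks of g, which do not affect the integral.\<close>

lemma has_contour_integral_subpath_real:
  assumes g: "g piecewise_C1_differentiable_on {a..b}" and "a < b"
    and int: "((\<lambda>s. f (g s) * vector_derivative g (at s)) has_integral I) {a..b}"
  shows "(f has_contour_integral I) (subpath a b g)"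
proof -
  obtain S where S: "\<And>x. x \<in> {a..b} - S \<Longrightarrow> g differentiable at x" and fs: "finite S"
    using g unfolding piecewise_C1_differentiable_on_def C1_differentiable_on_eq by blast
  have *: "((\<lambda>x. f (g ((b - a) * x + a)) * vector_derivative g (at ((b - a) * x + a)))
            has_integral (1 / (b - a)) *\<^sub>R I) {0..1}"
  proof -
    have "b / (b - a) - a / (b - a) = 1"
      using \<open>a < b\<close> by (simp flip: diff_divide_distrib)
    then show ?thesis
      using has_integral_affinity[of _ I a b "b - a" a] int \<open>a < b\<close>
      by (simp add: image_affinity_atLeastAtMost_div_diff scaleR_conv_of_real)
  qed
  have vd: "vector_derivative (\<lambda>x. g ((b - a) * x + a)) (at x)
              = (b - a) *\<^sub>R vector_derivative g (at ((b - a) * x + a))"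
    if "x \<in> {0..1}" "x \<notin> (\<lambda>t. (b - a) *\<^sub>R t + a) -` S" for x
  proof (rule vector_derivative_at [OF vector_diff_chain_at [simplified o_def]])
    show "((\<lambda>x. (b - a) * x + a) has_vector_derivative b - a) (at x)"
      by (intro derivative_eq_intros | simp)+
    have "(b - a) * x \<le> b - a" "0 \<le> (b - a) * x"
      using that \<open>a < b\<close> by (auto intro: mult_left_le)
    then have "a \<le> (b - a) * x + a" "(b - a) * x + a \<le> b"
      by linarith+
    then have "(b - a) * x + a \<in> {a..b} - S"
      using that by auto
    then show "(g has_vector_derivative vector_derivative g (at ((b - a) * x + a)))
                 (at ((b - a) * x + a))"
      using S vector_derivative_works by blast
  qed
  have fin: "finite ((\<lambda>t. (b - a) *\<^sub>R t + a) -` S)"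
    using fs \<open>a < b\<close> by (auto simp: inj_on_def finite_vimageI)
  have "((\<lambda>x. f (g ((b - a) * x + a)) * ((b - a) *\<^sub>R vector_derivative g (at ((b - a) * x + a))))
            has_integral I) {0..1}"
    using has_integral_cmul [OF *, where c = "b - a"] \<open>a < b\<close> by simp
  then show ?thesis
    unfolding subpath_def has_contour_integral
    by (rule has_integral_spike_finite [OF fin, rotated]) (use vd in auto)
qed

text \<open>Two branches of the logarithm serve as primitives of 1/(w - q):
  \<open>Ln (w - q)\<close> along h, which misses the ray to the left of q, and
  \<open>Ln (q - w)\<close> along d, which misses the ray to the right. At the junction in the upper
  half-plane they differ by -i pi, at the one in the lower half-plane by +i pi, and these jumps add
  up to 2 pi i. How often h crosses the real axis beyond q is irrelevant.\<close>

lemma winding_number_real_crossings: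
  assumes h: "valid_path h" "path_image h \<inter> of_real ` {..q} = {}"
    and d: "valid_path d" "path_image d \<inter> of_real ` {q..} = {}"
    and ends: "pathstart d = pathfinish h" "pathfinish d = pathstart h"
    and Im: "Im (pathfinish h) > 0" "Im (pathstart h) < 0"
  shows "winding_number (h +++ d) (of_real q) = 1"
proof -
  let ?q = "complex_of_real q"
  have nonreal: "w \<in> of_real ` {..q}" if "w - ?q \<in> \<real>\<^sub>\<le>\<^sub>0" for w
  proof -
    from that obtain x where "x \<le> 0" "w - ?q = of_real x"
      by (auto elim: nonpos_Reals_cases)
    then have "w = of_real (q + x)"
      by (simp add: algebra_simps)
    then show ?thesis
      using \<open>x \<le> 0\<close> by (auto simp del: of_real_add of_real_diff)
  qed
  have nonreal': "w \<in> of_real ` {q..}" if "?q - w \<in> \<real>\<^sub>\<le>\<^sub>0" for w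
  proof -
    from that obtain x where "x \<le> 0" "?q - w = of_real x"
      by (auto elim: nonpos_Reals_cases)
    then have "w = of_real (q - x)"
      by (simp add: algebra_simps)
    then show ?thesis
      using \<open>x \<le> 0\<close> by (auto simp del: of_real_add of_real_diff)
  qed
  have "((\<lambda>w. 1 / (w - ?q)) has_contour_integral (Ln (pathfinish h - ?q) - Ln (pathstart h - ?q))) h"
  proof (rule contour_integral_primitive)
    show "((\<lambda>w. Ln (w - ?q)) has_field_derivative 1 / (w - ?q)) (at w within {w. w - ?q \<notin> \<real>\<^sub>\<le>\<^sub>0})"
      if "w \<in> {w. w - ?q \<notin> \<real>\<^sub>\<le>\<^sub>0}" for w
      using that by (auto intro!: derivative_eq_intros simp: inverse_eq_divide)
    show "path_image h \<subseteq> {w. w - ?q \<notin> \<real>\<^sub>\<le>\<^sub>0}"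
      using h nonreal by auto
  qed fact
  moreover have "((\<lambda>w. 1 / (w - ?q)) has_contour_integral (Ln (?q - pathfinish d) - Ln (?q - pathstart d))) d"
  proof (rule contour_integral_primitive)
    show "((\<lambda>w. Ln (?q - w)) has_field_derivative 1 / (w - ?q)) (at w within {w. ?q - w \<notin> \<real>\<^sub>\<le>\<^sub>0})"
      if "w \<in> {w. ?q - w \<notin> \<real>\<^sub>\<le>\<^sub>0}" for w
    proof -
      have "-1 / (?q - w) = 1 / (w - ?q)"
        by (metis minus_diff_eq minus_divide_divide)
      then show ?thesis
        using that by (auto intro!: derivative_eq_intros simp: inverse_eq_divide)
    qed
    show "path_image d \<subseteq> {w. ?q - w \<notin> \<real>\<^sub>\<le>\<^sub>0}"
      using d nonreal' by auto
  qed fact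
  ultimately have "((\<lambda>w. 1 / (w - ?q)) has_contour_integral
      (Ln (pathfinish h - ?q) - Ln (pathstart h - ?q) + (Ln (?q - pathfinish d) - Ln (?q - pathstart d)))) (h +++ d)"
    using h d by (intro has_contour_integral_join) auto
  moreover have "pathstart h - ?q \<noteq> 0" "pathfinish h - ?q \<noteq> 0"
    using Im by auto
  then have "Ln (?q - pathfinish d) = Ln (pathstart h - ?q) + \<i> * pi"
    and "Ln (?q - pathstart d) = Ln (pathfinish h - ?q) - \<i> * pi"
    using Ln_minus[of "pathstart h - ?q"] Ln_minus[of "pathfinish h - ?q"] Im ends by simp_all
  ultimately have "((\<lambda>w. 1 / (w - ?q)) has_contour_integral 2 * pi * \<i>) (h +++ d)"
    by (simp add: algebra_simps)
  moreover have "?q \<notin> path_image (h +++ d)"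
    using h(2) d(2) ends by (auto simp: path_image_join)
  ultimately show ?thesis
    using h(1) d(1) ends by (simp add: winding_number_valid_path contour_integral_unique)
qed

lemma connected_of_real_image:
  "convex A \<Longrightarrow> connected (of_real ` A :: complex set)" for A :: "real set"
  by (intro connected_continuous_image convex_connected continuous_intros) auto

text \<open>
  The curve \<open>h\<close> is a long piece of the contour and \<open>d\<close> closes it through \<open>-\<rho>\<close>, far away from the
  connected sets \<open>K\<close> and \<open>K'\<close> that join the finitely many poles which the two real rays, known to lie
  on the correct sides of the contour, do not reach.
\<close>

lemma closed_contour_residues:
  fixes L R K K' :: "complex set" and q\<^sub>0 q\<^sub>1 r \<rho> :: real
  assumes hol: "F holomorphic_on - (L \<union> R)" and real: "L \<union> R \<subseteq> \<real>"
    and fin: "\<And>B. finite ((L \<union> R) \<inter> ball 0 B)"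
    and K: "connected K" "of_real q\<^sub>0 \<in> K" "L \<subseteq> K \<union> of_real ` {..q\<^sub>0}"
    and K': "connected K'" "of_real q\<^sub>1 \<in> K'" "R \<subseteq> K' \<union> of_real ` {q\<^sub>1..}"
    and KK': "K \<union> K' \<subseteq> ball 0 r" and \<rho>: "r \<le> \<rho>" "of_real (- \<rho>) \<notin> L"
    and h: "valid_path h"
      "path_image h \<inter> (K \<union> K' \<union> of_real ` {..q\<^sub>0} \<union> of_real ` {q\<^sub>1..}) = {}"
    and d: "valid_path d" "path_image d \<inter> ball 0 r = {}" "path_image d \<inter> \<real> \<subseteq> {of_real (- \<rho>)}"
    and ends: "pathstart d = pathfinish h" "pathfinish d = pathstart h"
    and Im: "Im (pathfinish h) > 0" "Im (pathstart h) < 0"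
  shows "contour_integral h F + contour_integral d F =
           2 * pi * \<i> * (\<Sum>p\<in>{p\<in>L. - \<rho> < Re p}. residue F p)"
proof -
  define C where "C = h +++ d"
  have C: "valid_path C" "pathfinish C = pathstart C" "path_image C = path_image h \<union> path_image d"
    using h d ends by (auto simp: C_def path_image_join valid_path_join)
  have pC: "path C"
    using C by (simp add: valid_path_imp_path)
  have q: "\<bar>q\<^sub>0\<bar> < r" "\<bar>q\<^sub>1\<bar> < r" "\<rho> > 0"
  proof -
    have "norm (complex_of_real q\<^sub>0) < r" "norm (complex_of_real q\<^sub>1) < r"
      using K K' KK' by (metis UnCI mem_ball_0 subsetD)+
    then show "\<bar>q\<^sub>0\<bar> < r" "\<bar>q\<^sub>1\<bar> < r" "\<rho> > 0"
      using \<rho> by auto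
  qed
  have d_real: "x = - \<rho>" if "of_real x \<in> path_image d" for x
    using that d(3) by (metis IntI Reals_of_real of_real_eq_iff singletonD subsetD)
  have dK: "path_image d \<inter> (K \<union> K') = {}"
    using d(2) KK' by blast
  have w_eq: "winding_number C a = winding_number C b"
    if "connected S" "a \<in> S" "b \<in> S" "S \<inter> path_image C = {}" for S a b
    using winding_number_eq[OF pC C(2)] that by blast
  obtain B0 where B0: "\<And>z. B0 \<le> norm z \<Longrightarrow> winding_number C z = 0"
    using winding_number_zero_at_infinity[OF pC C(2)] by blast

  \<comment> \<open>The set \<open>K\<close> together with the real interval from -\<rho> to q0 is
    connected and missed by the curve. So all these poles have the winding number of q0, where h
    misses the ray to the left and d misses the ray to the right.\<close>
  have w_left: "winding_number C p = 1" if p: "p \<in> L" "- \<rho> < Re p" for p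
  proof -
    let ?S = "K \<union> of_real ` {-\<rho><..q\<^sub>0}"
    have "of_real q\<^sub>0 \<in> (of_real ` {-\<rho><..q\<^sub>0} :: complex set)"
      using q \<rho> by auto
    then have "connected ?S"
      using K connected_of_real_image[of "{-\<rho><..q\<^sub>0}"] by (intro connected_Un) auto
    moreover have "?S \<inter> path_image C = {}"
      using h(2) dK d_real unfolding C(3) by fastforce
    moreover have "p \<in> ?S"
      using p K(3) by auto
    ultimately have "winding_number C p = winding_number C (of_real q\<^sub>0)"
      using w_eq K(2) by blast
    also have "\<dots> = 1"
      unfolding C_def
    proof (rule winding_number_real_crossings)
      show "path_image d \<inter> of_real ` {q\<^sub>0..} = {}"
        using d_real q \<rho> by fastforce
    qed (use h d ends Im in auto)
    finally show ?thesis .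
  qed

  \<comment> \<open>Such a pole lies on the real ray left of -\<rho>, which the curve does not meet;
    moving out along this ray ends where winding numbers vanish.\<close>
  have w_far: "winding_number C p = 0" if p: "p \<in> L" "\<not> - \<rho> < Re p" for p
  proof -
    have "p \<notin> K"
      using p KK' \<rho> abs_Re_le_cmod[of p] by (auto simp: subset_iff)
    with p K(3) obtain x where x: "p = of_real x"
      by auto
    then have "x \<noteq> - \<rho>"
      using \<rho>(2) p by auto
    with p x have "x < - \<rho>"
      by auto
    let ?S = "of_real ` {..<-\<rho>} :: complex set"
    define y where "y = - \<bar>B0\<bar> - \<rho> - 1"
    have "winding_number C p = winding_number C (of_real y)"
    proof (rule w_eq)
      show "connected ?S"
        by (intro connected_of_real_image) auto
      show "?S \<inter> path_image C = {}"
        using h(2) d_real q \<rho> unfolding C(3) by fastforce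
      have "y < - \<rho>"
        by (simp add: y_def)
      then show "of_real y \<in> ?S"
        by auto
    qed (use \<open>x < - \<rho>\<close> x in auto)
    also have "\<dots> = 0"
      using q by (intro B0) (simp only: norm_of_real, simp add: y_def)
    finally show ?thesis .
  qed

  \<comment> \<open>The same escape to infinity, now through \<open>K'\<close> and along the right
    ray.\<close>
  have w_right: "winding_number C p = 0" if p: "p \<in> R" for p
  proof -
    let ?S = "K' \<union> of_real ` {q\<^sub>1..}"
    define y where "y = \<bar>B0\<bar> + \<bar>q\<^sub>1\<bar>"
    have "winding_number C p = winding_number C (of_real y)"
    proof (rule w_eq)
      show "connected ?S"
        using K' connected_of_real_image[of "{q\<^sub>1..}"] by (intro connected_Un) auto
      show "?S \<inter> path_image C = {}"
        using h(2) dK d_real q \<rho> unfolding C(3) by fastforce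
      have "q\<^sub>1 \<le> y"
        by (simp add: y_def)
      then show "of_real y \<in> ?S"
        by auto
    qed (use p K' in auto)
    also have "\<dots> = 0"
      by (intro B0) (simp only: norm_of_real, simp add: y_def)
    finally show ?thesis .
  qed

  have avoid: "path_image C \<inter> (L \<union> R) = {}"
  proof -
    have "of_real (- \<rho>) \<notin> R"
    proof
      assume "of_real (- \<rho>) \<in> R"
      then have "of_real (- \<rho>) \<in> K'  \<or> of_real (- \<rho>) \<in> (of_real ` {q\<^sub>1..} :: complex set)"
        using K'(3) by blast
      then show False
      proof
        assume "of_real (- \<rho>) \<in> K'"
        then have "complex_of_real (- \<rho>) \<in> ball 0 r"
          using KK' by blast
        then show False
          using \<rho> q by simp
      next
        assume "of_real (- \<rho>) \<in> (of_real ` {q\<^sub>1..} :: complex set)"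
        then have "q\<^sub>1 \<le> - \<rho>"
          by (metis atLeast_iff imageE of_real_eq_iff)
        then show False
          using \<rho> q by simp
      qed
    qed
    then have "p \<notin> L \<union> R" if "p \<in> path_image d" for p
      using \<rho>(2) d_real that real by (metis Reals_cases UnE subsetD)
    then have "path_image d \<inter> (L \<union> R) = {}"
      by blast
    moreover have "L \<union> R \<subseteq> K \<union> K' \<union> of_real ` {..q\<^sub>0} \<union> of_real ` {q\<^sub>1..}"
      using K(3) K'(3) by auto
    then have "path_image h \<inter> (L \<union> R) = {}"
      using h(2) by auto
    ultimately show ?thesis
      unfolding C(3) by blast
  qed

  obtain B1 where B1: "path_image C \<subseteq> ball 0 B1"
    using bounded_subset_ballD[OF bounded_path_image[OF pC]] by blast
  \<comment> \<open>\<open>\<rho> + 1\<close> makes the disc contain every pole to the right of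
    -\<rho>: those in \<open>K\<close> have norm below r, the others are reals between -\<rho> and
    q0.\<close>
  define B where "B = max B1 (\<rho> + 1)"
  define P where "P = (L \<union> R) \<inter> ball 0 B"
  have "contour_integral C F = 2 * pi * \<i> * (\<Sum>p\<in>P. winding_number C p * residue F p)"
  proof (rule Residue_theorem)
    show "finite P"
      unfolding P_def by (rule fin)
    show "F holomorphic_on ball 0 B - P"
      by (rule holomorphic_on_subset[OF hol]) (auto simp: P_def)
    have "path_image C \<subseteq> ball 0 B"
      using B1 by (auto simp: B_def)
    then show "path_image C \<subseteq> ball 0 B - P" "\<forall>z. z \<notin> ball 0 B \<longrightarrow> winding_number C z = 0"
      using avoid winding_number_zero_outside[OF pC convex_ball C(2), of _ 0 B] by (auto simp: P_def)
  qed (use C in auto)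
  also have "(\<Sum>p\<in>P. winding_number C p * residue F p) = (\<Sum>p\<in>{p\<in>L. - \<rho> < Re p}. residue F p)"
  proof (rule sum.mono_neutral_cong_right)
    show "finite P"
      unfolding P_def by (rule fin)
    show "{p \<in> L. - \<rho> < Re p} \<subseteq> P"
    proof
      fix p assume p: "p \<in> {p \<in> L. - \<rho> < Re p}"
      then have "p \<in> K \<or> (\<exists>x\<le>q\<^sub>0. p = of_real x)"
        using K(3) by auto
      then have "norm p < \<rho> + 1"
        using KK' \<rho> q p by (auto simp: subset_iff)
      then show "p \<in> P"
        using p by (auto simp: P_def B_def)
    qed
    show "\<forall>p\<in>P - {p \<in> L. - \<rho> < Re p}. winding_number C p * residue F p = 0"
      using w_far w_right by (auto simp: P_def)
  qed (use w_left in auto)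
  also have "contour_integral C F = contour_integral h F + contour_integral d F"
  proof -
    have "F contour_integrable_on h" "F contour_integrable_on d"
    proof -
      have "finite P"
        unfolding P_def by (rule fin)
      then have "open (ball 0 B - P)"
        by (intro open_Diff finite_imp_closed) auto
      moreover have "F holomorphic_on ball 0 B - P"
        by (rule holomorphic_on_subset[OF hol]) (auto simp: P_def)
      moreover have "path_image h \<union> path_image d \<subseteq> ball 0 B - P"
        using B1 avoid unfolding C(3) by (auto simp: B_def P_def)
      ultimately show "F contour_integrable_on h" "F contour_integrable_on d"
        using h(1) d(1) by (meson contour_integrable_holomorphic_simple le_sup_iff)+
    qed
    then show ?thesis
      using h(1) d(1) ends by (simp add: C_def)
  qed
  finally show ?thesis .
qed

lemma integral_expanding_interval_limit:
  fixes f :: "real \<Rightarrow> 'a :: banach" and a b :: "nat \<Rightarrow> real"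
  assumes f: "f integrable_on UNIV"
    and a: "filterlim a at_bot sequentially" and b: "filterlim b at_top sequentially"
  shows "(\<lambda>n. integral {a n..b n} f) \<longlonglongrightarrow> integral UNIV f"
proof (rule tendstoI)
  fix e :: real assume "e > 0"
  moreover have "(f has_integral integral UNIV f) UNIV"
    using f by (rule integrable_integral)
  ultimately obtain B where "B > 0" and
    B: "\<And>u v. ball 0 B \<subseteq> {u..v} \<Longrightarrow> norm (integral {u..v} f - integral UNIV f) < e"
    unfolding has_integral_alt'[of f] by (auto simp: box_real)
  have "\<forall>\<^sub>F n in sequentially. a n \<le> - B \<and> B \<le> b n"
    using a b by (auto simp: filterlim_at_bot filterlim_at_top intro: eventually_conj)
  then show "\<forall>\<^sub>F n in sequentially. dist (integral {a n..b n} f) (integral UNIV f) < e"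
  proof eventually_elim
    case (elim n)
    then have "ball 0 B \<subseteq> {a n..b n}"
      by (auto simp: ball_def)
    then show ?case
      using B by (simp add: dist_norm)
  qed
qed

text \<open>The piece of g over {-n..n} is closed through -\<rho> and n tends to infinity. The
  heights \<open>Y\<close> and \<open>Y'\<close> are free because the ends of a loop stay at bounded
  height: they have to be led far away from the real axis before they can be joined to the vertical
  line at a vanishing cost.\<close>

lemma contour_integral_eq_shifted_line:
  fixes L R K K' :: "complex set" and q\<^sub>0 q\<^sub>1 r \<rho> :: real
  assumes hol: "F holomorphic_on - (L \<union> R)" and real: "L \<union> R \<subseteq> \<real>"
    and fin: "\<And>B. finite ((L \<union> R) \<inter> ball 0 B)"
    and K: "connected K" "of_real q\<^sub>0 \<in> K" "L \<subseteq> K \<union> of_real ` {..q\<^sub>0}"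
    and K': "connected K'" "of_real q\<^sub>1 \<in> K'" "R \<subseteq> K' \<union> of_real ` {q\<^sub>1..}"
    and KK': "K \<union> K' \<subseteq> ball 0 r" and \<rho>: "r \<le> \<rho>" "of_real (- \<rho>) \<notin> L \<union> R"
    and g: "\<And>a b. g piecewise_C1_differentiable_on {a..b}"
      "range g \<inter> (K \<union> K' \<union> of_real ` {..q\<^sub>0} \<union> of_real ` {q\<^sub>1..}) = {}"
    and int_g: "(\<lambda>s. F (g s) * vector_derivative g (at s)) integrable_on UNIV"
    and int_line: "(\<lambda>y. F (Complex (- \<rho>) y)) integrable_on UNIV"
    and upper: "\<forall>\<^sub>F n in sequentially. 0 < Im (g (real n)) \<and> Im (g (real n)) \<le> Y n \<and> r \<le> norm (g (real n))"
      "filterlim Y at_top sequentially"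
      "(\<lambda>n. contour_integral (linepath (g (real n)) (Complex (Re (g (real n))) (Y n))) F) \<longlonglongrightarrow> 0"
      "(\<lambda>n. contour_integral (linepath (Complex (Re (g (real n))) (Y n)) (Complex (- \<rho>) (Y n))) F) \<longlonglongrightarrow> 0"
    and lower: "\<forall>\<^sub>F n in sequentially. Im (g (- real n)) < 0 \<and> Y' n \<le> Im (g (- real n)) \<and> r \<le> norm (g (- real n))"
      "filterlim Y' at_bot sequentially"
      "(\<lambda>n. contour_integral (linepath (g (- real n)) (Complex (Re (g (- real n))) (Y' n))) F) \<longlonglongrightarrow> 0"
      "(\<lambda>n. contour_integral (linepath (Complex (Re (g (- real n))) (Y' n)) (Complex (- \<rho>) (Y' n))) F) \<longlonglongrightarrow> 0"
  shows "integral UNIV (\<lambda>s. F (g s) * vector_derivative g (at s)) =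
           2 * pi * \<i> * (\<Sum>p\<in>{p\<in>L. - \<rho> < Re p}. residue F p) +
           \<i> * integral UNIV (\<lambda>y. F (Complex (- \<rho>) y))"
proof -
  let ?G = "\<lambda>s. F (g s) * vector_derivative g (at s)"
  let ?S = "2 * pi * \<i> * (\<Sum>p\<in>{p\<in>L. - \<rho> < Re p}. residue F p)"
  let ?c = "\<lambda>a b. contour_integral (linepath a b) F"
  define u where "u n = g (real n)" for n
  define v where "v n = g (- real n)" for n
  define u' where "u' n = Complex (Re (u n)) (Y n)" for n
  define v' where "v' n = Complex (Re (v n)) (Y' n)" for n
  define w where "w n = Complex (- \<rho>) (Y n)" for n
  define w' where "w' n = Complex (- \<rho>) (Y' n)" for n
  note defs = u_def v_def u'_def v'_def w_def w'_def

  have cont: "continuous_on A F" if "A \<inter> (L \<union> R) = {}" for A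
    using holomorphic_on_imp_continuous_on[OF hol] that by (auto elim: continuous_on_subset)

  have ev: "\<forall>\<^sub>F n in sequentially. integral {- real n..real n} ?G
          = ?S - (?c (u n) (u' n) + ?c (u' n) (w n) - ?c (v n) (v' n) - ?c (v' n) (w' n))
              + \<i> * integral {Y' n..Y n} (\<lambda>y. F (Complex (- \<rho>) y))"
  proof -
    have "\<forall>\<^sub>F n in sequentially. max 1 r \<le> Y n \<and> Y' n \<le> min (- 1) (- r)"
      using upper(2) lower(2) by (auto simp: filterlim_at_bot filterlim_at_top eventually_conj_iff)
    with upper(1) lower(1) eventually_gt_at_top[of 0] show ?thesis
    proof eventually_elim
      case (elim n)
      define h where "h = subpath (- real n) (real n) g"
      \<comment> \<open>Vertically away from the real axis, across to Re = -\<rho>, along that line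
        through the real axis, and back in the same manner. Only the middle piece meets the real
        axis. Vertical moves away from the axis increase the norm, the horizontal pieces have |Im|
        >= r and the middle piece has |Re| = \<rho> >= r, so all of d avoids
        \<open>ball 0 r\<close>.\<close>
      define d where "d = linepath (u n) (u' n) +++ linepath (u' n) (w n) +++ linepath (w n) (w' n)
                            +++ linepath (w' n) (v' n) +++ linepath (v' n) (v n)"
      have seg1: "closed_segment (u n) (u' n) \<inter> \<real> = {}" "closed_segment (u n) (u' n) \<inter> ball 0 r = {}"
      proof -
        have *: "Re z = Re (u n) \<and> Im (u n) \<le> Im z" if "z \<in> closed_segment (u n) (u' n)" for z
          using that elim by (auto simp: closed_segment_same_Re defs closed_segment_eq_real_ivl)
        then show "closed_segment (u n) (u' n) \<inter> \<real> = {}"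
          using elim by (fastforce simp: u_def complex_is_Real_iff)
        have "norm (u n) \<le> norm z" if "z \<in> closed_segment (u n) (u' n)" for z
          using *[OF that] elim by (auto simp: cmod_def defs)
        then show "closed_segment (u n) (u' n) \<inter> ball 0 r = {}"
          using elim unfolding u_def by (meson disjoint_iff mem_ball_0 not_le order_trans)
      qed
      have seg2: "closed_segment (u' n) (w n) \<inter> \<real> = {}" "closed_segment (u' n) (w n) \<inter> ball 0 r = {}"
      proof -
        have *: "Im z = Y n" if "z \<in> closed_segment (u' n) (w n)" for z
          using that by (auto simp: closed_segment_same_Im defs)
        then show "closed_segment (u' n) (w n) \<inter> \<real> = {}"
          using elim by (force simp: complex_is_Real_iff)
        have "r \<le> norm z" if "z \<in> closed_segment (u' n) (w n)" for z
          using *[OF that] elim abs_Im_le_cmod[of z] by auto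
        then show "closed_segment (u' n) (w n) \<inter> ball 0 r = {}"
          by force
      qed
      have seg3: "closed_segment (w n) (w' n) \<inter> \<real> \<subseteq> {of_real (- \<rho>)}"
        "closed_segment (w n) (w' n) \<inter> ball 0 r = {}"
      proof -
        have *: "Re z = - \<rho>" if "z \<in> closed_segment (w n) (w' n)" for z
          using that by (auto simp: closed_segment_same_Re defs)
        then show "closed_segment (w n) (w' n) \<inter> \<real> \<subseteq> {of_real (- \<rho>)}"
          by (auto simp: complex_is_Real_iff complex_eq_iff)
        have "r \<le> norm z" if "z \<in> closed_segment (w n) (w' n)" for z
          using *[OF that] \<rho> abs_Re_le_cmod[of z] by auto
        then show "closed_segment (w n) (w' n) \<inter> ball 0 r = {}"
          by force
      qed
      have seg4: "closed_segment (w' n) (v' n) \<inter> \<real> = {}" "closed_segment (w' n) (v' n) \<inter> ball 0 r = {}"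
      proof -
        have *: "Im z = Y' n" if "z \<in> closed_segment (w' n) (v' n)" for z
          using that by (auto simp: closed_segment_same_Im defs)
        then show "closed_segment (w' n) (v' n) \<inter> \<real> = {}"
          using elim by (force simp: complex_is_Real_iff)
        have "r \<le> norm z" if "z \<in> closed_segment (w' n) (v' n)" for z
          using *[OF that] elim abs_Im_le_cmod[of z] by auto
        then show "closed_segment (w' n) (v' n) \<inter> ball 0 r = {}"
          by force
      qed
      have seg5: "closed_segment (v' n) (v n) \<inter> \<real> = {}" "closed_segment (v' n) (v n) \<inter> ball 0 r = {}"
      proof -
        have *: "Re z = Re (v n) \<and> Im z \<le> Im (v n)" if "z \<in> closed_segment (v' n) (v n)" for z
          using that elim by (auto simp: closed_segment_same_Re defs closed_segment_eq_real_ivl)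
        then show "closed_segment (v' n) (v n) \<inter> \<real> = {}"
          using elim by (fastforce simp: v_def complex_is_Real_iff)
        have "norm (v n) \<le> norm z" if "z \<in> closed_segment (v' n) (v n)" for z
        proof -
          have "\<bar>Im (v n)\<bar> \<le> \<bar>Im z\<bar>"
            using *[OF that] elim by (auto simp: defs)
          then have "(Im (v n))\<^sup>2 \<le> (Im z)\<^sup>2"
            by (rule abs_le_square_iff[THEN iffD1])
          then show ?thesis
            using *[OF that] by (auto simp: cmod_def)
        qed
        then show "closed_segment (v' n) (v n) \<inter> ball 0 r = {}"
          using elim unfolding v_def by (meson disjoint_iff mem_ball_0 not_le order_trans)
      qed
      have nonpole: "closed_segment a b \<inter> (L \<union> R) = {}" if "closed_segment a b \<inter> \<real> \<subseteq> {of_real (- \<rho>)}" for a b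
        using that real \<rho>(2) by blast
      have F_int: "F contour_integrable_on linepath (u n) (u' n)"
        "F contour_integrable_on linepath (u' n) (w n)" "F contour_integrable_on linepath (w n) (w' n)"
        "F contour_integrable_on linepath (w' n) (v' n)" "F contour_integrable_on linepath (v' n) (v n)"
        using seg1(1) seg2(1) seg3(1) seg4(1) seg5(1)
        by (auto intro!: contour_integrable_continuous_linepath cont nonpole)
      have "contour_integral h F + contour_integral d F = ?S"
      proof (rule closed_contour_residues[OF hol real fin K K' KK' \<rho>(1)])
        show "valid_path h"
          using elim by (auto simp: h_def intro!: valid_path_subpath_real g)
        show "path_image h \<inter> (K \<union> K' \<union> of_real ` {..q\<^sub>0} \<union> of_real ` {q\<^sub>1..}) = {}"
          using g(2) by (force simp: h_def path_image_subpath_gen)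
        show "valid_path d"
          by (auto simp: d_def intro!: valid_path_join)
        have "path_image d = closed_segment (u n) (u' n) \<union> (closed_segment (u' n) (w n) \<union>
                (closed_segment (w n) (w' n) \<union> (closed_segment (w' n) (v' n) \<union> closed_segment (v' n) (v n))))"
          by (simp add: d_def path_image_join)
        then show "path_image d \<inter> ball 0 r = {}" "path_image d \<inter> \<real> \<subseteq> {of_real (- \<rho>)}"
          using seg1 seg2 seg3 seg4 seg5 by (simp_all add: Int_Un_distrib2)
      qed (use elim \<rho> in \<open>auto simp: h_def d_def defs\<close>)
      moreover have "contour_integral h F = integral {- real n..real n} ?G"
        unfolding h_def
      proof (rule contour_integral_unique, rule has_contour_integral_subpath_real)
        have "?G integrable_on {- real n..real n}"
          using int_g by (rule integrable_on_subinterval) auto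
        then show "(?G has_integral integral {- real n..real n} ?G) {- real n..real n}"
          by (rule integrable_integral)
      qed (use elim g in auto)
      moreover have "contour_integral d F = ?c (u n) (u' n) + (?c (u' n) (w n) + (?c (w n) (w' n) +
                       (?c (w' n) (v' n) + ?c (v' n) (v n))))"
        using F_int by (simp add: d_def valid_path_join contour_integrable_joinI)
      moreover have "?c (w n) (w' n) = - ?c (w' n) (w n)" "?c (w' n) (v' n) = - ?c (v' n) (w' n)"
        "?c (v' n) (v n) = - ?c (v n) (v' n)"
        using seg3(1) seg4(1) seg5(1)
        by (auto intro!: contour_integral_reverse_linepath cont nonpole)
      moreover have "?c (w' n) (w n) = \<i> * integral {Y' n..Y n} (\<lambda>y. F (Complex (- \<rho>) y))"
        using elim by (intro contour_integral_linepath_same_Re) (auto simp: defs)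
      ultimately show ?case
        by (simp add: algebra_simps)
    qed
  qed
  have "(\<lambda>n. integral {- real n..real n} ?G) \<longlonglongrightarrow> integral UNIV ?G"
    by (rule integral_expanding_interval_limit[OF int_g])
       (auto simp: filterlim_real_sequentially filterlim_uminus_at_bot)
  moreover have "(\<lambda>n. ?S - (?c (u n) (u' n) + ?c (u' n) (w n) - ?c (v n) (v' n) - ?c (v' n) (w' n))
              + \<i> * integral {Y' n..Y n} (\<lambda>y. F (Complex (- \<rho>) y)))
           \<longlonglongrightarrow> ?S - (0 + 0 - 0 - 0) + \<i> * integral UNIV (\<lambda>y. F (Complex (- \<rho>) y))"
    unfolding defs
    by (intro tendsto_intros upper lower integral_expanding_interval_limit[OF int_line])
  then have "(\<lambda>n. integral {- real n..real n} ?G)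
           \<longlonglongrightarrow> ?S - (0 + 0 - 0 - 0) + \<i> * integral UNIV (\<lambda>y. F (Complex (- \<rho>) y))"
    by (simp only: tendsto_cong[OF ev])
  ultimately show ?thesis
    by (simp add: LIMSEQ_unique)
qed

section \<open>The function \<open>\<theta>\<close>\<close>

text \<open>The minimum of Gamma on the positive axis lies near 1.46, hence the threshold
  3/2.\<close>

lemma Gamma_real_mono_ge: "3 / 2 \<le> x \<Longrightarrow> x \<le> y \<Longrightarrow> Gamma x \<le> Gamma y" for x y :: real
  using Gamma_real_strict_mono[of x y] by (cases "x = y") auto

lemma sin_nonreal: "Im s \<noteq> 0 \<Longrightarrow> sin s \<noteq> 0" for s :: complex
  using sin_eq_0[of s] by force

locale fox_setting =
  fixes \<alpha> \<beta> :: real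
  assumes \<beta>: "0 < \<beta>" "\<beta> \<le> 1" and \<alpha>: "1 < \<alpha>" "\<alpha> < 2"
begin

definition upper_params :: "(complex \<times> real) list" where
  "upper_params = [(1, 1 / \<alpha>), (of_real \<beta>, \<beta> / \<alpha>), (1, 1 / 2)]"

definition lower_params :: "(complex \<times> real) list" where
  "lower_params = [(1, 1), (1, 1 / \<alpha>), (1, 1 / 2)]"

definition theta :: "complex \<Rightarrow> complex" where
  "theta = fox_theta 2 1 upper_params lower_params"

definition lpoles :: "complex set" where
  "lpoles = left_poles 2 lower_params"

definition rpoles :: "complex set" where
  "rpoles = right_poles 1 upper_params"

lemma lpoles_eq:
  "lpoles = range (\<lambda>n. of_real (- (1 + real n))) \<union> range (\<lambda>n. of_real (- (\<alpha> * (1 + real n))))"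
proof -
  have ex: "(\<exists>j<2. P j) \<longleftrightarrow> P 0 \<or> P (1::nat)" for P
    by (auto simp: less_2_cases_iff)
  have nonpos: "s \<in> \<int>\<^sub>\<le>\<^sub>0 \<longleftrightarrow> (\<exists>n. s = - of_nat n)" for s :: complex
    by (auto elim: nonpos_Ints_cases')
  have "1 + \<xi> = - of_nat n \<longleftrightarrow> \<xi> = of_real (- (1 + real n))" for \<xi> :: complex and n
    by (auto simp: complex_eq_iff)
  moreover have "1 + of_real (1 / \<alpha>) * \<xi> = - of_nat n \<longleftrightarrow> \<xi> = of_real (- (\<alpha> * (1 + real n)))" for \<xi> :: complex and n
    using \<alpha> by (auto simp: complex_eq_iff field_simps)
  ultimately have "1 + \<xi> \<in> \<int>\<^sub>\<le>\<^sub>0 \<longleftrightarrow> \<xi> \<in> range (\<lambda>n. of_real (- (1 + real n)))"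
    "1 + of_real (1 / \<alpha>) * \<xi> \<in> \<int>\<^sub>\<le>\<^sub>0 \<longleftrightarrow> \<xi> \<in> range (\<lambda>n. of_real (- (\<alpha> * (1 + real n))))" for \<xi> :: complex
    by (simp_all only: nonpos image_iff bex_UNIV)
  then show ?thesis
    unfolding lpoles_def left_poles_def lower_params_def ex by auto
qed

lemma rpoles_eq: "rpoles = range (\<lambda>n. of_real (\<alpha> * real n))"
proof -
  have ex: "(\<exists>j<1. P j) \<longleftrightarrow> P (0::nat)" for P
    by auto
  have nonpos: "s \<in> \<int>\<^sub>\<le>\<^sub>0 \<longleftrightarrow> (\<exists>n. s = - of_nat n)" for s :: complex
    by (auto elim: nonpos_Ints_cases')
  have "- (of_real (1 / \<alpha>) * \<xi>) = - of_nat n \<longleftrightarrow> \<xi> = of_real (\<alpha> * real n)" for \<xi> :: complex and n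
    using \<alpha> by (auto simp: complex_eq_iff field_simps)
  then have "- (of_real (1 / \<alpha>) * \<xi>) \<in> \<int>\<^sub>\<le>\<^sub>0 \<longleftrightarrow> \<xi> \<in> range (\<lambda>n. of_real (\<alpha> * real n))" for \<xi> :: complex
    by (simp_all only: nonpos image_iff bex_UNIV)
  then show ?thesis
    unfolding rpoles_def right_poles_def upper_params_def ex by auto
qed

lemma theta_eq:
  "theta \<xi> = Gamma (1 + \<xi>) * Gamma (1 + \<xi> / of_real \<alpha>) * Gamma (- (\<xi> / of_real \<alpha>)) *
     rGamma (- (\<xi> / 2)) * rGamma (of_real \<beta> + of_real (\<beta> / \<alpha>) * \<xi>) * rGamma (1 + \<xi> / 2)"
  by (simp add: theta_def fox_theta_def upper_params_def lower_params_def numeral_2_eq_2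
        numeral_3_eq_3 atLeastLessThanSuc_atLeastAtMost rGamma_inverse_Gamma field_simps)

text \<open>Two pairs of Gamma factors, with arguments in xi/\<alpha> and xi/2, are reflection pairs
  and collapse to sines. The identity also holds at zeros of the denominator, where the default
  values make both sides 0.\<close>

lemma theta_eq_sin:
  "theta \<xi> = Gamma (1 + \<xi>) * rGamma (of_real \<beta> + of_real (\<beta> / \<alpha>) * \<xi>) *
     sin (of_real pi * \<xi> / 2) / sin (of_real pi * \<xi> / of_real \<alpha>)"
proof -
  have "rGamma (- (\<xi> / 2)) * rGamma (1 + \<xi> / 2) = - sin (of_real pi * \<xi> / 2) / of_real pi"
    using rGamma_reflection_complex[of "- (\<xi> / 2)"] by simp
  moreover have "Gamma (1 + \<xi> / of_real \<alpha>) * Gamma (- (\<xi> / of_real \<alpha>))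
                   = - of_real pi / sin (of_real pi * \<xi> / of_real \<alpha>)"
    using Gamma_reflection_complex[of "- (\<xi> / of_real \<alpha>)"] by (simp add: mult.commute)
  moreover have "theta \<xi> = Gamma (1 + \<xi>) * rGamma (of_real \<beta> + of_real (\<beta> / \<alpha>) * \<xi>) *
      (Gamma (1 + \<xi> / of_real \<alpha>) * Gamma (- (\<xi> / of_real \<alpha>))) *
      (rGamma (- (\<xi> / 2)) * rGamma (1 + \<xi> / 2))"
    by (simp only: theta_eq mult_ac)
  ultimately show ?thesis
    by simp
qed

text \<open>One more reflection trades Gamma(1 + xi) for 1/Gamma(-xi), an entire function whose
  argument has large positive real part far to the left; the duplication of the sine cancels sin(pi
  xi/2). In this form upper bounds need only estimates of \<open>rGamma\<close> above and of sine
  and cosine below.\<close>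

lemma theta_eq_nonreal:
  assumes "Im \<xi> \<noteq> 0"
  shows "theta \<xi> = - (of_real pi / 2) * rGamma (- \<xi>) * rGamma (of_real \<beta> + of_real (\<beta> / \<alpha>) * \<xi>) /
           (sin (of_real pi * \<xi> / of_real \<alpha>) * cos (of_real pi * \<xi> / 2))"
proof -
  have "1 + \<xi> \<notin> \<int>\<^sub>\<le>\<^sub>0"
    using assms by (auto elim!: nonpos_Ints_cases simp: complex_eq_iff)
  then have nz: "rGamma (1 + \<xi>) \<noteq> 0"
    by (simp add: rGamma_eq_zero_iff)
  have sin_nz: "sin (of_real pi * \<xi>) \<noteq> 0"
    using assms by (intro sin_nonreal) simp
  have "rGamma (1 + \<xi>) * rGamma (- \<xi>) = - sin (of_real pi * \<xi>) / of_real pi"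
    using rGamma_reflection_complex[of "- \<xi>"] by (simp add: mult.commute)
  then have "Gamma (1 + \<xi>) = - of_real pi * rGamma (- \<xi>) / sin (of_real pi * \<xi>)"
    using nz sin_nz by (simp add: Gamma_def field_simps)
  moreover have "sin (of_real pi * \<xi>) = 2 * sin (of_real pi * \<xi> / 2) * cos (of_real pi * \<xi> / 2)"
    using sin_double[of "of_real pi * \<xi> / 2"] by simp
  moreover from this have "sin (of_real pi * \<xi> / 2) \<noteq> 0"
    using sin_nz by auto
  ultimately show ?thesis
    by (simp add: theta_eq_sin mult_ac)
qed

section \<open>Size of \<open>theta\<close> in vertical strips, far to the left and far to the
  right\<close>

lemma norm_sin_scaled_ge:
  assumes "\<phi> > 0" "c > 0"
  shows "\<exists>d>0. \<forall>\<xi>. \<bar>Im \<xi>\<bar> \<ge> \<phi> \<longrightarrow>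
     d * exp (c * \<bar>Im \<xi>\<bar>) \<le> norm (sin (of_real c * \<xi>)) \<and> d * exp (c * \<bar>Im \<xi>\<bar>) \<le> norm (cos (of_real c * \<xi>))"
proof (intro exI conjI allI impI)
  show "0 < (1 - exp (- (2 * (c * \<phi>)))) / 2"
    using assms by simp
next
  fix \<xi> :: complex assume "\<phi> \<le> \<bar>Im \<xi>\<bar>"
  then have "c * \<phi> \<le> \<bar>Im (of_real c * \<xi>)\<bar>"
    using assms by (simp add: abs_mult)
  from norm_sin_ge[OF this] norm_cos_ge[OF this] assms
  show "(1 - exp (- (2 * (c * \<phi>)))) / 2 * exp (c * \<bar>Im \<xi>\<bar>) \<le> norm (sin (of_real c * \<xi>))"
    and "(1 - exp (- (2 * (c * \<phi>)))) / 2 * exp (c * \<bar>Im \<xi>\<bar>) \<le> norm (cos (of_real c * \<xi>))"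
    by (simp_all add: abs_mult)
qed

lemma norm_theta_denominator_ge:
  assumes "\<phi> > 0"
  shows "\<exists>d>0. \<forall>\<xi>. \<bar>Im \<xi>\<bar> \<ge> \<phi> \<longrightarrow> d * exp ((pi / \<alpha> + pi / 2) * \<bar>Im \<xi>\<bar>)
           \<le> norm (sin (of_real pi * \<xi> / of_real \<alpha>) * cos (of_real pi * \<xi> / 2))"
proof -
  from norm_sin_scaled_ge[OF assms, of "pi / \<alpha>"] \<alpha> obtain d1 where
    d1: "d1 > 0" "\<And>\<xi>. \<bar>Im \<xi>\<bar> \<ge> \<phi> \<Longrightarrow> d1 * exp (pi / \<alpha> * \<bar>Im \<xi>\<bar>) \<le> norm (sin (of_real (pi / \<alpha>) * \<xi>))"
    by auto
  from norm_sin_scaled_ge[OF assms, of "pi / 2"] obtain d2 where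
    d2: "d2 > 0" "\<And>\<xi>. \<bar>Im \<xi>\<bar> \<ge> \<phi> \<Longrightarrow> d2 * exp (pi / 2 * \<bar>Im \<xi>\<bar>) \<le> norm (cos (of_real (pi / 2) * \<xi>))"
    by auto
  have "d1 * d2 * exp ((pi / \<alpha> + pi / 2) * \<bar>Im \<xi>\<bar>)
           \<le> norm (sin (of_real pi * \<xi> / of_real \<alpha>) * cos (of_real pi * \<xi> / 2))"
    if "\<bar>Im \<xi>\<bar> \<ge> \<phi>" for \<xi>
  proof -
    have "d1 * exp (pi / \<alpha> * \<bar>Im \<xi>\<bar>) * (d2 * exp (pi / 2 * \<bar>Im \<xi>\<bar>))
            \<le> norm (sin (of_real (pi / \<alpha>) * \<xi>)) * norm (cos (of_real (pi / 2) * \<xi>))"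
      using d1 d2 that by (intro mult_mono) auto
    moreover have "exp ((pi / \<alpha> + pi / 2) * \<bar>Im \<xi>\<bar>) = exp (pi / \<alpha> * \<bar>Im \<xi>\<bar>) * exp (pi / 2 * \<bar>Im \<xi>\<bar>)"
      by (simp add: distrib_right flip: exp_add)
    ultimately show ?thesis
      by (simp add: norm_mult mult_ac)
  qed
  then show ?thesis
    using d1(1) d2(1) by (intro exI[of _ "d1 * d2"]) auto
qed

text \<open>With kappa = \<beta>/\<alpha>, the two reciprocal Gamma factors grow at rates pi/2 and
  kappa pi/2, up to \<epsilon>, and the denominator at rate pi/\<alpha> + pi/2. Since kappa <=
  1/\<alpha>, the net rate is at most -pi/(2 \<alpha>) before the losses.\<close>

lemma theta_vertical_strip_bound:
  "\<exists>C>0. \<forall>\<xi>. a \<le> Re \<xi> \<and> Re \<xi> \<le> b \<and> 1 \<le> \<bar>Im \<xi>\<bar> \<longrightarrow>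
     norm (theta \<xi>) \<le> C * exp (- (pi / (4 * \<alpha>)) * \<bar>Im \<xi>\<bar>)"
proof -
  define \<kappa> where "\<kappa> = \<beta> / \<alpha>"
  \<comment> \<open>The losses amount to \<epsilon> (1 + kappa) <= 2 \<epsilon> = pi/(4 \<alpha>),
    half of the available decay.\<close>
  define \<epsilon> where "\<epsilon> = pi / \<alpha> / 8"
  have \<kappa>: "0 < \<kappa>" "\<kappa> \<le> 1 / \<alpha>" "\<kappa> \<le> 1" and "\<epsilon> > 0"
    using \<alpha> \<beta> by (auto simp: \<kappa>_def \<epsilon>_def field_simps)
  obtain C1 where C1: "C1 > 0"
    "\<And>s. - b \<le> Re s \<Longrightarrow> Re s \<le> - a \<Longrightarrow> norm (rGamma s) \<le> C1 * exp ((pi / 2 + \<epsilon>) * \<bar>Im s\<bar>)"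
    using norm_rGamma_strip[OF \<open>\<epsilon> > 0\<close>, of "- b" "- a"] by blast
  obtain C2 where C2: "C2 > 0"
    "\<And>s. \<beta> + \<kappa> * a \<le> Re s \<Longrightarrow> Re s \<le> \<beta> + \<kappa> * b \<Longrightarrow> norm (rGamma s) \<le> C2 * exp ((pi / 2 + \<epsilon>) * \<bar>Im s\<bar>)"
    using norm_rGamma_strip[OF \<open>\<epsilon> > 0\<close>, of "\<beta> + \<kappa> * a" "\<beta> + \<kappa> * b"] by blast
  obtain d where d: "d > 0" "\<And>\<xi>. \<bar>Im \<xi>\<bar> \<ge> 1 \<Longrightarrow> d * exp ((pi / \<alpha> + pi / 2) * \<bar>Im \<xi>\<bar>)
           \<le> norm (sin (of_real pi * \<xi> / of_real \<alpha>) * cos (of_real pi * \<xi> / 2))"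
    using norm_theta_denominator_ge[of 1] by auto
  have "norm (theta \<xi>) \<le> pi / 2 * C1 * C2 / d * exp (- (pi / (4 * \<alpha>)) * \<bar>Im \<xi>\<bar>)"
    if \<xi>: "a \<le> Re \<xi>" "Re \<xi> \<le> b" "1 \<le> \<bar>Im \<xi>\<bar>" for \<xi>
  proof -
    let ?y = "\<bar>Im \<xi>\<bar>"
    have "norm (rGamma (- \<xi>)) \<le> C1 * exp ((pi / 2 + \<epsilon>) * ?y)"
      using C1(2)[of "- \<xi>"] \<xi> by simp
    moreover have "norm (rGamma (of_real \<beta> + of_real \<kappa> * \<xi>)) \<le> C2 * exp ((pi / 2 + \<epsilon>) * (\<kappa> * ?y))"
      using C2(2)[of "of_real \<beta> + of_real \<kappa> * \<xi>"] \<xi> \<kappa> by (simp add: abs_mult)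
    ultimately have num: "norm (rGamma (- \<xi>)) * norm (rGamma (of_real \<beta> + of_real \<kappa> * \<xi>))
        \<le> (C1 * exp ((pi / 2 + \<epsilon>) * ?y)) * (C2 * exp ((pi / 2 + \<epsilon>) * (\<kappa> * ?y)))"
      using C1(1) by (intro mult_mono) auto
    have "norm (theta \<xi>) = pi / 2 * (norm (rGamma (- \<xi>)) * norm (rGamma (of_real \<beta> + of_real \<kappa> * \<xi>))) /
            norm (sin (of_real pi * \<xi> / of_real \<alpha>) * cos (of_real pi * \<xi> / 2))"
      using \<xi> by (subst theta_eq_nonreal) (auto simp: norm_mult norm_divide \<kappa>_def)
    also have "\<dots> \<le> pi / 2 * ((C1 * exp ((pi / 2 + \<epsilon>) * ?y)) * (C2 * exp ((pi / 2 + \<epsilon>) * (\<kappa> * ?y)))) /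
                      (d * exp ((pi / \<alpha> + pi / 2) * ?y))"
      using num d \<xi> C1 C2 by (intro frac_le mult_left_mono) auto
    also have "\<dots> = pi / 2 * C1 * C2 / d *
                exp ((pi / 2 + \<epsilon>) * ?y + (pi / 2 + \<epsilon>) * (\<kappa> * ?y) - (pi / \<alpha> + pi / 2) * ?y)"
      by (simp add: exp_add exp_diff mult_ac)
    also have "\<dots> \<le> pi / 2 * C1 * C2 / d * exp (- (pi / (4 * \<alpha>)) * ?y)"
    proof -
      have "\<epsilon> * (1 + \<kappa>) \<le> \<epsilon> * 2"
        using \<kappa> \<open>\<epsilon> > 0\<close> by (intro mult_left_mono) auto
      moreover have "pi / 2 * \<kappa> \<le> pi / 2 * (1 / \<alpha>)"
        using \<kappa> by (intro mult_left_mono) auto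
      ultimately have "(pi / 2 + \<epsilon>) + (pi / 2 + \<epsilon>) * \<kappa> - (pi / \<alpha> + pi / 2) \<le> - (pi / \<alpha> / 4)"
        by (simp add: \<epsilon>_def distrib_left distrib_right)
      then have "((pi / 2 + \<epsilon>) + (pi / 2 + \<epsilon>) * \<kappa> - (pi / \<alpha> + pi / 2)) * ?y \<le> - (pi / (4 * \<alpha>)) * ?y"
        by (intro mult_right_mono) (auto simp: mult.commute)
      then show ?thesis
        using C1 C2 d by (intro mult_left_mono) (auto simp: algebra_simps)
    qed
    finally show ?thesis .
  qed
  then show ?thesis
    using C1 C2 d by (intro exI[of _ "pi / 2 * C1 * C2 / d"]) auto
qed

text \<open>For Re xi = -x the factor 1/Gamma(-xi) contributes 1/Gamma(x). Reflecting the other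
  reciprocal Gamma factor gives a sine times Gamma(s + 1)/s, and |Gamma(s + 1)| <= Gamma(2 - \<beta>
  + kappa x) <= Gamma(x) because kappa < 1, so the Gamma values cancel. The remaining exponential
  rate pi kappa - pi/\<alpha> is 0 when \<beta> = 1; the decay in |Im xi| therefore comes from
  1/|s|, which is why Gamma(s) is not bounded directly.\<close>

lemma theta_far_left_bound:
  assumes "\<phi> > 0"
  shows "\<exists>r>0. \<exists>C>0. \<forall>\<xi>. Re \<xi> \<le> - r \<and> \<phi> \<le> \<bar>Im \<xi>\<bar> \<longrightarrow> norm (theta \<xi>) \<le> C / \<bar>Im \<xi>\<bar>"
proof -
  define \<kappa> where "\<kappa> = \<beta> / \<alpha>"
  have \<kappa>: "0 < \<kappa>" "\<kappa> \<le> 1 / \<alpha>" "\<kappa> < 1"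
    using \<alpha> \<beta> by (auto simp: \<kappa>_def field_simps)
  obtain d where d: "d > 0" "\<And>\<xi>. \<bar>Im \<xi>\<bar> \<ge> \<phi> \<Longrightarrow> d * exp ((pi / \<alpha> + pi / 2) * \<bar>Im \<xi>\<bar>)
           \<le> norm (sin (of_real pi * \<xi> / of_real \<alpha>) * cos (of_real pi * \<xi> / 2))"
    using norm_theta_denominator_ge[OF assms] by auto
  \<comment> \<open>The bound x >= \<alpha> gives kappa x >= \<beta>, so 2 - \<beta> + kappa x lies
    in the range where Gamma increases; x >= 2/(1 - kappa) gives 2 - \<beta> + kappa x <= x.\<close>
  define r where "r = max \<alpha> (2 / (1 - \<kappa>))"
  have "norm (theta \<xi>) \<le> (1 / (2 * \<kappa> * d)) / \<bar>Im \<xi>\<bar>" if \<xi>: "Re \<xi> \<le> - r" "\<phi> \<le> \<bar>Im \<xi>\<bar>" for \<xi>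
  proof -
    define y where "y = \<bar>Im \<xi>\<bar>"
    define x where "x = - Re \<xi>"
    define s where "s = 1 - of_real \<beta> - of_real \<kappa> * \<xi>"
    have "y > 0"
      using \<xi> assms by (simp add: y_def)
    have x: "x \<ge> \<alpha>" "x \<ge> 2 / (1 - \<kappa>)"
      using \<xi> by (auto simp: x_def r_def)
    have s: "Re s = 1 - \<beta> + \<kappa> * x" "\<bar>Im s\<bar> = \<kappa> * y"
      using \<kappa> by (auto simp: s_def x_def y_def abs_mult)
    have "\<kappa> * x \<ge> \<beta>"
      using x \<alpha> \<beta> by (simp add: \<kappa>_def field_simps)
    have "2 \<le> (1 - \<kappa>) * x"
      using x \<kappa> by (simp add: field_simps)
    then have le_x: "2 - \<beta> + \<kappa> * x \<le> x"
      using \<beta> by (simp add: algebra_simps)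
    have "s \<notin> \<int>\<^sub>\<le>\<^sub>0"
      using s(2) \<kappa> \<open>y > 0\<close> by (auto elim!: nonpos_Ints_cases)
    then have "rGamma s \<noteq> 0" "s \<noteq> 0"
      by (auto simp: rGamma_eq_zero_iff)
    have *: "rGamma (of_real \<beta> + of_real \<kappa> * \<xi>) * rGamma s
            = sin (of_real pi * (of_real \<beta> + of_real \<kappa> * \<xi>)) / of_real pi"
      using rGamma_reflection_complex[of "of_real \<beta> + of_real \<kappa> * \<xi>"]
      by (simp add: s_def algebra_simps)
    have "rGamma (of_real \<beta> + of_real \<kappa> * \<xi>)
            = sin (of_real pi * (of_real \<beta> + of_real \<kappa> * \<xi>)) / of_real pi * (Gamma (s + 1) / s)"
    proof -
      have "Gamma (s + 1) / s = inverse (rGamma s)"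
        using \<open>s \<noteq> 0\<close> Gamma_plus1[OF \<open>s \<notin> \<int>\<^sub>\<le>\<^sub>0\<close>] by (simp add: Gamma_def)
      then show ?thesis
        unfolding *[symmetric] using \<open>rGamma s \<noteq> 0\<close> by simp
    qed
    moreover have "norm (sin (of_real pi * (of_real \<beta> + of_real \<kappa> * \<xi>))) \<le> exp (pi * \<kappa> * y)"
      using norm_sin_le[of "of_real pi * (of_real \<beta> + of_real \<kappa> * \<xi>)"] \<kappa>
      by (simp add: y_def abs_mult mult.assoc)
    moreover have "norm (Gamma (s + 1) / s) \<le> Gamma x / (\<kappa> * y)"
    proof -
      have "norm (Gamma (s + 1)) \<le> Gamma (2 - \<beta> + \<kappa> * x)"
        using norm_Gamma_le[of "s + 1"] s \<open>\<kappa> * x \<ge> \<beta>\<close> by (simp add: algebra_simps)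
      also have "\<dots> \<le> Gamma x"
        using le_x \<open>\<kappa> * x \<ge> \<beta>\<close> by (intro Gamma_real_mono_ge) auto
      finally show ?thesis
        using abs_Im_le_cmod[of s] s \<kappa> \<open>y > 0\<close>
        by (auto simp: norm_divide intro!: frac_le order_trans[OF norm_ge_zero])
    qed
    ultimately have r1: "norm (rGamma (of_real \<beta> + of_real \<kappa> * \<xi>))
                       \<le> exp (pi * \<kappa> * y) / pi * (Gamma x / (\<kappa> * y))"
      by (simp only: norm_mult norm_divide[of "sin _"] norm_of_real abs_of_pos[OF pi_gt_zero])
         (intro mult_mono divide_right_mono, auto)
    have "Gamma x > 0"
      using x \<alpha> by (intro Gamma_real_pos) auto
    have "norm (rGamma (- \<xi>)) \<le> exp (pi / 2 * y) * rGamma x"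
      using norm_rGamma_le[of "- \<xi>"] x \<alpha> by (simp add: x_def y_def)
    also have "\<dots> = exp (pi / 2 * y) / Gamma x"
      by (simp only: rGamma_inverse_Gamma divide_inverse)
    finally have num: "norm (rGamma (- \<xi>)) * norm (rGamma (of_real \<beta> + of_real \<kappa> * \<xi>))
        \<le> exp (pi / 2 * y) / Gamma x * (exp (pi * \<kappa> * y) / pi * (Gamma x / (\<kappa> * y)))"
      using r1 \<open>Gamma x > 0\<close> by (intro mult_mono) auto
    have "norm (theta \<xi>) = pi / 2 * (norm (rGamma (- \<xi>)) * norm (rGamma (of_real \<beta> + of_real \<kappa> * \<xi>))) /
            norm (sin (of_real pi * \<xi> / of_real \<alpha>) * cos (of_real pi * \<xi> / 2))"
      using \<xi> assms by (subst theta_eq_nonreal) (auto simp: norm_mult norm_divide \<kappa>_def)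
    also have "\<dots> \<le> pi / 2 * (exp (pi / 2 * y) / Gamma x * (exp (pi * \<kappa> * y) / pi * (Gamma x / (\<kappa> * y)))) /
                      (d * exp ((pi / \<alpha> + pi / 2) * y))"
      using num d \<xi> \<open>Gamma x > 0\<close> \<open>y > 0\<close> \<kappa> by (intro frac_le mult_left_mono) (auto simp: y_def)
    also have "\<dots> = (1 / (2 * \<kappa> * d)) / y * (exp (pi / 2 * y) * exp (pi * \<kappa> * y) / exp ((pi / \<alpha> + pi / 2) * y))"
      using \<open>Gamma x > 0\<close> by (simp add: field_simps)
    also have "exp (pi / 2 * y) * exp (pi * \<kappa> * y) / exp ((pi / \<alpha> + pi / 2) * y) = exp ((pi * \<kappa> - pi / \<alpha>) * y)"
      by (simp add: algebra_simps flip: exp_add exp_diff)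
    also have "(1 / (2 * \<kappa> * d)) / y * exp ((pi * \<kappa> - pi / \<alpha>) * y) \<le> (1 / (2 * \<kappa> * d)) / y * 1"
    proof (intro mult_left_mono)
      have "pi * \<kappa> \<le> pi * (1 / \<alpha>)"
        using \<kappa> by (intro mult_left_mono) auto
      then show "exp ((pi * \<kappa> - pi / \<alpha>) * y) \<le> 1"
        using \<open>y > 0\<close> by (simp add: mult_le_0_iff)
    qed (use \<kappa> d \<open>y > 0\<close> in auto)
    finally show ?thesis
      by (simp add: y_def)
  qed
  moreover have "r > 0"
    using \<alpha> by (simp add: r_def)
  moreover have "1 / (2 * \<kappa> * d) > 0"
    using \<kappa> d by simp
  ultimately show ?thesis
    by blast
qed

text \<open>On a horizontal ray off the axis the sines are bounded above and away from 0. Up to a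
  constant depending on \<phi>, the Gamma quotient is at least Gamma(1 + x)/Gamma(\<beta> + kappa
  x), which is at least 1 because \<beta> <= 1 and kappa < 1.\<close>

lemma theta_far_right_bound:
  assumes "\<phi> \<noteq> 0"
  shows "\<exists>r. \<exists>c>0. \<forall>\<xi>. r \<le> Re \<xi> \<and> Im \<xi> = \<phi> \<longrightarrow> c \<le> norm (theta \<xi>)"
proof -
  define \<kappa> where "\<kappa> = \<beta> / \<alpha>"
  have \<kappa>: "0 < \<kappa>" "\<kappa> < 1"
    using \<alpha> \<beta> by (auto simp: \<kappa>_def field_simps)
  obtain d where d: "d > 0" "\<And>\<xi>. \<bar>Im \<xi>\<bar> \<ge> \<bar>\<phi>\<bar> \<Longrightarrow> d * exp (pi / 2 * \<bar>Im \<xi>\<bar>) \<le> norm (sin (of_real (pi / 2) * \<xi>))"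
    using norm_sin_scaled_ge[of "\<bar>\<phi>\<bar>" "pi / 2"] assms by auto
  \<comment> \<open>The threshold 3/(2 kappa) gives kappa x >= 3/2, which places both Gamma
    arguments in the range of monotonicity.\<close>
  have "d / exp (pi / \<alpha> * \<bar>\<phi>\<bar>) \<le> norm (theta \<xi>)" if \<xi>: "3 / (2 * \<kappa>) \<le> Re \<xi>" "Im \<xi> = \<phi>" for \<xi>
  proof -
    define x where "x = Re \<xi>"
    define s where "s = of_real \<beta> + of_real \<kappa> * \<xi>"
    have "\<kappa> * x \<ge> 3 / 2"
      using \<xi> \<kappa> by (simp add: x_def field_simps)
    moreover have "x > 0"
      using \<xi> \<kappa> less_le_trans[of 0 "3 / (2 * \<kappa>)" "Re \<xi>"] by (simp add: x_def)
    ultimately have x: "\<kappa> * x \<ge> 3 / 2" "x > 0" "\<kappa> * x \<le> x"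
      using \<kappa> by (auto simp: mult_left_le_one_le)
    have pos: "Gamma (1 + x) > 0" "Gamma (\<beta> + \<kappa> * x) > 0"
      using x \<beta> by (auto intro!: Gamma_real_pos)
    have "1 + \<xi> \<notin> \<int>\<^sub>\<le>\<^sub>0" "s \<notin> \<int>\<^sub>\<le>\<^sub>0"
      using \<xi> assms \<kappa> by (auto elim!: nonpos_Ints_cases simp: complex_eq_iff s_def)
    then have nz: "rGamma (1 + \<xi>) \<noteq> 0" "Gamma s \<noteq> 0"
      by (auto simp: rGamma_eq_zero_iff Gamma_eq_zero_iff)
    have "norm (rGamma (1 + \<xi>)) \<le> exp (pi / 2 * \<bar>\<phi>\<bar>) * rGamma (1 + x)"
      using norm_rGamma_le[of "1 + \<xi>"] x \<xi> by (simp add: x_def)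
    also have "\<dots> = exp (pi / 2 * \<bar>\<phi>\<bar>) / Gamma (1 + x)"
      by (simp only: rGamma_inverse_Gamma divide_inverse)
    finally have "norm (Gamma (1 + \<xi>)) \<ge> Gamma (1 + x) / exp (pi / 2 * \<bar>\<phi>\<bar>)"
      using nz le_imp_inverse_le[of "norm (rGamma (1 + \<xi>))"]
      by (auto simp: Gamma_def[of "1 + \<xi>"] norm_inverse dest: le_imp_inverse_le)
    moreover have "norm (Gamma s) \<le> Gamma (\<beta> + \<kappa> * x)"
      using norm_Gamma_le[of s] x \<beta> by (simp add: s_def x_def)
    then have "norm (rGamma s) \<ge> 1 / Gamma (\<beta> + \<kappa> * x)"
      using nz le_imp_inverse_le[of "norm (Gamma s)"]
      by (simp add: rGamma_inverse_Gamma norm_divide inverse_eq_divide)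
    ultimately have "Gamma (1 + x) / exp (pi / 2 * \<bar>\<phi>\<bar>) * (1 / Gamma (\<beta> + \<kappa> * x))
        \<le> norm (Gamma (1 + \<xi>)) * norm (rGamma s)"
      using pos by (intro mult_mono) auto
    moreover have "1 / exp (pi / 2 * \<bar>\<phi>\<bar>) \<le> Gamma (1 + x) / exp (pi / 2 * \<bar>\<phi>\<bar>) * (1 / Gamma (\<beta> + \<kappa> * x))"
      using Gamma_real_mono_ge[of "\<beta> + \<kappa> * x" "1 + x"] x \<beta> pos by (simp add: field_simps)
    ultimately have g: "1 / exp (pi / 2 * \<bar>\<phi>\<bar>) \<le> norm (Gamma (1 + \<xi>)) * norm (rGamma s)"
      by linarith
    have sin1: "d * exp (pi / 2 * \<bar>\<phi>\<bar>) \<le> norm (sin (of_real pi * \<xi> / 2))"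
      using d(2)[of \<xi>] \<xi> by simp
    have sin2: "norm (sin (of_real pi * \<xi> / of_real \<alpha>)) \<le> exp (pi / \<alpha> * \<bar>\<phi>\<bar>)"
      using norm_sin_le[of "of_real (pi / \<alpha>) * \<xi>"] \<xi> \<alpha> by (simp add: abs_mult)
    have "sin (of_real (pi / \<alpha>) * \<xi>) \<noteq> 0"
      using \<xi> assms \<alpha> by (intro sin_nonreal) simp
    then have sin2_pos: "norm (sin (of_real pi * \<xi> / of_real \<alpha>)) > 0"
      by simp
    have "d / exp (pi / \<alpha> * \<bar>\<phi>\<bar>)
            = 1 / exp (pi / 2 * \<bar>\<phi>\<bar>) * (d * exp (pi / 2 * \<bar>\<phi>\<bar>)) / exp (pi / \<alpha> * \<bar>\<phi>\<bar>)"
      by simp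
    also have "\<dots> \<le> norm (Gamma (1 + \<xi>)) * norm (rGamma s) * norm (sin (of_real pi * \<xi> / 2)) /
                   norm (sin (of_real pi * \<xi> / of_real \<alpha>))"
      using d(1) by (intro frac_le mult_mono g sin1 sin2 sin2_pos mult_nonneg_nonneg) auto
    also have "\<dots> = norm (theta \<xi>)"
      by (simp add: theta_eq_sin norm_mult norm_divide s_def \<kappa>_def)
    finally show ?thesis .
  qed
  then show ?thesis
    using d by (intro exI[of _ "3 / (2 * \<kappa>)"] exI[of _ "d / exp (pi / \<alpha> * \<bar>\<phi>\<bar>)"]) auto
qed

end

section \<open>Integrability and topology for curves parametrised by the real line\<close>

lemma absolutely_integrable_exp_decay:
  fixes f :: "real \<Rightarrow> complex"
  assumes cont: "continuous_on UNIV f" and "c > 0"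
    and bound: "\<And>y. 1 \<le> \<bar>y\<bar> \<Longrightarrow> norm (f y) \<le> C * exp (- c * \<bar>y\<bar>)"
  shows "f absolutely_integrable_on UNIV"
proof -
  have "bounded (f ` {-1..1})"
    using cont by (intro compact_imp_bounded compact_continuous_image) (auto elim: continuous_on_subset)
  then obtain M where M: "M > 0" "\<And>y. y \<in> {-1..1} \<Longrightarrow> norm (f y) \<le> M"
    by (auto simp: bounded_pos)
  \<comment> \<open>The sum \<open>e y + e (- y)\<close> dominates exp(-c |y|) and is built from an
    integral over a half-line. In the constant below, \<open>M * exp c\<close> takes care of |y| <=
    1 and |C| of the tails.\<close>
  define e where "e y = indicator {0..} y *\<^sub>R exp (- c * y)" for y :: real
  have "(\<lambda>y. exp (- c * y)) integrable_on {0..}"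
    using has_integral_exp_minus_to_infinity[OF \<open>c > 0\<close>, of 0] by blast
  then have "(\<lambda>y. exp (- c * y)) absolutely_integrable_on {0..}"
    by (intro nonnegative_absolutely_integrable_1) auto
  then have e: "integrable lborel e"
    unfolding e_def[abs_def] set_integrable_def by (subst (asm) integrable_completion) auto
  then have "integrable lborel (\<lambda>y. e (0 + - 1 * y))"
    by (rule lborel_integrable_real_affine) auto
  then have int: "(\<lambda>y. (\<bar>C\<bar> + M * exp c) * (e y + e (- y))) integrable_on UNIV"
    using e by (intro integrable_on_lborel integrable_mult_right integrable_add) auto
  have bound': "norm (f y) \<le> (\<bar>C\<bar> + M * exp c) * (e y + e (- y))" for y
  proof -
    have "norm (f y) \<le> (\<bar>C\<bar> + M * exp c) * exp (- c * \<bar>y\<bar>)"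
    proof (cases "\<bar>y\<bar> \<le> 1")
      case True
      then have "norm (f y) \<le> M"
        using M(2)[of y] by (simp add: abs_le_iff)
      also have "M = M * exp c * exp (- c * 1)"
        by (simp add: exp_minus)
      also have "\<dots> \<le> (\<bar>C\<bar> + M * exp c) * exp (- c * \<bar>y\<bar>)"
        using True M(1) \<open>c > 0\<close> by (intro mult_mono) auto
      finally show ?thesis .
    next
      case False
      then have "norm (f y) \<le> C * exp (- c * \<bar>y\<bar>)"
        by (intro bound) auto
      also have "\<dots> \<le> (\<bar>C\<bar> + M * exp c) * exp (- c * \<bar>y\<bar>)"
        using M(1) by (intro mult_right_mono) (auto intro: add_increasing2)
      finally show ?thesis .
    qed
    also have "\<dots> \<le> (\<bar>C\<bar> + M * exp c) * (e y + e (- y))"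
      using M(1) by (intro mult_left_mono) (auto simp: e_def indicator_def abs_if)
    finally show ?thesis .
  qed
  show ?thesis
    by (rule measurable_bounded_by_integrable_imp_absolutely_integrable[OF _ _ int])
       (use bound' cont in \<open>auto intro: continuous_imp_measurable_on_sets_lebesgue\<close>)
qed

text \<open>Paths from q to the finitely many points, all sharing q, form the set. Compactness
  matters: a closing curve can go round a bounded set, but not round a whole side of the
  contour.\<close>

lemma compact_connected_superset:
  fixes U :: "'a :: real_normed_vector set"
  assumes U: "open U" "connected U" and A: "finite A" "A \<subseteq> U" and q: "q \<in> U"
  shows "\<exists>K. compact K \<and> connected K \<and> q \<in> K \<and> A \<subseteq> K \<and> K \<subseteq> U"
proof -
  have "path_connected U"
    using U by (simp add: connected_open_path_connected)
  then have "\<exists>p. path p \<and> path_image p \<subseteq> U \<and> pathstart p = q \<and> pathfinish p = a" if "a \<in> A" for a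
    using that A q by (auto simp: path_connected_def)
  then obtain p where p: "\<And>a. a \<in> A \<Longrightarrow> path (p a) \<and> path_image (p a) \<subseteq> U \<and> pathstart (p a) = q \<and> pathfinish (p a) = a"
    by metis
  let ?K = "{q} \<union> (\<Union>a\<in>A. path_image (p a))"
  have q_in: "q \<in> path_image (p a)" if "a \<in> A" for a
    using p[OF that] pathstart_in_path_image by metis
  have "compact ?K"
    using A p by (intro compact_Un compact_UN) (auto simp: compact_path_image)
  moreover have "connected ?K"
  proof -
    have "connected (\<Union> (insert {q} ((\<lambda>a. path_image (p a)) ` A)))"
      using p q_in by (intro connected_Union) (auto simp: connected_path_image)
    then show ?thesis
      by simp
  qed
  moreover have "A \<subseteq> ?K"
    using p pathfinish_in_path_image by fastforce
  moreover have "?K \<subseteq> U"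
    using p q by blast
  ultimately show ?thesis
    by (intro exI[of _ ?K]) simp
qed

text \<open>Near a given point only a compact piece of the curve can occur, since both ends leave
  every disc. Closedness makes the complement open, so its components are open and
  path-connected.\<close>

lemma closed_range_proper:
  fixes g :: "real \<Rightarrow> 'a :: real_normed_vector"
  assumes cont: "continuous_on UNIV g"
    and lim: "filterlim (\<lambda>s. norm (g s)) at_top at_bot" "filterlim (\<lambda>s. norm (g s)) at_top at_top"
  shows "closed (range g)"
proof -
  have "\<exists>T. open T \<and> x \<in> T \<and> T \<subseteq> - range g" if x: "x \<in> - range g" for x
  proof -
    obtain a where a: "\<And>s. s \<le> a \<Longrightarrow> norm x + 1 \<le> norm (g s)"
      using lim(1) by (auto simp: filterlim_at_top eventually_at_bot_linorder)
    obtain b where b: "\<And>s. s \<ge> b \<Longrightarrow> norm x + 1 \<le> norm (g s)"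
      using lim(2) by (auto simp: filterlim_at_top eventually_at_top_linorder)
    have "compact (g ` {a..b})"
      using cont by (intro compact_continuous_image) (auto elim: continuous_on_subset)
    then have "open (ball x 1 - g ` {a..b})"
      by (intro open_Diff) (auto simp: compact_imp_closed)
    moreover have "x \<in> ball x 1 - g ` {a..b}"
      using x by auto
    moreover have "ball x 1 - g ` {a..b} \<subseteq> - range g"
    proof
      fix y assume y: "y \<in> ball x 1 - g ` {a..b}"
      have "norm y < norm x + 1"
        using y norm_triangle_ineq2[of y x] by (auto simp: dist_norm norm_minus_commute)
      then have "y \<noteq> g s" for s
        using a[of s] b[of s] y by (cases "s \<le> a"; cases "s \<ge> b") auto
      then show "y \<in> - range g"
        by auto
    qed
    ultimately show ?thesis
      by blast
  qed
  then have "open (- range g)"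
    by (subst open_subopen) blast
  then show ?thesis
    by (simp add: closed_def)
qed

section \<open>Location of the poles, and \<open>theta\<close> on vertical lines\<close>

context fox_setting
begin

lemma poles_real: "lpoles \<union> rpoles \<subseteq> \<real>"
  by (auto simp: lpoles_eq rpoles_eq simp del: of_real_minus of_real_mult of_real_add)

lemma lpoles_le: "p \<in> lpoles \<Longrightarrow> Re p \<le> - 1"
  using \<alpha> mult_mono[of 1 \<alpha> 1 "1 + real n" for n] by (auto simp: lpoles_eq)

lemma rpoles_ge: "p \<in> rpoles \<Longrightarrow> 0 \<le> Re p"
  using \<alpha> by (auto simp: rpoles_eq)

lemma finite_poles_ball: "finite ((lpoles \<union> rpoles) \<inter> ball 0 B)"
proof (rule finite_subset)
  let ?N = "{n. real n \<le> \<bar>B\<bar>}"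
  let ?S = "(\<lambda>n. of_real (- (1 + real n))) ` ?N \<union> (\<lambda>n. of_real (- (\<alpha> * (1 + real n)))) ` ?N
              \<union> (\<lambda>n. of_real (\<alpha> * real n)) ` ?N :: complex set"
  have le: "real n \<le> \<alpha> * real n" "1 + real n \<le> \<alpha> * (1 + real n)" for n
    using \<alpha> mult_right_mono[of 1 \<alpha> "real n"] by auto
  show "(lpoles \<union> rpoles) \<inter> ball 0 B \<subseteq> ?S"
  proof
    fix p assume p: "p \<in> (lpoles \<union> rpoles) \<inter> ball 0 B"
    then have "norm p \<le> \<bar>B\<bar>"
      by auto
    consider n where "p = of_real (- (1 + real n))" | n where "p = of_real (- (\<alpha> * (1 + real n)))"
      | n where "p = of_real (\<alpha> * real n)"
      using p by (auto simp: lpoles_eq rpoles_eq)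
    then show "p \<in> ?S"
    proof cases
      case (1 n)
      then have "real n \<le> \<bar>B\<bar>"
        using \<open>norm p \<le> \<bar>B\<bar>\<close> by (simp only: norm_of_real)
      then show ?thesis
        using 1 by blast
    next
      case (2 n)
      then have "real n \<le> \<bar>B\<bar>"
        using \<open>norm p \<le> \<bar>B\<bar>\<close> le[of n] by (simp only: norm_of_real)
      then show ?thesis
        using 2 by blast
    next
      case (3 n)
      then have "real n \<le> \<bar>B\<bar>"
        using \<open>norm p \<le> \<bar>B\<bar>\<close> le[of n] by (simp only: norm_of_real)
      then show ?thesis
        using 3 by blast
    qed
  qed
  have "?N \<subseteq> {..nat \<lceil>\<bar>B\<bar>\<rceil>}"
    by (auto simp: le_nat_iff) linarith
  then have "finite ?N"
    by (rule finite_subset) auto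
  then show "finite ?S"
    by auto
qed

lemma theta_holomorphic: "theta holomorphic_on - (lpoles \<union> rpoles)"
proof -
  have ex: "(\<exists>j<2. P j) \<longleftrightarrow> P 0 \<or> P (1::nat)" "(\<exists>j<1. P j) \<longleftrightarrow> P (0::nat)" for P
    by (auto simp: less_2_cases_iff)
  have "1 + \<xi> \<notin> \<int>\<^sub>\<le>\<^sub>0" "1 + \<xi> / of_real \<alpha> \<notin> \<int>\<^sub>\<le>\<^sub>0" "- (\<xi> / of_real \<alpha>) \<notin> \<int>\<^sub>\<le>\<^sub>0"
    if "\<xi> \<in> - (lpoles \<union> rpoles)" for \<xi>
    using that unfolding lpoles_def left_poles_def lower_params_def rpoles_def right_poles_def upper_params_def ex
    by auto
  then show ?thesis
    unfolding theta_eq[abs_def] using \<alpha>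
    by (intro holomorphic_intros) auto
qed

lemma theta_line_integrable:
  assumes "of_real a \<notin> lpoles \<union> rpoles"
  shows "(\<lambda>y. theta (Complex a y)) absolutely_integrable_on UNIV"
proof -
  obtain C where C: "\<And>\<xi>. Re \<xi> = a \<Longrightarrow> 1 \<le> \<bar>Im \<xi>\<bar> \<Longrightarrow> norm (theta \<xi>) \<le> C * exp (- (pi / (4 * \<alpha>)) * \<bar>Im \<xi>\<bar>)"
    using theta_vertical_strip_bound[of a a] by auto
  have "Complex a y \<in> - (lpoles \<union> rpoles)" for y
    using assms poles_real by (cases "y = 0") (auto simp: complex_is_Real_iff complex_of_real_def subset_iff)
  then have "continuous_on UNIV (\<lambda>y. theta (Complex a y))"
    by (intro continuous_on_compose2[OF holomorphic_on_imp_continuous_on[OF theta_holomorphic]])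
       (auto simp: Complex_eq intro!: continuous_intros)
  then show ?thesis
    by (rule absolutely_integrable_exp_decay[where c = "pi / (4 * \<alpha>)" and C = C])
       (use C[of "Complex a _"] \<alpha> in auto)
qed

end

section \<open>Independence of the contour\<close>

locale fox_integrand_setting = fox_setting +
  fixes z :: real
  assumes z: "0 < z" "z < 1"
begin

definition F :: "complex \<Rightarrow> complex" where
  "F \<xi> = theta \<xi> * of_real z powr (- \<xi>)"

lemma norm_F: "norm (F \<xi>) = norm (theta \<xi>) * z powr (- Re \<xi>)"
  using z by (simp add: F_def norm_mult norm_powr_real_powr)

lemma F_holomorphic: "F holomorphic_on - (lpoles \<union> rpoles)"
  unfolding F_def[abs_def] using z
  by (intro holomorphic_intros theta_holomorphic) auto

lemma F_continuous: "A \<inter> (lpoles \<union> rpoles) = {} \<Longrightarrow> continuous_on A F"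
  using holomorphic_on_imp_continuous_on[OF F_holomorphic] by (auto elim: continuous_on_subset)

text \<open>The modulus of z powr (- xi) is constant on a vertical line. For a = -\<rho> this
  produces the error term z powr \<rho> with a factor independent of z.\<close>

lemma F_line_integrable:
  assumes "of_real a \<notin> lpoles \<union> rpoles"
  shows "(\<lambda>y. F (Complex a y)) absolutely_integrable_on UNIV"
    and "norm (integral UNIV (\<lambda>y. F (Complex a y)))
           \<le> z powr (- a) * integral UNIV (\<lambda>y. norm (theta (Complex a y)))"
proof -
  have int: "(\<lambda>y. norm (theta (Complex a y))) integrable_on UNIV"
    using theta_line_integrable[OF assms] by (simp add: absolutely_integrable_on_def)
  then have int': "(\<lambda>y. z powr (- a) * norm (theta (Complex a y))) integrable_on UNIV"
    by (intro integrable_on_mult_right)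
  have "Complex a y \<in> - (lpoles \<union> rpoles)" for y
    using assms poles_real by (cases "y = 0") (auto simp: complex_is_Real_iff complex_of_real_def subset_iff)
  then have cont: "continuous_on UNIV (\<lambda>y. F (Complex a y))"
    by (intro continuous_on_compose2[OF holomorphic_on_imp_continuous_on[OF F_holomorphic]])
       (auto simp: Complex_eq intro!: continuous_intros)
  show *: "(\<lambda>y. F (Complex a y)) absolutely_integrable_on UNIV"
    by (rule measurable_bounded_by_integrable_imp_absolutely_integrable[OF _ _ int'])
       (use cont in \<open>auto simp: norm_F intro: continuous_imp_measurable_on_sets_lebesgue\<close>)
  have "norm (integral UNIV (\<lambda>y. F (Complex a y))) \<le> integral UNIV (\<lambda>y. z powr (- a) * norm (theta (Complex a y)))"
    using * int' by (intro integral_norm_bound_integral) (auto simp: norm_F absolutely_integrable_on_def)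
  then show "norm (integral UNIV (\<lambda>y. F (Complex a y)))
           \<le> z powr (- a) * integral UNIV (\<lambda>y. norm (theta (Complex a y)))"
    by simp
qed

text \<open>
  The end of a contour is joined to the line \<open>Re \<xi> = -\<rho>\<close> by a vertical and a horizontal segment.
  The sign \<open>\<sigma> = \<plusminus>1\<close> tells whether this happens in the upper or in the lower half-plane.
\<close>

definition closes :: "real \<Rightarrow> (nat \<Rightarrow> complex) \<Rightarrow> real \<Rightarrow> bool" where
  "closes \<sigma> u \<rho> \<longleftrightarrow> (\<exists>Y.
     (\<forall>\<^sub>F n in sequentially. 0 < \<sigma> * Im (u n) \<and> \<sigma> * Im (u n) \<le> Y n) \<and>
     filterlim Y at_top sequentially \<and>
     (\<lambda>n. contour_integral (linepath (u n) (Complex (Re (u n)) (\<sigma> * Y n))) F) \<longlonglongrightarrow> 0 \<and>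
     (\<lambda>n. contour_integral (linepath (Complex (Re (u n)) (\<sigma> * Y n)) (Complex (- \<rho>) (\<sigma> * Y n))) F)
       \<longlonglongrightarrow> 0)"

lemma F_integrable_segment:
  assumes "closed_segment a b \<inter> \<real> = {}"
  shows "F contour_integrable_on linepath a b"
  using assms poles_real by (intro contour_integrable_continuous_linepath F_continuous) blast

lemma horizontal_segment_nonreal:
  "y \<noteq> 0 \<Longrightarrow> closed_segment (Complex a y) (Complex b y) \<inter> \<real> = {}"
  by (auto simp: closed_segment_same_Im complex_is_Real_iff)

text \<open>The horizontal segment has bounded length and lies in a fixed strip, where theta decays
  exponentially with the height.\<close>

lemma closes_line:
  assumes \<sigma>: "\<sigma> = 1 \<or> \<sigma> = - 1"
    and Re: "(\<lambda>n. Re (u n)) \<longlonglongrightarrow> \<gamma>" and Im: "filterlim (\<lambda>n. \<sigma> * Im (u n)) at_top sequentially"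
  shows "closes \<sigma> u \<rho>"
proof -
  \<comment> \<open>With this height the vertical segment degenerates to a point and its integral is
    0.\<close>
  define Y where "Y n = \<sigma> * Im (u n)" for n
  define b where "b = max (\<gamma> + 1) (- \<rho>)"
  obtain C where C: "C > 0" "\<And>\<xi>. min (\<gamma> - 1) (- \<rho>) \<le> Re \<xi> \<Longrightarrow> Re \<xi> \<le> b \<Longrightarrow> 1 \<le> \<bar>Im \<xi>\<bar> \<Longrightarrow>
      norm (theta \<xi>) \<le> C * exp (- (pi / (4 * \<alpha>)) * \<bar>Im \<xi>\<bar>)"
    using theta_vertical_strip_bound[of "min (\<gamma> - 1) (- \<rho>)" b] by blast
  define c where "c = pi / (4 * \<alpha>)"
  have "c > 0"
    using \<alpha> by (simp add: c_def)
  have eq: "Complex (Re (u n)) (\<sigma> * Y n) = u n" for n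
    using \<sigma> by (auto simp: Y_def)
  have Y_gt: "\<forall>\<^sub>F n in sequentially. 1 \<le> Y n"
    using Im by (simp add: filterlim_at_top Y_def)
  have "(\<lambda>n. contour_integral (linepath (Complex (Re (u n)) (\<sigma> * Y n)) (Complex (- \<rho>) (\<sigma> * Y n))) F) \<longlonglongrightarrow> 0"
  proof (rule Lim_null_comparison)
    let ?M = "\<bar>\<gamma>\<bar> + 1 + \<bar>\<rho>\<bar>"
    have "\<forall>\<^sub>F n in sequentially. \<bar>Re (u n) - \<gamma>\<bar> < 1"
      using tendstoD[OF Re, of 1] by (simp add: dist_real_def)
    with Y_gt show "\<forall>\<^sub>F n in sequentially.
        norm (contour_integral (linepath (Complex (Re (u n)) (\<sigma> * Y n)) (Complex (- \<rho>) (\<sigma> * Y n))) F)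
          \<le> C * exp (- c * Y n) * z powr (- b) * ?M"
    proof eventually_elim
      case (elim n)
      have "norm (contour_integral (linepath (Complex (Re (u n)) (\<sigma> * Y n)) (Complex (- \<rho>) (\<sigma> * Y n))) F)
          \<le> C * exp (- c * Y n) * z powr (- b) * norm (Complex (- \<rho>) (\<sigma> * Y n) - Complex (Re (u n)) (\<sigma> * Y n))"
      proof (rule contour_integral_bound_linepath)
        show "F contour_integrable_on linepath (Complex (Re (u n)) (\<sigma> * Y n)) (Complex (- \<rho>) (\<sigma> * Y n))"
          using elim \<sigma> by (intro F_integrable_segment horizontal_segment_nonreal) auto
      next
        fix \<xi> assume "\<xi> \<in> closed_segment (Complex (Re (u n)) (\<sigma> * Y n)) (Complex (- \<rho>) (\<sigma> * Y n))"
        then have \<xi>: "\<bar>Im \<xi>\<bar> = Y n" "min (\<gamma> - 1) (- \<rho>) \<le> Re \<xi>" "Re \<xi> \<le> b"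
          using elim \<sigma> by (auto simp: closed_segment_same_Im closed_segment_eq_real_ivl b_def split: if_splits)
        then have "norm (theta \<xi>) \<le> C * exp (- c * Y n)"
          using C(2)[of \<xi>] elim by (simp add: c_def)
        moreover have "z powr (- Re \<xi>) \<le> z powr (- b)"
          using z \<xi> by (intro powr_mono') auto
        ultimately show "norm (F \<xi>) \<le> C * exp (- c * Y n) * z powr (- b)"
          using C(1) by (simp add: norm_F mult_mono)
      qed (use C(1) in auto)
      also have "norm (Complex (- \<rho>) (\<sigma> * Y n) - Complex (Re (u n)) (\<sigma> * Y n)) = \<bar>- \<rho> - Re (u n)\<bar>"
        by (simp add: complex_diff cmod_def)
      also have "C * exp (- c * Y n) * z powr (- b) * \<bar>- \<rho> - Re (u n)\<bar> \<le> C * exp (- c * Y n) * z powr (- b) * ?M"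
        using elim C(1) by (intro mult_left_mono) auto
      finally show ?case .
    qed
    have "filterlim (\<lambda>n. c * Y n) at_top sequentially"
      unfolding Y_def by (rule filterlim_tendsto_pos_mult_at_top[OF tendsto_const \<open>c > 0\<close> Im])
    then have "(\<lambda>n. exp (- c * Y n)) \<longlonglongrightarrow> 0"
      by (intro filterlim_compose[OF exp_at_bot]) (simp add: filterlim_uminus_at_bot)
    then have "(\<lambda>n. C * exp (- c * Y n) * z powr (- b) * ?M) \<longlonglongrightarrow> C * 0 * z powr (- b) * ?M"
      by (intro tendsto_intros)
    then show "(\<lambda>n. C * exp (- c * Y n) * z powr (- b) * ?M) \<longlonglongrightarrow> 0"
      by simp
  qed
  moreover have "\<forall>\<^sub>F n in sequentially. 0 < \<sigma> * Im (u n) \<and> \<sigma> * Im (u n) \<le> Y n"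
    using Y_gt by eventually_elim (auto simp: Y_def)
  ultimately show ?thesis
    using Im unfolding closes_def by (intro exI[of _ Y]) (simp add: eq Y_def[symmetric])
qed

lemma square_times_powr_null: "((\<lambda>x. x\<^sup>2 * z powr x) \<longlongrightarrow> 0) at_top"
proof -
  define c where "c = - ln z"
  have "c > 0"
    using z by (simp add: c_def)
  have "((\<lambda>x. (c * x)\<^sup>2 / exp (c * x)) \<longlongrightarrow> 0) at_top"
    by (rule filterlim_compose[OF tendsto_power_div_exp_0])
       (intro filterlim_tendsto_pos_mult_at_top[OF tendsto_const] \<open>c > 0\<close> filterlim_ident)
  then have "((\<lambda>x. inverse (c\<^sup>2) * ((c * x)\<^sup>2 / exp (c * x))) \<longlongrightarrow> inverse (c\<^sup>2) * 0) at_top"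
    by (intro tendsto_intros)
  moreover have "inverse (c\<^sup>2) * ((c * x)\<^sup>2 / exp (c * x)) = x\<^sup>2 * z powr x" for x
    using \<open>c > 0\<close> z by (simp add: powr_def c_def power_mult_distrib exp_minus field_simps)
  ultimately show ?thesis
    by simp
qed

text \<open>The threshold for \<rho> puts both joining segments into the region of
  \<open>theta_far_left_bound\<close>; it depends on \<phi> but not on the particular end u.\<close>

lemma closes_loop:
  assumes \<phi>: "\<phi> > 0"
  shows "\<exists>\<rho>\<^sub>0. \<forall>\<rho>\<ge>\<rho>\<^sub>0. \<forall>\<sigma> u. (\<sigma> = 1 \<or> \<sigma> = - 1) \<longrightarrow> filterlim (\<lambda>n. Re (u n)) at_bot sequentially \<longrightarrow>
           (\<forall>\<^sub>F n in sequentially. Im (u n) = \<sigma> * \<phi>) \<longrightarrow> closes \<sigma> u \<rho>"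
proof -
  obtain r C where r: "r > 0" and C: "C > 0"
    "\<And>\<xi>. Re \<xi> \<le> - r \<Longrightarrow> \<phi> \<le> \<bar>Im \<xi>\<bar> \<Longrightarrow> norm (theta \<xi>) \<le> C / \<bar>Im \<xi>\<bar>"
    using theta_far_left_bound[OF \<phi>] by blast
  have "closes \<sigma> u \<rho>"
    if \<rho>: "\<rho> \<ge> r" and \<sigma>: "\<sigma> = 1 \<or> \<sigma> = - 1" and Re: "filterlim (\<lambda>n. Re (u n)) at_bot sequentially"
      and Im: "\<forall>\<^sub>F n in sequentially. Im (u n) = \<sigma> * \<phi>" for \<rho> \<sigma> u
  proof -
    define x where "x n = - Re (u n)" for n
    have x_lim: "filterlim x at_top sequentially"
      using Re by (simp add: x_def[abs_def] filterlim_uminus_at_top)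
    \<comment> \<open>The height has to grow faster than x, since the horizontal segment contributes
      at most (C / Y) x, but so slowly that the vertical segment, contributing at most (C / \<phi>)
      z powr x times Y, still vanishes. The square does both.\<close>
    define Y where "Y n = (x n)\<^sup>2" for n
    have Y_lim: "filterlim Y at_top sequentially"
      unfolding Y_def[abs_def] by (intro filterlim_pow_at_top x_lim) auto
    have large: "\<forall>\<^sub>F n in sequentially. Im (u n) = \<sigma> * \<phi> \<and> \<rho> \<le> x n \<and> \<phi> \<le> Y n"
      using Im x_lim Y_lim by (simp add: filterlim_at_top eventually_conj_iff)
    have sgn: "\<sigma> * (\<sigma> * t) = t" "\<bar>\<sigma> * t\<bar> = \<bar>t\<bar>" for t
      using \<sigma> by auto
    have "\<forall>\<^sub>F n in sequentially. 0 < \<sigma> * Im (u n) \<and> \<sigma> * Im (u n) \<le> Y n"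
      using large by eventually_elim (simp add: sgn \<phi>)
    moreover have "(\<lambda>n. contour_integral (linepath (u n) (Complex (Re (u n)) (\<sigma> * Y n))) F) \<longlonglongrightarrow> 0"
    proof (rule Lim_null_comparison)
      show "\<forall>\<^sub>F n in sequentially. norm (contour_integral (linepath (u n) (Complex (Re (u n)) (\<sigma> * Y n))) F)
              \<le> C / \<phi> * ((x n)\<^sup>2 * z powr (x n))"
        using large
      proof eventually_elim
        case (elim n)
        have seg: "Re \<xi> = - x n \<and> \<phi> \<le> \<bar>Im \<xi>\<bar>" if "\<xi> \<in> closed_segment (u n) (Complex (Re (u n)) (\<sigma> * Y n))" for \<xi>
          using that elim \<sigma> \<phi>
          by (auto simp: closed_segment_same_Re closed_segment_eq_real_ivl x_def split: if_splits)
        have "norm (contour_integral (linepath (u n) (Complex (Re (u n)) (\<sigma> * Y n))) F)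
                \<le> C / \<phi> * z powr (x n) * norm (Complex (Re (u n)) (\<sigma> * Y n) - u n)"
        proof (rule contour_integral_bound_linepath)
          show "F contour_integrable_on linepath (u n) (Complex (Re (u n)) (\<sigma> * Y n))"
            using seg \<phi> by (intro F_integrable_segment) (fastforce simp: complex_is_Real_iff)
        next
          fix \<xi> assume "\<xi> \<in> closed_segment (u n) (Complex (Re (u n)) (\<sigma> * Y n))"
          then have \<xi>: "Re \<xi> = - x n" "\<phi> \<le> \<bar>Im \<xi>\<bar>"
            using seg by auto
          have "norm (theta \<xi>) \<le> C / \<bar>Im \<xi>\<bar>"
            using C(2)[of \<xi>] \<xi> elim \<rho> by simp
          also have "\<dots> \<le> C / \<phi>"
            using \<xi> \<phi> C(1) by (intro divide_left_mono) auto
          finally have "norm (theta \<xi>) * z powr (x n) \<le> C / \<phi> * z powr (x n)"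
            by (intro mult_right_mono) auto
          then show "norm (F \<xi>) \<le> C / \<phi> * z powr (x n)"
            using \<xi> by (simp add: norm_F)
        qed (use C(1) \<phi> in auto)
        also have "norm (Complex (Re (u n)) (\<sigma> * Y n) - u n) = \<bar>\<sigma> * (Y n - \<phi>)\<bar>"
          using elim by (simp add: cmod_def algebra_simps)
        also have "C / \<phi> * z powr (x n) * \<bar>\<sigma> * (Y n - \<phi>)\<bar> \<le> C / \<phi> * z powr (x n) * Y n"
          unfolding sgn using elim \<phi> C(1) by (intro mult_left_mono) auto
        finally show ?case
          by (simp add: Y_def mult_ac)
      qed
      have "(\<lambda>n. (x n)\<^sup>2 * z powr (x n)) \<longlonglongrightarrow> 0"
        by (rule filterlim_compose[OF square_times_powr_null x_lim])
      then have "(\<lambda>n. C / \<phi> * ((x n)\<^sup>2 * z powr (x n))) \<longlonglongrightarrow> C / \<phi> * 0"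
        by (intro tendsto_mult tendsto_const)
      then show "(\<lambda>n. C / \<phi> * ((x n)\<^sup>2 * z powr (x n))) \<longlonglongrightarrow> 0"
        by simp
    qed
    moreover have "(\<lambda>n. contour_integral (linepath (Complex (Re (u n)) (\<sigma> * Y n)) (Complex (- \<rho>) (\<sigma> * Y n))) F) \<longlonglongrightarrow> 0"
    proof (rule Lim_null_comparison)
      show "\<forall>\<^sub>F n in sequentially.
          norm (contour_integral (linepath (Complex (Re (u n)) (\<sigma> * Y n)) (Complex (- \<rho>) (\<sigma> * Y n))) F)
            \<le> C * inverse (x n)"
        using large
      proof eventually_elim
        case (elim n)
        have "x n > 0"
          using elim \<rho> r by linarith
        have "norm (contour_integral (linepath (Complex (Re (u n)) (\<sigma> * Y n)) (Complex (- \<rho>) (\<sigma> * Y n))) F)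
                \<le> C / Y n * norm (Complex (- \<rho>) (\<sigma> * Y n) - Complex (Re (u n)) (\<sigma> * Y n))"
        proof (rule contour_integral_bound_linepath)
          show "F contour_integrable_on linepath (Complex (Re (u n)) (\<sigma> * Y n)) (Complex (- \<rho>) (\<sigma> * Y n))"
            using elim \<sigma> \<phi> by (intro F_integrable_segment horizontal_segment_nonreal) auto
        next
          fix \<xi> assume "\<xi> \<in> closed_segment (Complex (Re (u n)) (\<sigma> * Y n)) (Complex (- \<rho>) (\<sigma> * Y n))"
          then have \<xi>: "\<bar>Im \<xi>\<bar> = Y n" "Re \<xi> \<le> - \<rho>"
            using elim \<phi> by (auto simp: closed_segment_same_Im closed_segment_eq_real_ivl x_def sgn split: if_splits)
          then have "norm (theta \<xi>) \<le> C / Y n"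
            using C(2)[of \<xi>] elim \<rho> by simp
          moreover have "z powr (- Re \<xi>) \<le> 1"
            using z \<xi> \<rho> r by (simp add: powr_le1)
          ultimately have "norm (theta \<xi>) * z powr (- Re \<xi>) \<le> C / Y n * 1"
            using C(1) elim \<phi> by (intro mult_mono) auto
          then show "norm (F \<xi>) \<le> C / Y n"
            by (simp add: norm_F)
        qed (use C(1) elim \<phi> in auto)
        also have "norm (Complex (- \<rho>) (\<sigma> * Y n) - Complex (Re (u n)) (\<sigma> * Y n)) = \<bar>x n - \<rho>\<bar>"
          by (simp add: complex_diff cmod_def x_def)
        also have "C / Y n * \<bar>x n - \<rho>\<bar> \<le> C / Y n * x n"
          using C(1) elim \<phi> \<rho> r by (intro mult_left_mono) auto
        also have "\<dots> = C * inverse (x n)"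
          using \<open>x n > 0\<close> by (simp add: Y_def power2_eq_square field_simps)
        finally show ?case .
      qed
      have "(\<lambda>n. C * inverse (x n)) \<longlonglongrightarrow> C * 0"
        by (intro tendsto_mult tendsto_const tendsto_inverse_0_at_top x_lim)
      then show "(\<lambda>n. C * inverse (x n)) \<longlonglongrightarrow> 0"
        by simp
    qed
    ultimately show ?thesis
      using Y_lim unfolding closes_def by blast
  qed
  then show ?thesis
    by blast
qed

end

section \<open>Value along vertical contours, and the position of the ends of left loops\<close>

context fox_integrand_setting
begin

abbreviation integrand :: "(real \<Rightarrow> complex) \<Rightarrow> real \<Rightarrow> complex" where
  "integrand g \<equiv> fox_integrand 2 1 upper_params lower_params (of_real z) g"

lemma integrand_eq: "integrand g = (\<lambda>s. F (g s) * vector_derivative g (at s))"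
  by (simp add: fun_eq_iff fox_integrand_def F_def theta_def)

definition shifted_value :: "real \<Rightarrow> complex" where
  "shifted_value \<rho> = 2 * pi * \<i> * (\<Sum>p\<in>{p\<in>lpoles. - \<rho> < Re p}. residue F p) +
     \<i> * integral UNIV (\<lambda>y. F (Complex (- \<rho>) y))"

text \<open>The connected sets remain parameters because they are used in two ways: a general
  contour supplies sets of uncontrolled size and thus only large \<rho>, whereas the line Re = -1/2
  admits single points and r = 1.\<close>

lemma contour_value_of_barriers:
  assumes g: "\<And>a b. g piecewise_C1_differentiable_on {a..b}"
    and int: "integrand g integrable_on UNIV"
    and K: "connected K" "of_real q\<^sub>0 \<in> K" "lpoles \<subseteq> K \<union> of_real ` {..q\<^sub>0}"
    and K': "connected K'" "of_real q\<^sub>1 \<in> K'" "rpoles \<subseteq> K' \<union> of_real ` {q\<^sub>1..}"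
    and KK': "K \<union> K' \<subseteq> ball 0 r" and \<rho>: "r \<le> \<rho>" "0 < \<rho>" "of_real (- \<rho>) \<notin> lpoles"
    and disj: "range g \<inter> (K \<union> K' \<union> of_real ` {..q\<^sub>0} \<union> of_real ` {q\<^sub>1..}) = {}"
    and lim: "filterlim (\<lambda>s. norm (g s)) at_top at_bot" "filterlim (\<lambda>s. norm (g s)) at_top at_top"
    and closes: "closes 1 (\<lambda>n. g (real n)) \<rho>" "closes (- 1) (\<lambda>n. g (- real n)) \<rho>"
  shows "integral UNIV (integrand g) = shifted_value \<rho>"
proof -
  obtain Y where Y: "\<forall>\<^sub>F n in sequentially. 0 < 1 * Im (g (real n)) \<and> 1 * Im (g (real n)) \<le> Y n"
    "filterlim Y at_top sequentially"
    "(\<lambda>n. contour_integral (linepath (g (real n)) (Complex (Re (g (real n))) (1 * Y n))) F) \<longlonglongrightarrow> 0"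
    "(\<lambda>n. contour_integral (linepath (Complex (Re (g (real n))) (1 * Y n)) (Complex (- \<rho>) (1 * Y n))) F) \<longlonglongrightarrow> 0"
    using closes(1) unfolding closes_def by blast
  obtain Y' where Y': "\<forall>\<^sub>F n in sequentially. 0 < - 1 * Im (g (- real n)) \<and> - 1 * Im (g (- real n)) \<le> Y' n"
    "filterlim Y' at_top sequentially"
    "(\<lambda>n. contour_integral (linepath (g (- real n)) (Complex (Re (g (- real n))) (- 1 * Y' n))) F) \<longlonglongrightarrow> 0"
    "(\<lambda>n. contour_integral (linepath (Complex (Re (g (- real n))) (- 1 * Y' n)) (Complex (- \<rho>) (- 1 * Y' n))) F) \<longlonglongrightarrow> 0"
    using closes(2) unfolding closes_def by blast
  have "filterlim (\<lambda>n. norm (g (real n))) at_top sequentially"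
    by (rule filterlim_compose[OF lim(2) filterlim_real_sequentially])
  then have norm: "\<forall>\<^sub>F n in sequentially. r \<le> norm (g (real n))"
    by (simp add: filterlim_at_top)
  have "filterlim (\<lambda>n. - real n) at_bot sequentially"
    by (simp add: filterlim_uminus_at_bot filterlim_real_sequentially)
  from filterlim_compose[OF lim(1) this] have norm': "\<forall>\<^sub>F n in sequentially. r \<le> norm (g (- real n))"
    by (simp add: filterlim_at_top)
  have nonpole: "of_real (- \<rho>) \<notin> lpoles \<union> rpoles"
    using \<rho> rpoles_ge[of "of_real (- \<rho>)"] by auto
  show ?thesis
    unfolding integrand_eq shifted_value_def
  proof (rule contour_integral_eq_shifted_line[OF F_holomorphic poles_real finite_poles_ball K K' KK' \<rho>(1)
        nonpole g disj])
    show "(\<lambda>s. F (g s) * vector_derivative g (at s)) integrable_on UNIV"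
      using int unfolding integrand_eq .
    show "(\<lambda>y. F (Complex (- \<rho>) y)) integrable_on UNIV"
      using F_line_integrable(1)[OF nonpole] by (simp add: absolutely_integrable_on_def)
    show "\<forall>\<^sub>F n in sequentially. 0 < Im (g (real n)) \<and> Im (g (real n)) \<le> Y n \<and> r \<le> norm (g (real n))"
      using Y(1) norm by eventually_elim auto
    show "\<forall>\<^sub>F n in sequentially. Im (g (- real n)) < 0 \<and> - Y' n \<le> Im (g (- real n)) \<and> r \<le> norm (g (- real n))"
      using Y'(1) norm' by eventually_elim auto
    show "filterlim (\<lambda>n. - Y' n) at_bot sequentially"
      using Y'(2) by (simp add: filterlim_uminus_at_bot)
  qed (use Y Y' in auto)
qed

lemma contour_sides_continuous:
  assumes "contour_sides g U V"
  shows "continuous_on UNIV g"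
proof (rule continuous_at_imp_continuous_on, rule ballI)
  fix x
  have "continuous_on {x - 1..x + 1} g"
    using assms by (simp add: contour_sides_def piecewise_C1_differentiable_on_def)
  then show "isCont g x"
    by (rule continuous_on_interior) (simp add: interior_atLeastAtMost_real)
qed

text \<open>On each side a real ray lies in the correct component and picks up all but finitely many
  poles. The others are joined to the start of the ray inside that component, and the size of the
  resulting compact sets determines how large \<rho> must be.\<close>

lemma contour_value:
  assumes sides: "contour_sides g U V" and poles: "lpoles \<subseteq> U" "rpoles \<subseteq> V"
    and int: "integrand g absolutely_integrable_on UNIV"
    and left: "\<forall>\<^sub>F x in at_bot. Complex x 0 \<in> U" and right: "\<forall>\<^sub>F x in at_top. Complex x 0 \<in> V"
    and lim: "filterlim (\<lambda>s. norm (g s)) at_top at_bot" "filterlim (\<lambda>s. norm (g s)) at_top at_top"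
    and closes: "\<forall>\<rho>\<ge>\<rho>\<^sub>0. closes 1 (\<lambda>n. g (real n)) \<rho> \<and> closes (- 1) (\<lambda>n. g (- real n)) \<rho>"
  shows "\<exists>r. \<forall>\<rho>\<ge>r. of_real (- \<rho>) \<notin> lpoles \<longrightarrow> integral UNIV (integrand g) = shifted_value \<rho>"
proof -
  have g: "g piecewise_C1_differentiable_on {a..b}" for a b
    using sides by (simp add: contour_sides_def)
  have "open (- range g)"
    using closed_range_proper[OF contour_sides_continuous[OF sides] lim] by (simp add: open_Compl)
  have UV: "open U" "connected U" "U \<subseteq> - range g" "open V" "connected V" "V \<subseteq> - range g"
    using sides open_components[OF \<open>open (- range g)\<close>] in_components_connected in_components_subset
    unfolding contour_sides_def by blast+
  obtain q\<^sub>0 where q0: "\<And>x. x \<le> q\<^sub>0 \<Longrightarrow> Complex x 0 \<in> U"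
    using left by (auto simp: eventually_at_bot_linorder)
  obtain q\<^sub>1 where q1: "\<And>x. x \<ge> q\<^sub>1 \<Longrightarrow> Complex x 0 \<in> V"
    using right by (auto simp: eventually_at_top_linorder)
  have q0': "of_real x \<in> U" if "x \<le> q\<^sub>0" for x
    using q0[OF that] by (simp add: complex_of_real_def)
  have q1': "of_real x \<in> V" if "x \<ge> q\<^sub>1" for x
    using q1[OF that] by (simp add: complex_of_real_def)
  \<comment> \<open>The poles not reached by the left ray; they are bounded because left poles
    satisfy Re p <= -1.\<close>
  define A where "A = {p \<in> lpoles. q\<^sub>0 < Re p}"
  define A' where "A' = {p \<in> rpoles. Re p < q\<^sub>1}"
  have real_norm: "norm p = \<bar>Re p\<bar>" "p = of_real (Re p)" if "p \<in> lpoles \<union> rpoles" for p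
    using that poles_real by (auto simp: complex_is_Real_iff cmod_def complex_eq_iff subset_iff)
  have "finite A"
  proof (rule finite_subset[OF _ finite_poles_ball])
    show "A \<subseteq> (lpoles \<union> rpoles) \<inter> ball 0 (\<bar>q\<^sub>0\<bar> + 1)"
      using lpoles_le real_norm by (fastforce simp: A_def)
  qed
  have "finite A'"
  proof (rule finite_subset[OF _ finite_poles_ball])
    show "A' \<subseteq> (lpoles \<union> rpoles) \<inter> ball 0 (\<bar>q\<^sub>1\<bar> + 1)"
      using rpoles_ge real_norm by (fastforce simp: A'_def)
  qed
  obtain K where K: "compact K" "connected K" "of_real q\<^sub>0 \<in> K" "A \<subseteq> K" "K \<subseteq> U"
    using compact_connected_superset[OF UV(1,2) \<open>finite A\<close>, of "of_real q\<^sub>0"] poles q0' by (auto simp: A_def)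
  obtain K' where K': "compact K'" "connected K'" "of_real q\<^sub>1 \<in> K'" "A' \<subseteq> K'" "K' \<subseteq> V"
    using compact_connected_superset[OF UV(4,5) \<open>finite A'\<close>, of "of_real q\<^sub>1"] poles q1' by (auto simp: A'_def)
  have "bounded (K \<union> K')"
    using K K' by (simp add: compact_imp_bounded)
  then obtain r where r: "r > 0" "K \<union> K' \<subseteq> ball 0 r"
    using bounded_subset_ballD[of "K \<union> K'" 0] by auto
  have "integral UNIV (integrand g) = shifted_value \<rho>"
    if \<rho>: "\<rho> \<ge> max r \<rho>\<^sub>0" "of_real (- \<rho>) \<notin> lpoles" for \<rho>
  proof (rule contour_value_of_barriers[OF g])
    show "integrand g integrable_on UNIV"
      using int by (simp add: absolutely_integrable_on_def)
    have "p \<in> K \<union> of_real ` {..q\<^sub>0}" if "p \<in> lpoles" for p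
      using that K(4) real_norm[of p] by (cases "q\<^sub>0 < Re p") (auto simp: A_def image_iff not_less)
    then show "lpoles \<subseteq> K \<union> of_real ` {..q\<^sub>0}"
      by blast
    have "p \<in> K' \<union> of_real ` {q\<^sub>1..}" if "p \<in> rpoles" for p
      using that K'(4) real_norm[of p] by (cases "Re p < q\<^sub>1") (auto simp: A'_def image_iff not_less)
    then show "rpoles \<subseteq> K' \<union> of_real ` {q\<^sub>1..}"
      by blast
    have "of_real ` {..q\<^sub>0} \<subseteq> U" "of_real ` {q\<^sub>1..} \<subseteq> V"
      using q0' q1' by auto
    then show "range g \<inter> (K \<union> K' \<union> of_real ` {..q\<^sub>0} \<union> of_real ` {q\<^sub>1..}) = {}"
      using K(5) K'(5) UV(3,6) by blast
    show "closes 1 (\<lambda>n. g (real n)) \<rho>" "closes (- 1) (\<lambda>n. g (- real n)) \<rho>"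
      using closes \<rho> by auto
  qed (use \<rho> r K K' lim in auto)
  then show ?thesis
    by blast
qed

lemma filterlim_norm_of_Re:
  "filterlim (\<lambda>s. Re (g s)) at_bot G \<Longrightarrow> filterlim (\<lambda>s. norm (g s)) at_top G"
proof (rule filterlim_at_top_mono)
  assume "filterlim (\<lambda>s. Re (g s)) at_bot G"
  then show "filterlim (\<lambda>s. - Re (g s)) at_top G"
    by (simp add: filterlim_uminus_at_top)
  show "\<forall>\<^sub>F s in G. - Re (g s) \<le> norm (g s)"
    using abs_Re_le_cmod by (intro always_eventually allI) (metis abs_ge_minus_self order_trans)
qed

lemma contour_value_line:
  assumes line: "line_imag_inf g U V" and poles: "lpoles \<subseteq> U" "rpoles \<subseteq> V"
    and int: "integrand g absolutely_integrable_on UNIV"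
  shows "\<exists>r. \<forall>\<rho>\<ge>r. of_real (- \<rho>) \<notin> lpoles \<longrightarrow> integral UNIV (integrand g) = shifted_value \<rho>"
proof -
  obtain \<gamma> where sides: "contour_sides g U V"
    and bot: "((\<lambda>s. Re (g s)) \<longlongrightarrow> \<gamma>) at_bot" "filterlim (\<lambda>s. Im (g s)) at_bot at_bot"
    and top: "((\<lambda>s. Re (g s)) \<longlongrightarrow> \<gamma>) at_top" "filterlim (\<lambda>s. Im (g s)) at_top at_top"
    and UV: "\<forall>y. \<forall>\<^sub>F x in at_bot. Complex x y \<in> U" "\<forall>y. \<forall>\<^sub>F x in at_top. Complex x y \<in> V"
    using line unfolding line_imag_inf_def by blast
  have minus: "filterlim (\<lambda>n. - real n) at_bot sequentially"
    by (simp add: filterlim_uminus_at_bot filterlim_real_sequentially)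
  show ?thesis
  proof (rule contour_value[OF sides poles int])
    show "filterlim (\<lambda>s. norm (g s)) at_top at_top"
      using abs_Im_le_cmod
      by (intro filterlim_at_top_mono[OF top(2)] always_eventually allI) (metis abs_ge_self order_trans)
    show "filterlim (\<lambda>s. norm (g s)) at_top at_bot"
    proof (rule filterlim_at_top_mono)
      show "filterlim (\<lambda>s. - Im (g s)) at_top at_bot"
        using bot(2) by (simp add: filterlim_uminus_at_top)
      show "\<forall>\<^sub>F s in at_bot. - Im (g s) \<le> norm (g s)"
        using abs_Im_le_cmod by (intro always_eventually allI) (metis abs_ge_minus_self order_trans)
    qed
    have "closes 1 (\<lambda>n. g (real n)) \<rho>" for \<rho>
      using filterlim_compose[OF top(1) filterlim_real_sequentially]
        filterlim_compose[OF top(2) filterlim_real_sequentially]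
      by (intro closes_line) auto
    moreover have "closes (- 1) (\<lambda>n. g (- real n)) \<rho>" for \<rho>
      using filterlim_compose[OF bot(1) minus] filterlim_compose[OF bot(2) minus]
      by (intro closes_line) (auto simp: filterlim_uminus_at_top)
    ultimately show "\<forall>\<rho>\<ge>0. closes 1 (\<lambda>n. g (real n)) \<rho> \<and> closes (- 1) (\<lambda>n. g (- real n)) \<rho>"
      by blast
  qed (use UV in auto)
qed

lemma same_component:
  assumes "U \<in> components S" "V \<in> components S" "U \<noteq> V" "connected T" "T \<subseteq> S" "u \<in> T" "v \<in> T" "u \<in> U"
  shows "v \<notin> V"
proof -
  have "T \<subseteq> U"
    using assms by (intro components_maximal[of U S T]) auto
  moreover have "U \<inter> V = {}"
    using assms components_eq by blast
  ultimately show ?thesis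
    using assms by blast
qed

text \<open>
  If both ends of a loop were on the same side of the real axis, a far away left pole could be joined
  to the exterior of the loop on the other side of the axis.
\<close>

lemma loop_minus_inf_ends:
  assumes sides: "contour_sides g U V" and lp: "lpoles \<subseteq> U"
    and s: "s = 1 \<or> s = - 1"
    and tail: "\<forall>\<^sub>F t in at_bot. 0 < s * Im (g t)" "\<forall>\<^sub>F t in at_top. 0 < s * Im (g t)"
    and V: "\<forall>\<^sub>F x in at_top. Complex x 0 \<in> V"
  shows False
proof -
  obtain a where a: "\<And>t. t \<le> a \<Longrightarrow> 0 < s * Im (g t)"
    using tail(1) by (auto simp: eventually_at_bot_linorder)
  obtain b where b: "\<And>t. t \<ge> b \<Longrightarrow> 0 < s * Im (g t)"
    using tail(2) by (auto simp: eventually_at_top_linorder)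
  have "continuous_on {a..b} g"
    using sides by (simp add: contour_sides_def piecewise_C1_differentiable_on_def)
  then have "bounded (g ` {a..b})"
    by (intro compact_imp_bounded compact_continuous_image) auto
  then obtain B where B: "B > 0" "\<And>t. t \<in> {a..b} \<Longrightarrow> norm (g t) \<le> B"
    by (auto simp: bounded_pos)
  \<comment> \<open>The far ends of g lie in the half-plane where s * Im is positive and its middle
    part lies in the disc of radius B, so neither contains such a point.\<close>
  have out: "w \<in> - range g" if "s * Im w \<le> 0" "B < norm w" for w
  proof
    assume "w \<in> range g"
    then obtain t where "w = g t"
      by blast
    then show False
      using that a[of t] b[of t] B(2)[of t] by (cases "t \<le> a"; cases "t \<ge> b") auto
  qed
  obtain x where x: "Complex x 0 \<in> V" "x > B"
    using eventually_happens[OF eventually_conj[OF V eventually_gt_at_top[of B]]] by auto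
  obtain n where n: "real n > B"
    using reals_Archimedean2 by blast
  define p where "p = complex_of_real (- (1 + real n))"
  have "p \<in> U"
    using lp by (auto simp: p_def lpoles_eq)
  \<comment> \<open>Level c lies on the side opposite to the ends and beyond the disc of radius B.
    The set \<open>T\<close> leads from a far left pole to this level, across, and back to the axis
    at x > B, avoiding the range of g throughout.\<close>
  define c where "c = - s * (B + 1)"
  define T where "T = closed_segment p (Complex (Re p) c) \<union> closed_segment (Complex (Re p) c) (Complex x c)
      \<union> closed_segment (Complex x c) (Complex x 0)"
  have "connected T"
    unfolding T_def by (intro connected_Un) (auto simp: Int_Un_distrib2)
  have Re_p: "Re p = - (1 + real n)" "Im p = 0"
    by (simp_all add: p_def)
  have "T \<subseteq> - range g"
  proof
    fix w assume w: "w \<in> T"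
    have "s * Im w \<le> 0 \<and> (Re w = Re p \<or> \<bar>Im w\<bar> = B + 1 \<or> Re w = x)"
      using w s B(1) Re_p
      by (auto simp: T_def c_def closed_segment_same_Re closed_segment_same_Im closed_segment_eq_real_ivl
               split: if_splits)
    then show "w \<in> - range g"
      using abs_Re_le_cmod[of w] abs_Im_le_cmod[of w] n x Re_p by (intro out) auto
  qed
  have "Complex x 0 \<notin> V"
    using sides unfolding contour_sides_def
    by (intro same_component[OF _ _ _ \<open>connected T\<close> \<open>T \<subseteq> - range g\<close> _ _ \<open>p \<in> U\<close>]) (auto simp: T_def)
  then show False
    using x by simp
qed

text \<open>An end running along the negative real axis would, by the intermediate value theorem for
  Re, pass through one of the left poles -(1 + n).\<close>

lemma loop_ray_nonzero:
  fixes g :: "real \<Rightarrow> complex"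
  assumes g: "continuous_on UNIV g" "range g \<inter> lpoles = {}"
    and Re: "filterlim (\<lambda>s. Re (g s)) at_bot G" and Im: "\<forall>\<^sub>F s in G. Im (g s) = \<phi>"
    and G: "G = at_bot \<or> G = at_top"
  shows "\<phi> \<noteq> 0"
proof
  assume "\<phi> = 0"
  obtain T s where T: "connected T" "s \<in> T" "\<And>t. t \<in> T \<Longrightarrow> Im (g t) = 0" "\<forall>\<^sub>F t in G. t \<in> T" "G \<noteq> bot"
  proof (cases "G = at_bot")
    case True
    have "\<exists>a. \<forall>t\<le>a. Im (g t) = 0"
      using Im unfolding \<open>\<phi> = 0\<close> True eventually_at_bot_linorder .
    then obtain a where "\<forall>t\<le>a. Im (g t) = 0"
      by blast
    then show ?thesis
      using True by (intro that[of "{..a}" a]) (auto simp: eventually_le_at_bot)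
  next
    case False
    then have "G = at_top"
      using G by auto
    have "\<exists>a. \<forall>t\<ge>a. Im (g t) = 0"
      using Im unfolding \<open>\<phi> = 0\<close> \<open>G = at_top\<close> eventually_at_top_linorder .
    then obtain a where "\<forall>t\<ge>a. Im (g t) = 0"
      by blast
    then show ?thesis
      using \<open>G = at_top\<close> by (intro that[of "{a..}" a]) (auto simp: eventually_ge_at_top)
  qed
  obtain n where n: "- Re (g s) < real n"
    using reals_Archimedean2 by blast
  define p where "p = - (1 + real n)"
  have "\<forall>\<^sub>F t in G. Re (g t) \<le> p"
    using Re by (simp add: filterlim_at_bot)
  then obtain t where t: "t \<in> T" "Re (g t) \<le> p"
    using eventually_happens'[OF T(5) eventually_conj[OF T(4)]] by blast
  have "connected ((\<lambda>t. Re (g t)) ` T)"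
    using T(1) g(1) by (intro connected_continuous_image continuous_intros) (auto elim: continuous_on_subset)
  moreover have "p \<le> Re (g s)"
    using n by (simp add: p_def)
  ultimately have "p \<in> (\<lambda>t. Re (g t)) ` T"
    using t T(2) by (meson connectedD_interval imageI)
  then obtain u where "u \<in> T" "Re (g u) = p"
    by auto
  then have "g u = of_real p"
    using T(3) by (simp add: complex_eq_iff)
  then have "g u \<in> lpoles"
    unfolding lpoles_eq p_def by blast
  then show False
    using g(2) by blast
qed

end

section \<open>The vertical line and the loops\<close>

text \<open>A connected set meeting both half-planes contains a point of the line, by the
  intermediate value theorem for Re; this gives maximality.\<close>

lemma halfplane_components:
  "{\<xi>. Re \<xi> < a} \<in> components (- {\<xi>. Re \<xi> = a})" "{\<xi>. a < Re \<xi>} \<in> components (- {\<xi>. Re \<xi> = a})"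
proof -
  have between: "False"
    if "connected d" "d \<subseteq> - {\<xi>. Re \<xi> = a}" "v \<in> d" "w \<in> d" "Re v < a" "a < Re w" for d v w
  proof -
    have "connected (Re ` d)"
      using that by (intro connected_continuous_image continuous_intros) auto
    then have "a \<in> Re ` d"
      using that by (meson connectedD_interval imageI less_imp_le)
    then show False
      using that by auto
  qed
  have ne: "Complex (a - 1) 0 \<in> {\<xi>. Re \<xi> < a}" "Complex (a + 1) 0 \<in> {\<xi>. a < Re \<xi>}"
    by auto
  show "{\<xi>. Re \<xi> < a} \<in> components (- {\<xi>. Re \<xi> = a})"
    unfolding in_components_maximal
  proof (intro conjI allI impI)
    fix d assume d: "d \<noteq> {} \<and> {\<xi>. Re \<xi> < a} \<subseteq> d \<and> d \<subseteq> - {\<xi>. Re \<xi> = a} \<and> connected d"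
    then have mem: "Complex (a - 1) 0 \<in> d"
      using ne by blast
    have "Re w < a" if "w \<in> d" for w
    proof -
      have "Re w \<noteq> a" "\<not> a < Re w"
        using between[of d "Complex (a - 1) 0" w] d that mem by auto
      then show ?thesis
        by simp
    qed
    then show "d = {\<xi>. Re \<xi> < a}"
      using d by blast
  next
    show "{\<xi>. Re \<xi> < a} \<noteq> {}"
      using ne by blast
  qed (use convex_halfspace_Re_lt[of a] in \<open>auto intro: convex_connected\<close>)
  show "{\<xi>. a < Re \<xi>} \<in> components (- {\<xi>. Re \<xi> = a})"
    unfolding in_components_maximal
  proof (intro conjI allI impI)
    fix d assume d: "d \<noteq> {} \<and> {\<xi>. a < Re \<xi>} \<subseteq> d \<and> d \<subseteq> - {\<xi>. Re \<xi> = a} \<and> connected d"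
    then have mem: "Complex (a + 1) 0 \<in> d"
      using ne by blast
    have "a < Re w" if "w \<in> d" for w
    proof -
      have "Re w \<noteq> a" "\<not> Re w < a"
        using between[of d w "Complex (a + 1) 0"] d that mem by auto
      then show ?thesis
        by simp
    qed
    then show "d = {\<xi>. a < Re \<xi>}"
      using d by blast
  next
    show "{\<xi>. a < Re \<xi>} \<noteq> {}"
      using ne by blast
  qed (use convex_halfspace_Re_gt[of a] in \<open>auto intro: convex_connected\<close>)
qed

lemma vertical_line_contour:
  "line_imag_inf (Complex a) {\<xi>. Re \<xi> < a} {\<xi>. a < Re \<xi>}"
    and vector_derivative_vertical_line: "vector_derivative (Complex a) (at s) = \<i>"
proof -
  have der: "(Complex a has_vector_derivative \<i>) (at s within A)" for s A
  proof -
    have "((\<lambda>s. of_real a + \<i> * of_real s) has_vector_derivative \<i>) (at s within A)"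
      by (auto intro!: derivative_eq_intros)
    then show ?thesis
      by (simp add: Complex_eq[abs_def])
  qed
  then show "vector_derivative (Complex a) (at s) = \<i>"
    by (intro vector_derivative_at)
  have "Complex a piecewise_C1_differentiable_on {c..d}" for c d
    using der
    by (intro C1_differentiable_imp_piecewise) (auto simp: C1_differentiable_on_def intro!: exI[of _ "\<lambda>_. \<i>"])
  moreover have "range (Complex a) = {\<xi>. Re \<xi> = a}"
    by (auto simp: image_iff complex_eq_iff)
  moreover have "Complex (a - 1) 0 \<in> {\<xi>. Re \<xi> < a} \<and> Complex (a - 1) 0 \<notin> {\<xi>. a < Re \<xi>}"
    by simp
  then have "{\<xi>. Re \<xi> < a} \<noteq> {\<xi>. a < Re \<xi>}"
    by metis
  ultimately have "contour_sides (Complex a) {\<xi>. Re \<xi> < a} {\<xi>. a < Re \<xi>}"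
    using halfplane_components[of a] by (simp add: contour_sides_def inj_def)
  then show "line_imag_inf (Complex a) {\<xi>. Re \<xi> < a} {\<xi>. a < Re \<xi>}"
    by (auto simp: line_imag_inf_def filterlim_ident eventually_gt_at_top eventually_gt_at_bot
             intro!: exI[of _ a])
qed

context fox_integrand_setting
begin

text \<open>The definition lets a loop end at arbitrary heights, but the left poles force the lower
  end below and the upper end above the real axis. Then the far negative axis lies between the two
  rays, hence in U, and \<open>closes_loop\<close> applies to each end with its own height.\<close>

lemma contour_value_loop:
  assumes loop: "loop_minus_inf g U V" and poles: "lpoles \<subseteq> U" "rpoles \<subseteq> V"
    and int: "integrand g absolutely_integrable_on UNIV"
  shows "\<exists>r. \<forall>\<rho>\<ge>r. of_real (- \<rho>) \<notin> lpoles \<longrightarrow> integral UNIV (integrand g) = shifted_value \<rho>"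
proof -
  obtain \<phi>\<^sub>1 \<phi>\<^sub>2 where sides: "contour_sides g U V" and "\<phi>\<^sub>1 < \<phi>\<^sub>2"
    and bot: "filterlim (\<lambda>s. Re (g s)) at_bot at_bot" "\<forall>\<^sub>F s in at_bot. Im (g s) = \<phi>\<^sub>1"
    and top: "filterlim (\<lambda>s. Re (g s)) at_bot at_top" "\<forall>\<^sub>F s in at_top. Im (g s) = \<phi>\<^sub>2"
    and UV: "\<forall>y\<in>{\<phi>\<^sub>1<..<\<phi>\<^sub>2}. \<forall>\<^sub>F x in at_bot. Complex x y \<in> U" "\<forall>y. \<forall>\<^sub>F x in at_top. Complex x y \<in> V"
    using loop unfolding loop_minus_inf_def by blast
  have cont: "continuous_on UNIV g"
    by (rule contour_sides_continuous[OF sides])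
  have "U \<subseteq> - range g"
    using sides in_components_subset by (auto simp: contour_sides_def)
  then have disj: "range g \<inter> lpoles = {}"
    using poles by blast
  have nz: "\<phi>\<^sub>1 \<noteq> 0" "\<phi>\<^sub>2 \<noteq> 0"
    using loop_ray_nonzero[OF cont disj bot] loop_ray_nonzero[OF cont disj top] by auto
  have V0: "\<forall>\<^sub>F x in at_top. Complex x 0 \<in> V"
    using UV by blast
  have "\<not> 0 < \<phi>\<^sub>1"
  proof
    assume "0 < \<phi>\<^sub>1"
    then have "\<forall>\<^sub>F t in at_bot. 0 < 1 * Im (g t)" "\<forall>\<^sub>F t in at_top. 0 < 1 * Im (g t)"
      using bot(2) top(2) \<open>\<phi>\<^sub>1 < \<phi>\<^sub>2\<close> by (auto elim: eventually_mono)
    then show False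
      using loop_minus_inf_ends[OF sides poles(1) _ _ _ V0] by blast
  qed
  moreover have "\<not> \<phi>\<^sub>2 < 0"
  proof
    assume "\<phi>\<^sub>2 < 0"
    then have "\<forall>\<^sub>F t in at_bot. 0 < - 1 * Im (g t)" "\<forall>\<^sub>F t in at_top. 0 < - 1 * Im (g t)"
      using bot(2) top(2) \<open>\<phi>\<^sub>1 < \<phi>\<^sub>2\<close> by (auto elim: eventually_mono)
    then show False
      using loop_minus_inf_ends[OF sides poles(1) _ _ _ V0] by blast
  qed
  ultimately have sgn: "\<phi>\<^sub>1 < 0" "0 < \<phi>\<^sub>2"
    using nz by auto
  from sgn have "- \<phi>\<^sub>1 > 0"
    by simp
  from closes_loop[OF this] obtain \<rho>\<^sub>1 where \<rho>1: "\<And>\<rho> \<sigma> u. \<rho> \<ge> \<rho>\<^sub>1 \<Longrightarrow> \<sigma> = 1 \<or> \<sigma> = - 1 \<Longrightarrow> filterlim (\<lambda>n. Re (u n)) at_bot sequentially \<Longrightarrow>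
      \<forall>\<^sub>F n in sequentially. Im (u n) = \<sigma> * - \<phi>\<^sub>1 \<Longrightarrow> closes \<sigma> u \<rho>"
    by blast
  from closes_loop[OF sgn(2)] obtain \<rho>\<^sub>2 where \<rho>2: "\<And>\<rho> \<sigma> u. \<rho> \<ge> \<rho>\<^sub>2 \<Longrightarrow> \<sigma> = 1 \<or> \<sigma> = - 1 \<Longrightarrow> filterlim (\<lambda>n. Re (u n)) at_bot sequentially \<Longrightarrow>
      \<forall>\<^sub>F n in sequentially. Im (u n) = \<sigma> * \<phi>\<^sub>2 \<Longrightarrow> closes \<sigma> u \<rho>"
    by blast
  have minus: "filterlim (\<lambda>n. - real n) at_bot sequentially"
    by (simp add: filterlim_uminus_at_bot filterlim_real_sequentially)
  show ?thesis
  proof (rule contour_value[OF sides poles int])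
    show "filterlim (\<lambda>s. norm (g s)) at_top at_bot" "filterlim (\<lambda>s. norm (g s)) at_top at_top"
      using bot(1) top(1) by (simp_all add: filterlim_norm_of_Re)
    have "closes 1 (\<lambda>n. g (real n)) \<rho>" if "\<rho> \<ge> \<rho>\<^sub>2" for \<rho>
      using filterlim_compose[OF top(1) filterlim_real_sequentially]
        eventually_compose_filterlim[OF top(2) filterlim_real_sequentially] that
      by (intro \<rho>2) auto
    moreover have "closes (- 1) (\<lambda>n. g (- real n)) \<rho>" if "\<rho> \<ge> \<rho>\<^sub>1" for \<rho>
      using filterlim_compose[OF bot(1) minus] eventually_compose_filterlim[OF bot(2) minus] that
      by (intro \<rho>1) auto
    ultimately show "\<forall>\<rho>\<ge>max \<rho>\<^sub>1 \<rho>\<^sub>2. closes 1 (\<lambda>n. g (real n)) \<rho> \<and> closes (- 1) (\<lambda>n. g (- real n)) \<rho>"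
      by auto
    show "\<forall>\<^sub>F x in at_bot. Complex x 0 \<in> U"
      using UV(1) sgn by simp
  qed fact
qed

text \<open>Where |F| >= c, the integral of the norm is at least c times the arc length, and the arc
  length is at least the horizontal displacement. So a curve cannot escape horizontally through such
  a region with a finite integral.\<close>

lemma integrand_displacement_bound:
  assumes sides: "contour_sides g U V" and int: "integrand g absolutely_integrable_on UNIV"
    and "a \<le> b" "c > 0" and c: "\<And>s. s \<in> {a..b} \<Longrightarrow> c \<le> norm (F (g s))"
  shows "c * \<bar>Re (g b) - Re (g a)\<bar> \<le> integral UNIV (\<lambda>s. norm (integrand g s))"
proof -
  let ?G = "\<lambda>s. norm (integrand g s)"
  have g: "g piecewise_C1_differentiable_on {a..b}"
    using sides by (simp add: contour_sides_def)
  obtain S where S: "\<And>x. x \<in> {a..b} - S \<Longrightarrow> g differentiable at x" and "finite S"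
    using g unfolding piecewise_C1_differentiable_on_def C1_differentiable_on_eq by blast
  have der: "((\<lambda>s. vector_derivative g (at s)) has_integral (g b - g a)) {a..b}"
  proof (rule fundamental_theorem_of_calculus_interior_strong[OF \<open>finite S\<close> \<open>a \<le> b\<close>])
    show "(g has_vector_derivative vector_derivative g (at x)) (at x)" if "x \<in> {a<..<b} - S" for x
      using S[of x] that by (auto simp: vector_derivative_works[symmetric])
    show "continuous_on {a..b} g"
      using g by (simp add: piecewise_C1_differentiable_on_def)
  qed
  have int_G: "?G integrable_on UNIV"
    using int by (simp add: absolutely_integrable_on_def)
  then have int_G': "?G integrable_on {a..b}"
    by (rule integrable_on_subinterval) auto
  have "norm (integral {a..b} (\<lambda>s. vector_derivative g (at s))) \<le> integral {a..b} (\<lambda>s. (1 / c) * ?G s)"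
  proof (rule integral_norm_bound_integral)
    show "(\<lambda>s. (1 / c) * ?G s) integrable_on {a..b}"
      using int_G' by (rule integrable_on_mult_right)
    show "norm (vector_derivative g (at s)) \<le> 1 / c * ?G s" if "s \<in> {a..b}" for s
      using mult_right_mono[OF c[OF that], of "norm (vector_derivative g (at s))"] \<open>c > 0\<close>
      unfolding integrand_eq by (simp add: norm_mult field_simps)
  qed (use der in blast)
  also have "\<dots> = integral {a..b} ?G / c"
    by simp
  also have "integral {a..b} (\<lambda>s. vector_derivative g (at s)) = g b - g a"
    using der by (rule integral_unique)
  finally have "c * norm (g b - g a) \<le> integral {a..b} ?G"
    using \<open>c > 0\<close> by (simp add: field_simps)
  moreover have "integral {a..b} ?G \<le> integral UNIV ?G"
    using int_G int_G' by (intro integral_subset_le) auto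
  moreover have "c * \<bar>Re (g b) - Re (g a)\<bar> \<le> c * norm (g b - g a)"
    using \<open>c > 0\<close> abs_Re_le_cmod[of "g b - g a"] by simp
  ultimately show ?thesis
    by linarith
qed

lemma F_far_right_bound:
  assumes "\<phi> \<noteq> 0"
  shows "\<exists>r. \<exists>c>0. \<forall>\<xi>. r \<le> Re \<xi> \<and> Im \<xi> = \<phi> \<longrightarrow> c \<le> norm (F \<xi>)"
proof -
  obtain r c where c: "c > 0" "\<And>\<xi>. r \<le> Re \<xi> \<Longrightarrow> Im \<xi> = \<phi> \<Longrightarrow> c \<le> norm (theta \<xi>)"
    using theta_far_right_bound[OF assms] by blast
  have "c \<le> norm (F \<xi>)" if "max r 0 \<le> Re \<xi>" "Im \<xi> = \<phi>" for \<xi>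
  proof -
    have "z powr 0 \<le> z powr (- Re \<xi>)"
      using z that by (intro powr_mono') auto
    then have "c * 1 \<le> norm (theta \<xi>) * z powr (- Re \<xi>)"
      using c that z by (intro mult_mono) auto
    then show ?thesis
      by (simp add: norm_F)
  qed
  then show ?thesis
    using c(1) by blast
qed

text \<open>The two end rays have different heights, so at least one is off the real axis. There |F|
  is eventually bounded below while the horizontal displacement is unbounded.\<close>

lemma loop_plus_inf_not_integrable:
  assumes loop: "loop_plus_inf g U V"
  shows "\<not> integrand g absolutely_integrable_on UNIV"
proof
  assume int: "integrand g absolutely_integrable_on UNIV"
  define M where "M = integral UNIV (\<lambda>s. norm (integrand g s))"
  obtain \<phi>\<^sub>1 \<phi>\<^sub>2 where sides: "contour_sides g U V" and "\<phi>\<^sub>1 < \<phi>\<^sub>2"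
    and bot: "filterlim (\<lambda>s. Re (g s)) at_top at_bot" "\<forall>\<^sub>F s in at_bot. Im (g s) = \<phi>\<^sub>1"
    and top: "filterlim (\<lambda>s. Re (g s)) at_top at_top" "\<forall>\<^sub>F s in at_top. Im (g s) = \<phi>\<^sub>2"
    using loop unfolding loop_plus_inf_def by blast
  show False
  proof (cases "\<phi>\<^sub>2 = 0")
    case False
    then obtain r c where c: "c > 0" "\<And>\<xi>. r \<le> Re \<xi> \<Longrightarrow> Im \<xi> = \<phi>\<^sub>2 \<Longrightarrow> c \<le> norm (F \<xi>)"
      using F_far_right_bound by blast
    have "\<forall>\<^sub>F s in at_top. r \<le> Re (g s) \<and> Im (g s) = \<phi>\<^sub>2"
      using top by (auto simp: filterlim_at_top intro: eventually_conj)
    then obtain a where a: "\<And>s. s \<ge> a \<Longrightarrow> r \<le> Re (g s) \<and> Im (g s) = \<phi>\<^sub>2"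
      by (auto simp: eventually_at_top_linorder)
    have "\<forall>\<^sub>F s in at_top. \<bar>Re (g a)\<bar> + (\<bar>M\<bar> + 1) / c \<le> Re (g s) \<and> a \<le> s"
      using top(1) eventually_ge_at_top[of a] by (auto simp: filterlim_at_top intro: eventually_conj)
    then obtain b where b: "\<bar>Re (g a)\<bar> + (\<bar>M\<bar> + 1) / c \<le> Re (g b)" "a \<le> b"
      using eventually_happens by fastforce
    have "c * \<bar>Re (g b) - Re (g a)\<bar> \<le> M"
      unfolding M_def using a b c by (intro integrand_displacement_bound[OF sides int]) auto
    moreover have "c * ((\<bar>M\<bar> + 1) / c) \<le> c * \<bar>Re (g b) - Re (g a)\<bar>"
      using c b by (intro mult_left_mono) auto
    ultimately show False
      using c(1) by simp
  next
    case True
    then have "\<phi>\<^sub>1 \<noteq> 0"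
      using \<open>\<phi>\<^sub>1 < \<phi>\<^sub>2\<close> by auto
    then obtain r c where c: "c > 0" "\<And>\<xi>. r \<le> Re \<xi> \<Longrightarrow> Im \<xi> = \<phi>\<^sub>1 \<Longrightarrow> c \<le> norm (F \<xi>)"
      using F_far_right_bound by blast
    have "\<forall>\<^sub>F s in at_bot. r \<le> Re (g s) \<and> Im (g s) = \<phi>\<^sub>1"
      using bot by (auto simp: filterlim_at_top intro: eventually_conj)
    then obtain b where b: "\<And>s. s \<le> b \<Longrightarrow> r \<le> Re (g s) \<and> Im (g s) = \<phi>\<^sub>1"
      by (auto simp: eventually_at_bot_linorder)
    have "\<forall>\<^sub>F s in at_bot. \<bar>Re (g b)\<bar> + (\<bar>M\<bar> + 1) / c \<le> Re (g s) \<and> s \<le> b"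
      using bot(1) eventually_le_at_bot[of b] by (auto simp: filterlim_at_top intro: eventually_conj)
    then obtain a where a: "\<bar>Re (g b)\<bar> + (\<bar>M\<bar> + 1) / c \<le> Re (g a)" "a \<le> b"
      using eventually_happens by fastforce
    have "c * \<bar>Re (g b) - Re (g a)\<bar> \<le> M"
      unfolding M_def using a b c by (intro integrand_displacement_bound[OF sides int]) auto
    moreover have "c * ((\<bar>M\<bar> + 1) / c) \<le> c * \<bar>Re (g b) - Re (g a)\<bar>"
      using c a by (intro mult_left_mono) auto
    ultimately show False
      using c(1) by simp
  qed
qed

lemma contour_value_any:
  assumes "fox_contour 2 1 upper_params lower_params g" "integrand g absolutely_integrable_on UNIV"
  shows "\<exists>r. \<forall>\<rho>\<ge>r. of_real (- \<rho>) \<notin> lpoles \<longrightarrow> integral UNIV (integrand g) = shifted_value \<rho>"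
proof -
  obtain U V where "loop_minus_inf g U V \<or> loop_plus_inf g U V \<or> line_imag_inf g U V"
    "lpoles \<subseteq> U" "rpoles \<subseteq> V"
    using assms(1) by (auto simp: fox_contour_def lpoles_def rpoles_def)
  then show ?thesis
    using contour_value_loop contour_value_line loop_plus_inf_not_integrable assms(2) by metis
qed

text \<open>This line shows that an admissible, absolutely integrable contour exists. It also gives
  the residue formula for every regular \<rho> >= 1, and so covers the range 1 < \<rho> < \<alpha>
  needed for the expansion.\<close>

lemma central_line:
  shows "fox_contour 2 1 upper_params lower_params (Complex (- 1 / 2))"
    and "integrand (Complex (- 1 / 2)) absolutely_integrable_on UNIV"
    and "1 \<le> \<rho> \<Longrightarrow> of_real (- \<rho>) \<notin> lpoles \<Longrightarrow> integral UNIV (integrand (Complex (- 1 / 2))) = shifted_value \<rho>"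
proof -
  let ?g = "Complex (- 1 / 2)" and ?U = "{\<xi>. Re \<xi> < - 1 / 2}" and ?V = "{\<xi>. - 1 / 2 < Re \<xi>}"
  have line: "line_imag_inf ?g ?U ?V"
    by (rule vertical_line_contour)
  have "lpoles \<subseteq> ?U" "rpoles \<subseteq> ?V"
    using lpoles_le rpoles_ge by fastforce+
  with line show "fox_contour 2 1 upper_params lower_params ?g"
    unfolding fox_contour_def lpoles_def rpoles_def by blast
  have eq: "integrand ?g = (\<lambda>s. F (Complex (- 1 / 2) s) * \<i>)"
    unfolding integrand_eq by (simp add: vector_derivative_vertical_line)
  have "of_real (- 1 / 2) \<notin> lpoles \<union> rpoles"
    using lpoles_le[of "of_real (- 1 / 2)"] rpoles_ge[of "of_real (- 1 / 2)"] by auto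
  from F_line_integrable(1)[OF this]
  show int: "integrand ?g absolutely_integrable_on UNIV"
    unfolding eq by (intro set_integrable_mult_left) auto
  assume \<rho>: "1 \<le> \<rho>" "of_real (- \<rho>) \<notin> lpoles"
  have sides: "contour_sides ?g ?U ?V"
    using line by (simp add: line_imag_inf_def)
  have lp: "p \<in> of_real ` {..- 3 / 4}" if "p \<in> lpoles" for p
    using lpoles_le[OF that] that poles_real by (auto elim!: Reals_cases simp: subset_iff)
  have rp: "p \<in> of_real ` {0..}" if "p \<in> rpoles" for p
    using rpoles_ge[OF that] that poles_real by (auto elim!: Reals_cases simp: subset_iff)
  show "integral UNIV (integrand ?g) = shifted_value \<rho>"
  \<comment> \<open>The point -3/4 separates the first left pole -1 from the line, and 0 is the
    first right pole. Both lie in the unit disc, which explains r = 1.\<close>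
  proof (rule contour_value_of_barriers[where K = "{of_real (- 3 / 4)}" and K' = "{of_real 0}" and r = 1])
    show "?g piecewise_C1_differentiable_on {a..b}" for a b
      using sides by (simp add: contour_sides_def)
    show "integrand ?g integrable_on UNIV"
      using int by (simp add: absolutely_integrable_on_def)
    show "lpoles \<subseteq> {of_real (- 3 / 4)} \<union> of_real ` {..- 3 / 4}" "rpoles \<subseteq> {of_real 0} \<union> of_real ` {0..}"
      using lp rp by blast+
    show "range ?g \<inter> ({of_real (- 3 / 4)} \<union> {of_real 0} \<union> of_real ` {..- 3 / 4} \<union> of_real ` {0..}) = {}"
      by (auto simp: complex_eq_iff)
    have ge: "s \<le> norm (?g s)" "- s \<le> norm (?g s)" for s
      using abs_Im_le_cmod[of "?g s"] by (simp_all add: abs_le_iff)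
    show "filterlim (\<lambda>s. norm (?g s)) at_top at_top"
      using ge(1) by (intro filterlim_at_top_mono[OF filterlim_ident] always_eventually) auto
    show "filterlim (\<lambda>s. norm (?g s)) at_top at_bot"
      using ge(2) by (intro filterlim_at_top_mono[OF filterlim_uminus_at_top_at_bot] always_eventually) auto
    show "closes 1 (\<lambda>n. ?g (real n)) \<rho>" "closes (- 1) (\<lambda>n. ?g (- real n)) \<rho>"
      by (auto intro!: closes_line filterlim_real_sequentially)
  qed (use \<rho> in auto)
qed

section \<open>The H-function is well defined\<close>

lemma regular_line_exists: "\<exists>\<rho>\<ge>r. of_real (- \<rho>) \<notin> lpoles"
proof (rule ccontr)
  assume "\<not> ?thesis"
  then have "(\<lambda>\<rho>. complex_of_real (- \<rho>)) ` {r..r + 1} \<subseteq> (lpoles \<union> rpoles) \<inter> ball 0 (\<bar>r\<bar> + 2)"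
    by auto
  then have "finite ((\<lambda>\<rho>. complex_of_real (- \<rho>)) ` {r..r + 1})"
    using finite_poles_ball finite_subset by blast
  then have "finite {r..r + 1}"
    by (rule finite_imageD) (auto simp: inj_on_def)
  then show False
    by (simp add: infinite_Icc)
qed

lemma fox_params_holds: "fox_params 2 1 upper_params lower_params"
proof -
  have "lpoles \<inter> rpoles = {}"
    using lpoles_le rpoles_ge by force
  then show ?thesis
    using \<alpha> \<beta> by (auto simp: fox_params_def lpoles_def rpoles_def upper_params_def lower_params_def)
qed

text \<open>An arbitrary contour yields \<open>shifted_value\<close> only from some bound on that
  depends on it. The central line links that value to the one at the prescribed \<rho>, because its
  integral equals both.\<close>

lemma fox_H_eq_shifted_value:
  assumes "1 \<le> \<rho>" "of_real (- \<rho>) \<notin> lpoles"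
  shows "fox_H 2 1 upper_params lower_params (of_real z) = 1 / (2 * of_real pi * \<i>) * shifted_value \<rho>"
  unfolding fox_H_def
proof (rule the_equality)
  show "fox_params 2 1 upper_params lower_params \<and>
    (\<exists>g. fox_contour 2 1 upper_params lower_params g \<and> integrand g absolutely_integrable_on UNIV \<and>
         1 / (2 * of_real pi * \<i>) * shifted_value \<rho> = 1 / (2 * of_real pi * \<i>) * integral UNIV (integrand g))"
    using fox_params_holds central_line(1,2) central_line(3)[OF assms] by metis
next
  fix h assume "fox_params 2 1 upper_params lower_params \<and>
    (\<exists>g. fox_contour 2 1 upper_params lower_params g \<and> integrand g absolutely_integrable_on UNIV \<and>
         h = 1 / (2 * of_real pi * \<i>) * integral UNIV (integrand g))"
  then obtain g where g: "fox_contour 2 1 upper_params lower_params g"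
    "integrand g absolutely_integrable_on UNIV" "h = 1 / (2 * of_real pi * \<i>) * integral UNIV (integrand g)"
    by blast
  obtain r where r: "\<And>\<rho>. \<rho> \<ge> r \<Longrightarrow> of_real (- \<rho>) \<notin> lpoles \<Longrightarrow> integral UNIV (integrand g) = shifted_value \<rho>"
    using contour_value_any[OF g(1,2)] by blast
  obtain \<rho>' where \<rho>': "\<rho>' \<ge> max r 1" "of_real (- \<rho>') \<notin> lpoles"
    using regular_line_exists by blast
  have "integral UNIV (integrand g) = shifted_value \<rho>'"
    using r \<rho>' by simp
  also have "\<dots> = shifted_value \<rho>"
    using central_line(3)[of \<rho>'] central_line(3)[OF assms] \<rho>' by simp
  finally show "h = 1 / (2 * of_real pi * \<i>) * shifted_value \<rho>"
    using g(3) by simp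
qed

end

section \<open>The leading term\<close>

context fox_setting
begin

text \<open>The residue of theta at -1.\<close>

definition leading_coeff :: real where
  "leading_coeff = Gamma (1 - 1 / \<alpha>) * Gamma (1 / \<alpha>) / (pi * Gamma (\<beta> - \<beta> / \<alpha>))"

lemma leading_coeff_pos: "leading_coeff > 0"
proof -
  have "\<beta> * 1 < \<beta> * \<alpha>"
    using \<alpha> \<beta> by (intro mult_strict_left_mono) auto
  then have "\<beta> - \<beta> / \<alpha> > 0" "1 - 1 / \<alpha> > 0"
    using \<alpha> \<beta> by (auto simp: field_simps)
  then show ?thesis
    using \<alpha> by (auto simp: leading_coeff_def intro!: divide_pos_pos mult_pos_pos Gamma_real_pos)
qed

text \<open>Since 1 < \<alpha> < 2, the first left pole is -1 and the next one is -\<alpha>, which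
  comes from the second Gamma factor.\<close>

lemma lpoles_right_of:
  assumes "1 < \<rho>" "\<rho> < \<alpha>"
  shows "{p \<in> lpoles. - \<rho> < Re p} = {- 1}"
proof -
  have "p = - 1" if p: "p \<in> lpoles" "- \<rho> < Re p" for p
  proof -
    have "\<alpha> * 1 \<le> \<alpha> * (1 + real n)" for n
      using \<alpha> by (intro mult_left_mono) auto
    then have "p \<noteq> of_real (- (\<alpha> * (1 + real n)))" for n
      using p(2) assms(2) by (smt (verit) Re_complex_of_real mult.right_neutral)
    then obtain n where n: "p = of_real (- (1 + real n))"
      using p(1) unfolding lpoles_eq by blast
    then have "real n < 1"
      using p assms \<alpha> by simp
    then show ?thesis
      using n by simp
  qed
  moreover have "- 1 \<in> lpoles"
    unfolding lpoles_eq by (rule UnI1, rule range_eqI[of _ _ 0]) simp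
  moreover have "- \<rho> < Re (- 1)"
    using assms by simp
  ultimately show ?thesis
    by blast
qed

end

context fox_integrand_setting
begin

text \<open>Only Gamma(1 + xi) is singular at -1, and (1 + xi) Gamma(1 + xi) = Gamma(xi + 2) removes
  the singularity. As Gamma(1) = 1, the residue is the value at -1 of the product \<open>H\<close>
  of the remaining factors.\<close>

lemma residue_F_minus_one: "residue F (- 1) = of_real (leading_coeff * z)"
proof (rule residue_simple')
  \<comment> \<open>The strip ends at the neighbouring poles -\<alpha> and 0, so -1 is the only pole
    inside.\<close>
  let ?S = "{\<xi>. - \<alpha> < Re \<xi>} \<inter> {\<xi>. Re \<xi> < 0}"
  show "open ?S"
    by (intro open_Int open_halfspace_Re_gt open_halfspace_Re_lt)
  show "- 1 \<in> ?S"
    using \<alpha> by simp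
  have "p = - 1" if p: "p \<in> ?S" "p \<in> lpoles \<union> rpoles" for p
  proof -
    from p have "p \<in> lpoles"
      using rpoles_ge by force
    obtain \<rho> where "max 1 (- Re p) < \<rho>" "\<rho> < \<alpha>"
      using p \<alpha> dense[of "max 1 (- Re p)" \<alpha>] by auto
    then have "p \<in> {p \<in> lpoles. - \<rho> < Re p}" "1 < \<rho>" "\<rho> < \<alpha>"
      using \<open>p \<in> lpoles\<close> by simp_all
    then show ?thesis
      by (simp only: lpoles_right_of singleton_iff)
  qed
  then show "F holomorphic_on ?S - {- 1}"
    by (intro holomorphic_on_subset[OF F_holomorphic]) auto
  define H :: "complex \<Rightarrow> complex" where "H \<xi> = Gamma (1 + \<xi> / of_real \<alpha>) * Gamma (- (\<xi> / of_real \<alpha>)) * rGamma (- (\<xi> / 2)) *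
     rGamma (of_real \<beta> + of_real (\<beta> / \<alpha>) * \<xi>) * rGamma (1 + \<xi> / 2) * of_real z powr (- \<xi>)" for \<xi>
  have H_1: "H (- 1) = of_real (leading_coeff * z)"
  proof -
    have "Gamma (1 + - 1 / complex_of_real \<alpha>) = of_real (Gamma (1 - 1 / \<alpha>))"
      by (simp flip: Gamma_complex_of_real)
    moreover have "Gamma (- (- 1 / complex_of_real \<alpha>)) = of_real (Gamma (1 / \<alpha>))"
      by (simp flip: Gamma_complex_of_real)
    \<comment> \<open>At -1 the two factors with coefficient 1/2 coincide and give 1/Gamma(1/2)^2;
      this is where the pi in the leading coefficient comes from.\<close>
    moreover have "rGamma (- (- 1 / 2)) * rGamma (1 + - 1 / 2) = complex_of_real (1 / pi)"
    proof -
      have "rGamma (1 / 2) = complex_of_real (1 / sqrt pi)"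
        by (simp add: rGamma_inverse_Gamma Gamma_one_half_complex inverse_eq_divide)
      then show ?thesis
        by (simp flip: of_real_mult)
    qed
    moreover have "rGamma (of_real \<beta> + of_real (\<beta> / \<alpha>) * - 1) = complex_of_real (1 / Gamma (\<beta> - \<beta> / \<alpha>))"
      by (simp add: rGamma_inverse_Gamma inverse_eq_divide flip: Gamma_complex_of_real)
    moreover have "complex_of_real z powr (- (- 1)) = of_real z"
      using z by simp
    moreover have "H (- 1) = Gamma (1 + - 1 / complex_of_real \<alpha>) * Gamma (- (- 1 / complex_of_real \<alpha>)) *
        (rGamma (- (- 1 / 2)) * rGamma (1 + - 1 / 2)) *
        rGamma (of_real \<beta> + of_real (\<beta> / \<alpha>) * - 1) * complex_of_real z powr (- (- 1))"
      unfolding H_def by (simp only: mult_ac)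
    ultimately have "H (- 1) = of_real (Gamma (1 - 1 / \<alpha>)) * of_real (Gamma (1 / \<alpha>)) * of_real (1 / pi) *
        of_real (1 / Gamma (\<beta> - \<beta> / \<alpha>)) * of_real z"
      by (simp only:)
    then show ?thesis
      by (simp add: leading_coeff_def flip: of_real_mult)
  qed
  have nonpos: "x \<le> 0" if "complex_of_real x \<in> \<int>\<^sub>\<le>\<^sub>0" for x
  proof -
    from that obtain n where "complex_of_real x = - of_nat n"
      by (rule nonpos_Ints_cases')
    then have "x = - real n"
      by (simp add: complex_eq_iff)
    then show ?thesis
      by simp
  qed
  have "isCont (\<lambda>\<xi>. Gamma (\<xi> + 2) * H \<xi>) (- 1)"
  proof -
    have "1 + - 1 / complex_of_real \<alpha> \<notin> \<int>\<^sub>\<le>\<^sub>0"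
      using nonpos[of "1 - 1 / \<alpha>"] \<alpha> by (auto simp: field_simps)
    moreover have "- (- 1 / complex_of_real \<alpha>) \<notin> \<int>\<^sub>\<le>\<^sub>0"
      using nonpos[of "1 / \<alpha>"] \<alpha> by auto
    ultimately show ?thesis
      unfolding H_def using z \<alpha> by (intro continuous_intros) auto
  qed
  then have "(\<lambda>\<xi>. Gamma (\<xi> + 2) * H \<xi>) \<midarrow>- 1\<rightarrow> H (- 1)"
    by (simp add: isCont_def)
  moreover have "\<forall>\<^sub>F \<xi> in at (- 1). Gamma (\<xi> + 2) * H \<xi> = F \<xi> * (\<xi> - - 1)"
  proof -
    have "\<forall>\<^sub>F \<xi> in at (- 1 :: complex). \<xi> \<in> ball (- 1) 1 - {- 1}"
      by (intro eventually_at_in_open) auto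
    then show ?thesis
    proof eventually_elim
      case (elim \<xi>)
      have "1 + \<xi> \<notin> \<int>\<^sub>\<le>\<^sub>0"
      proof
        assume "1 + \<xi> \<in> \<int>\<^sub>\<le>\<^sub>0"
        then obtain n where n: "1 + \<xi> = - of_nat n"
          by (auto elim: nonpos_Ints_cases')
        moreover have "norm (1 + \<xi>) < 1"
          using elim by (simp add: dist_norm norm_minus_commute add.commute)
        ultimately have "n = 0"
          by simp
        then show False
          using n elim by (simp add: add_eq_0_iff)
      qed
      from Gamma_plus1[OF this] have "Gamma (\<xi> + 2) = (1 + \<xi>) * Gamma (1 + \<xi>)"
        by (simp add: add_ac)
      then show ?case
        by (simp add: F_def theta_eq H_def mult_ac add.commute)
    qed
  qed
  ultimately show "(\<lambda>\<xi>. F \<xi> * (\<xi> - - 1)) \<midarrow>- 1\<rightarrow> of_real (leading_coeff * z)"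
    unfolding H_1 by (rule Lim_transform_eventually)
qed

text \<open>For \<rho> in this range the residue sum reduces to the single term at -1, and the
  integral along the shifted line is the whole error.\<close>

lemma fox_H_expansion:
  assumes "1 < \<rho>" "\<rho> < \<alpha>"
  shows "norm (fox_H 2 1 upper_params lower_params (of_real z) - of_real (leading_coeff * z))
           \<le> z powr \<rho> * integral UNIV (\<lambda>y. norm (theta (Complex (- \<rho>) y)))"
proof -
  have nonpole: "of_real (- \<rho>) \<notin> lpoles \<union> rpoles"
  proof -
    obtain \<rho>' where "\<rho> < \<rho>'" "\<rho>' < \<alpha>"
      using assms dense by blast
    have "of_real (- \<rho>) \<notin> lpoles"
    proof
      assume "of_real (- \<rho>) \<in> lpoles"
      then have "of_real (- \<rho>) \<in> {p \<in> lpoles. - \<rho>' < Re p}"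
        using \<open>\<rho> < \<rho>'\<close> by simp
      then have "complex_of_real (- \<rho>) = - 1"
        using lpoles_right_of[of \<rho>'] assms \<open>\<rho> < \<rho>'\<close> \<open>\<rho>' < \<alpha>\<close> by simp
      then show False
        using assms by (simp add: complex_eq_iff)
    qed
    then show ?thesis
      using rpoles_ge[of "of_real (- \<rho>)"] assms by auto
  qed
  have "fox_H 2 1 upper_params lower_params (of_real z)
      = 1 / (2 * of_real pi * \<i>) * (2 * pi * \<i> * of_real (leading_coeff * z) +
                \<i> * integral UNIV (\<lambda>y. F (Complex (- \<rho>) y)))"
    using fox_H_eq_shifted_value[of \<rho>] nonpole assms lpoles_right_of[OF assms]
    by (simp add: shifted_value_def residue_F_minus_one)
  moreover have "1 / (2 * of_real pi * \<i>) * (2 * pi * \<i> * v + \<i> * w) - v = w / (2 * of_real pi)" for v w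
    by (simp add: distrib_left)
  ultimately have "fox_H 2 1 upper_params lower_params (of_real z) - of_real (leading_coeff * z)
      = integral UNIV (\<lambda>y. F (Complex (- \<rho>) y)) / (2 * of_real pi)"
    by simp
  then have "norm (fox_H 2 1 upper_params lower_params (of_real z) - of_real (leading_coeff * z))
      = norm (integral UNIV (\<lambda>y. F (Complex (- \<rho>) y))) / (2 * pi)"
    by (simp add: norm_divide norm_mult)
  also have "\<dots> \<le> norm (integral UNIV (\<lambda>y. F (Complex (- \<rho>) y))) / 1"
    using pi_gt3 by (intro divide_left_mono) auto
  also have "\<dots> \<le> z powr \<rho> * integral UNIV (\<lambda>y. norm (theta (Complex (- \<rho>) y)))"
    using F_line_integrable(2)[OF nonpole] by simp
  finally show ?thesis .
qed

end

text \<open>Relative to the leading term the error is of order z powr (\<rho> - 1), so any \<rho>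
  strictly between 1 and \<alpha> suffices.\<close>

lemma (in fox_setting) fox_H_asymptotics:
  "((\<lambda>z. fox_H 2 1 upper_params lower_params (of_real z) / of_real (leading_coeff * z)) \<longlongrightarrow> 1) (at_right 0)"
proof -
  obtain \<rho> where \<rho>: "1 < \<rho>" "\<rho> < \<alpha>"
    using \<alpha> dense by blast
  let ?H = "\<lambda>z. fox_H 2 1 upper_params lower_params (complex_of_real z)"
  define M where "M = integral UNIV (\<lambda>y. norm (theta (Complex (- \<rho>) y)))"
  have "((\<lambda>z. ?H z / of_real (leading_coeff * z) - 1) \<longlongrightarrow> 0) (at_right 0)"
  proof (rule Lim_null_comparison)
    have "\<forall>\<^sub>F z in at_right (0::real). z \<in> {0<..<1}"
      by (rule eventually_at_right_real) auto
    then show "\<forall>\<^sub>F z in at_right 0. norm (?H z / of_real (leading_coeff * z) - 1)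
                 \<le> M / leading_coeff * z powr (\<rho> - 1)"
    proof eventually_elim
      case (elim z)
      then interpret fox_integrand_setting \<alpha> \<beta> z
        by unfold_locales auto
      have pos: "leading_coeff * z > 0"
        using leading_coeff_pos elim by auto
      then have "?H z / of_real (leading_coeff * z) - 1
            = (?H z - of_real (leading_coeff * z)) / of_real (leading_coeff * z)"
        using leading_coeff_pos elim by (simp add: diff_divide_distrib)
      then have "norm (?H z / of_real (leading_coeff * z) - 1)
            = norm (?H z - of_real (leading_coeff * z)) / (leading_coeff * z)"
        using pos by (simp only: norm_divide norm_of_real abs_of_pos)
      also have "\<dots> \<le> z powr \<rho> * M / (leading_coeff * z)"
        using fox_H_expansion[OF \<rho>] pos unfolding M_def by (intro divide_right_mono) auto
      also have "\<dots> = M / leading_coeff * z powr (\<rho> - 1)"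
        using elim by (simp add: powr_diff)
      finally show ?case .
    qed
    have "((\<lambda>z. z powr (\<rho> - 1)) \<longlongrightarrow> 0) (at_right 0)"
      using \<rho> by (auto intro!: tendsto_eq_intros tendsto_zero_powrI eventually_at_right_less eventually_mono[OF eventually_at_right_less])
    then have "((\<lambda>z. M / leading_coeff * z powr (\<rho> - 1)) \<longlongrightarrow> M / leading_coeff * 0) (at_right 0)"
      by (intro tendsto_mult tendsto_const)
    then show "((\<lambda>z. M / leading_coeff * z powr (\<rho> - 1)) \<longlongrightarrow> 0) (at_right 0)"
      by simp
  qed
  then show ?thesis
    by (simp add: LIM_zero_iff)
qed

text \<open>The filter expresses a joint limit in x and t, governed only by the similarity variable
  tending to 0. Since the quotient depends on (x, t) through this variable alone, the limit in one
  variable gives the claim without any further uniformity.\<close>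

theorem mainTheorem5:
  fixes \<alpha> \<beta> \<eta> :: real and N :: "real \<Rightarrow> real \<Rightarrow> complex"
  assumes "0 < \<beta>" "\<beta> \<le> 1" "1 < \<alpha>" "\<alpha> < 2" "0 < \<eta>"
    and N: "\<And>x t. t > 0 \<Longrightarrow> x \<noteq> 0 \<Longrightarrow>
      N x t = of_real (t powr (\<beta> - 1) / (\<alpha> * \<bar>x\<bar>)) *
        fox_H 2 1
          [(1, 1 / \<alpha>), (of_real \<beta>, \<beta> / \<alpha>), (1, 1 / 2)]
          [(1, 1), (1, 1 / \<alpha>), (1, 1 / 2)]
          (of_real (\<bar>x\<bar> / (\<eta> * t powr \<beta>) powr (1 / \<alpha>)))"
  shows "((\<lambda>(x, t). N x t /
            of_real (Gamma (1 + 1 / \<alpha>) * Gamma (1 - 1 / \<alpha>) /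
              (pi * \<eta> powr (1 / \<alpha>) * t powr (1 + \<beta> / \<alpha> - \<beta>) * Gamma (\<beta> - \<beta> / \<alpha>))))
          \<longlongrightarrow> 1)
         (inf (filtercomap (\<lambda>(x, t). \<bar>x\<bar> / (\<eta> * t powr \<beta>) powr (1 / \<alpha>)) (nhds 0))
              (principal {(x, t). x \<noteq> 0 \<and> t > 0}))"
proof -
  interpret fox_setting \<alpha> \<beta>
    by unfold_locales fact+
  define Z where "Z = (\<lambda>(x, t). \<bar>x\<bar> / (\<eta> * t powr \<beta>) powr (1 / \<alpha>))"
  define A where "A = {(x::real, t::real). x \<noteq> 0 \<and> t > 0}"
  let ?G = "inf (filtercomap Z (nhds 0)) (principal A)"
  have Z_pos: "Z p > 0" if "p \<in> A" for p
    using that \<open>0 < \<eta>\<close> by (auto simp: A_def Z_def)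
  have "filterlim Z (at_right 0) ?G"
    unfolding filterlim_at
  proof
    show "\<forall>\<^sub>F p in ?G. Z p \<in> {0<..} \<and> Z p \<noteq> 0"
    proof -
      have "\<forall>p\<in>A. Z p \<in> {0<..} \<and> Z p \<noteq> 0"
        using Z_pos by (metis greaterThan_iff less_irrefl)
      then show ?thesis
        by (simp add: eventually_inf_principal)
    qed
    show "(Z \<longlongrightarrow> 0) ?G"
      by (rule filterlim_mono[OF filterlim_filtercomap order_refl inf_le1])
  qed
  then have "((\<lambda>p. fox_H 2 1 upper_params lower_params (of_real (Z p)) / of_real (leading_coeff * Z p)) \<longlongrightarrow> 1) ?G"
    by (rule filterlim_compose[OF fox_H_asymptotics])
  moreover have "fox_H 2 1 upper_params lower_params (of_real (Z p)) / of_real (leading_coeff * Z p)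
      = (case p of (x, t) \<Rightarrow> N x t /
            of_real (Gamma (1 + 1 / \<alpha>) * Gamma (1 - 1 / \<alpha>) /
              (pi * \<eta> powr (1 / \<alpha>) * t powr (1 + \<beta> / \<alpha> - \<beta>) * Gamma (\<beta> - \<beta> / \<alpha>))))"
    if "p \<in> A" for p
  proof -
    from that obtain x t where p: "p = (x, t)" "x \<noteq> 0" "t > 0"
      by (auto simp: A_def)
    \<comment> \<open>The prefactor of \<open>N\<close>. It also occurs in the claimed asymptotic
      expression, which is c times the leading term of the H-function at \<open>Z p\<close>, the
      factor |x| cancelling; so c drops out of the quotient.\<close>
    define c where "c = t powr (\<beta> - 1) / (\<alpha> * \<bar>x\<bar>)"
    have "c > 0"
      using p \<open>1 < \<alpha>\<close> by (simp add: c_def)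
    have Z: "Z p = \<bar>x\<bar> / (\<eta> powr (1 / \<alpha>) * t powr (\<beta> / \<alpha>))"
      using p \<open>0 < \<eta>\<close> by (simp add: Z_def powr_mult powr_powr)
    have "t powr (1 + \<beta> / \<alpha> - \<beta>) = t powr (\<beta> / \<alpha> - (\<beta> - 1))"
      by (simp add: algebra_simps)
    also have "\<dots> = t powr (\<beta> / \<alpha>) / t powr (\<beta> - 1)"
      using p by (simp only: powr_diff)
    finally have t: "t powr (1 + \<beta> / \<alpha> - \<beta>) = t powr (\<beta> / \<alpha>) / t powr (\<beta> - 1)" .
    have "1 / \<alpha> \<notin> \<int>\<^sub>\<le>\<^sub>0"
      using \<open>1 < \<alpha>\<close> by (auto dest: nonpos_Ints_nonpos)
    \<comment> \<open>This absorbs the factor 1/\<alpha> of the prefactor.\<close>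
    then have "Gamma (1 + 1 / \<alpha>) = Gamma (1 / \<alpha>) / \<alpha>"
      using Gamma_plus1[of "1 / \<alpha>"] by (simp add: add.commute)
    then have "Gamma (1 + 1 / \<alpha>) * Gamma (1 - 1 / \<alpha>) /
              (pi * \<eta> powr (1 / \<alpha>) * t powr (1 + \<beta> / \<alpha> - \<beta>) * Gamma (\<beta> - \<beta> / \<alpha>))
           = c * (leading_coeff * Z p)"
      using p \<open>0 < \<eta>\<close> \<open>1 < \<alpha>\<close> unfolding Z t leading_coeff_def c_def by (simp add: mult_ac)
    moreover have "N x t = of_real c * fox_H 2 1 upper_params lower_params (of_real (Z p))"
      using N[OF p(3) p(2)] by (simp only: c_def Z_def p(1) prod.case upper_params_def lower_params_def)
    ultimately show ?thesis
      unfolding p(1) prod.case by (simp only: of_real_mult) (use \<open>c > 0\<close> in simp)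
  qed
  then have "\<forall>\<^sub>F p in ?G. fox_H 2 1 upper_params lower_params (of_real (Z p)) / of_real (leading_coeff * Z p)
      = (case p of (x, t) \<Rightarrow> N x t /
            of_real (Gamma (1 + 1 / \<alpha>) * Gamma (1 - 1 / \<alpha>) /
              (pi * \<eta> powr (1 / \<alpha>) * t powr (1 + \<beta> / \<alpha> - \<beta>) * Gamma (\<beta> - \<beta> / \<alpha>))))"
    by (simp add: eventually_inf_principal)
  ultimately show ?thesis
    unfolding Z_def[symmetric] A_def[symmetric] by (rule Lim_transform_eventually)
qed

end
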